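(* Let $m,n\ge1$ be integers, $\bm d=(d_1,\dots,d_n)\in\mathbb{N}_{\ge2}^n$, and let $Z:\bm t\in\Omega\mapsto Z(\bm t)\subset\mathbb{R}^{n\times n}$ be a semialgebraic family over a semialgebraic set $\Omega\subset\mathbb{R}^m$ with bounded fibres. Then for every $\bm t\in\Omega$ and every $\bm H=(H_1,\dots,H_n)$ with all $H_i\ge2$, $$\left|\frac{\#\big((\mathbb{A}_{\bm d}(\bm H))^n\cap Z(\bm t)\big)}{\prod_{i=1}^nH_i^{n(d_i+1)}}-\int_{Z(\bm t)}\prod_{k=1}^n\frac{\bm\rho_{\bm d}(\bm x^{(k)})\,d\bm x^{(k)}}{2^n\zeta(\bm d+\bm 1)}\right|\le M_1(Z,\bm d,n)\max_{1\le i\le n}\frac{(\log H_i)^{l(d_i)}}{H_i},$$ where $$M_1(Z,\bm d,n)=(d_1\cdots d_n)^n\left(2^{n^2}\max_{1\le i\le n}E_1(d_i)+2^{n(2D+1)+1}p(Z,\bm d)\,(2p(Z,\bm d)-1)^{n+s(Z,\bm d)-1}\right),$$ $E_1(d)=6d^2\,2^{d(d-2)}(d+1)^{d/2}$, $D=\sum_{i=1}^n(d_i+1)$, $s(Z,\bm d)=3S^{2^{D+n}}P^{(16^{D+n}-1)\lceil\log P/\log2\rceil}$, $p(Z,\bm d)=4^{(4^{D+n}-1)/3}P^{4^{D+n}}$, $S=s(Z)+n(D+(d_1\cdots d_n)^n+1)$ and $P=\max\{p(Z),\max_jd_j\}$.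
   Context: A semialgebraic family is a map $Z$ from a semialgebraic set $\Omega\subset\mathbb{R}^m$ to subsets of $\mathbb{R}^N$ whose graph $Z^*=\{(\bm t,\bm x):\bm x\in Z(\bm t)\}$ is semialgebraic; $Z(\bm t)$ is the fibre over $\bm t$. $s(Z)$ and $p(Z)$ denote, for a fixed given description of $Z^*$ by polynomial equalities and inequalities, the number of such relations and the maximal degree of the polynomials involved. $\mathbb{A}_d(H)$ is the set of real algebraic numbers of degree exactly $d$ with naive height (maximum absolute value of the coefficients of the primitive minimal polynomial in $\mathbb{Z}[X]$) at most $H$; $\mathbb{A}_{\bm d}(\bm H)=\prod_{j=1}^n\mathbb{A}_{d_j}(H_j)\subset\mathbb{R}^n$, and $(\mathbb{A}_{\bm d}(\bm H))^n\subset(\mathbb{R}^n)^n=\mathbb{R}^{n\times n}$, whose points are written $(\bm x^{(1)},\dots,\bm x^{(n)})$ with $\bm x^{(k)}\in\mathbb{R}^n$ and $d\bm x^{(k)}$ Lebesgue measure on $\mathbb{R}^n$. Koleda's density is $\rho_d(x)=\int_{\Delta_d(x)}|\sum_{k=1}^dkp_kx^{k-1}|\,dp_1\cdots dp_d$, $\Delta_d(x)=\{(p_1,\dots,p_d)\in[-1,1]^d:|\sum_{k=1}^dp_kx^k|\le1\}$; $\bm\rho_{\bm d}(\bm x)=\prod_{i=1}^n\rho_{d_i}(x_i)$ and $\zeta(\bm d+\bm1)=\prod_{i=1}^n\zeta(d_i+1)$ with $\zeta$ the Riemann zeta function. $l(d)=1$ if $d=2$, $0$ otherwise. *)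

theory Defs
  imports
    "HOL-Analysis.Analysis"
    "HOL-Computational_Algebra.Computational_Algebra"
    "HOL-Library.Poly_Mapping"
begin

type_synonym 'v rpoly = "('v \<Rightarrow>\<^sub>0 nat) \<Rightarrow>\<^sub>0 real"

definition rpoly_eval :: "'v rpoly \<Rightarrow> ('v \<Rightarrow> real) \<Rightarrow> real" where
  "rpoly_eval p x =
     (\<Sum>a\<in>Poly_Mapping.keys p. Poly_Mapping.lookup p a *
        (\<Prod>v\<in>Poly_Mapping.keys a. x v ^ Poly_Mapping.lookup a v))"

definition total_degree :: "'v rpoly \<Rightarrow> nat" where
  "total_degree p =
     Max (insert 0 ((\<lambda>a. \<Sum>v\<in>Poly_Mapping.keys a. Poly_Mapping.lookup a v) `
       Poly_Mapping.keys p))"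

text \<open>
  A polynomial relation compares a polynomial with 0, so \<open>f < 0\<close> and \<open>f \<le> 0\<close> are
  \<open>Gt (- f)\<close> and \<open>Ge (- f)\<close>.  A description of a semialgebraic set is a Boolean
  combination of finitely many such relations.
\<close>

datatype 'v relation = Eq "'v rpoly" | Gt "'v rpoly" | Ge "'v rpoly"

primrec relation_poly :: "'v relation \<Rightarrow> 'v rpoly" where
  "relation_poly (Eq f) = f"
| "relation_poly (Gt f) = f"
| "relation_poly (Ge f) = f"

primrec relation_holds :: "'v relation \<Rightarrow> ('v \<Rightarrow> real) \<Rightarrow> bool" where
  "relation_holds (Eq f) x \<longleftrightarrow> rpoly_eval f x = 0"
| "relation_holds (Gt f) x \<longleftrightarrow> rpoly_eval f x > 0"
| "relation_holds (Ge f) x \<longleftrightarrow> rpoly_eval f x \<ge> 0"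

datatype 'v description =
    Rel "'v relation"
  | Neg "'v description"
  | Conj "'v description" "'v description"
  | Disj "'v description" "'v description"

primrec holds :: "'v description \<Rightarrow> ('v \<Rightarrow> real) \<Rightarrow> bool" where
  "holds (Rel r) x \<longleftrightarrow> relation_holds r x"
| "holds (Neg \<phi>) x \<longleftrightarrow> \<not> holds \<phi> x"
| "holds (Conj \<phi> \<psi>) x \<longleftrightarrow> holds \<phi> x \<and> holds \<psi> x"
| "holds (Disj \<phi> \<psi>) x \<longleftrightarrow> holds \<phi> x \<or> holds \<psi> x"

primrec relations :: "'v description \<Rightarrow> 'v relation set" where
  "relations (Rel r) = {r}"
| "relations (Neg \<phi>) = relations \<phi>"
| "relations (Conj \<phi> \<psi>) = relations \<phi> \<union> relations \<psi>"
| "relations (Disj \<phi> \<psi>) = relations \<phi> \<union> relations \<psi>"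

definition num_relations :: "'v description \<Rightarrow> nat" where
  "num_relations \<phi> = card (relations \<phi>)"

definition max_degree :: "'v description \<Rightarrow> nat" where
  "max_degree \<phi> = Max ((\<lambda>r. total_degree (relation_poly r)) ` relations \<phi>)"

definition describes :: "'v description \<Rightarrow> (real ^ 'v :: finite) set \<Rightarrow> bool" where
  "describes \<phi> A \<longleftrightarrow> A = {x. holds \<phi> (\<lambda>v. x $ v)}"

definition semialgebraic :: "(real ^ 'v :: finite) set \<Rightarrow> bool" where
  "semialgebraic A \<longleftrightarrow> (\<exists>\<phi>. describes \<phi> A)"

text \<open>
  The point \<open>(t, x)\<close> of \<open>\<real>\<^sup>m \<times> \<real>\<^sup>n\<^sup>\<times>\<^sup>n\<close>, with coordinates indexed by the disjoint union of
  the index sets.  The row \<open>x $ k\<close> of a matrix is the \<open>k\<close>-th vector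
  \<open>x\<^bsup>(k)\<^esup>\<close> of the \<open>n\<close>-tuple, and \<open>x $ k $ i\<close> is its \<open>i\<close>-th coordinate.
\<close>

definition joint_point ::
    "real ^ 'm :: finite \<Rightarrow> real ^ 'n ^ 'n :: finite \<Rightarrow> real ^ ('m + 'n \<times> 'n)" where
  "joint_point t x =
     (\<chi> v. case v of Inl j \<Rightarrow> t $ j | Inr (k, i) \<Rightarrow> x $ k $ i)"

definition family_graph ::
    "(real ^ 'm :: finite) set \<Rightarrow> (real ^ 'm \<Rightarrow> (real ^ 'n ^ 'n :: finite) set)
      \<Rightarrow> (real ^ ('m + 'n \<times> 'n)) set" where
  "family_graph \<Omega> Z = {joint_point t x | t x. t \<in> \<Omega> \<and> x \<in> Z t}"

definition semialgebraic_family ::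
    "(real ^ 'm :: finite) set \<Rightarrow> (real ^ 'm \<Rightarrow> (real ^ 'n ^ 'n :: finite) set) \<Rightarrow> bool" where
  "semialgebraic_family \<Omega> Z \<longleftrightarrow> semialgebraic \<Omega> \<and> semialgebraic (family_graph \<Omega> Z)"

text \<open>
  An integer polynomial of least degree among those vanishing at \<open>x\<close> is a multiple of the
  minimal polynomial of \<open>x\<close> over the rationals; content 1 and a positive leading
  coefficient single out one of these multiples.
\<close>

definition primitive_minpoly :: "real \<Rightarrow> int poly \<Rightarrow> bool" where
  "primitive_minpoly x p \<longleftrightarrow>
     p \<noteq> 0 \<and> poly (map_poly of_int p) x = 0 \<and>
     (\<forall>q :: int poly. q \<noteq> 0 \<and> poly (map_poly of_int q) x = 0 \<longrightarrow>
        Polynomial.degree p \<le> Polynomial.degree q) \<and>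
     Polynomial.content p = 1 \<and> lead_coeff p > 0"

definition naive_height :: "int poly \<Rightarrow> int" where
  "naive_height p = Max ((\<lambda>k. \<bar>coeff p k\<bar>) ` {..Polynomial.degree p})"

definition alg_numbers :: "nat \<Rightarrow> real \<Rightarrow> real set" where
  "alg_numbers d H =
     {x. algebraic x \<and>
         (\<exists>p. primitive_minpoly x p \<and> Polynomial.degree p = d \<and>
              of_int (naive_height p) \<le> H)}"

definition alg_vectors :: "('n \<Rightarrow> nat) \<Rightarrow> ('n \<Rightarrow> real) \<Rightarrow> (real ^ 'n :: finite) set" where
  "alg_vectors d H = {x. \<forall>j. x $ j \<in> alg_numbers (d j) (H j)}"

definition alg_matrices :: "('n \<Rightarrow> nat) \<Rightarrow> ('n \<Rightarrow> real) \<Rightarrow> (real ^ 'n ^ 'n :: finite) set" where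
  "alg_matrices d H = {x. \<forall>k. x $ k \<in> alg_vectors d H}"

definition Delta :: "nat \<Rightarrow> real \<Rightarrow> (nat \<Rightarrow> real) set" where
  "Delta d x = {p \<in> {1..d} \<rightarrow>\<^sub>E {-1..1}. \<bar>\<Sum>k=1..d. p k * x ^ k\<bar> \<le> 1}"

definition rho :: "nat \<Rightarrow> real \<Rightarrow> real" where
  "rho d x = (LINT p:Delta d x | Pi\<^sub>M {1..d} (\<lambda>_. lborel).
                \<bar>\<Sum>k=1..d. real k * p k * x ^ (k - 1)\<bar>)"

definition rho_vec :: "('n \<Rightarrow> nat) \<Rightarrow> real ^ 'n :: finite \<Rightarrow> real" where
  "rho_vec d x = (\<Prod>i\<in>UNIV. rho (d i) (x $ i))"

text \<open>Only used at integers at least 3, where the Dirichlet series converges.\<close>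

definition zeta :: "nat \<Rightarrow> real" where
  "zeta s = suminf (\<lambda>k. 1 / real (Suc k) ^ s)"

definition zeta_vec :: "('n :: finite \<Rightarrow> nat) \<Rightarrow> real" where
  "zeta_vec d = (\<Prod>i\<in>UNIV. zeta (d i + 1))"

definition l_exp :: "nat \<Rightarrow> nat" where
  "l_exp d = (if d = 2 then 1 else 0)"

definition E1 :: "nat \<Rightarrow> real" where
  "E1 d = 6 * real d ^ 2 * 2 ^ (d * (d - 2)) * real (d + 1) powr (real d / 2)"

definition D_const :: "('n :: finite \<Rightarrow> nat) \<Rightarrow> nat" where
  "D_const d = (\<Sum>i\<in>UNIV. (d i + 1))"

definition S_const :: "'v description \<Rightarrow> ('n :: finite \<Rightarrow> nat) \<Rightarrow> nat" where
  "S_const \<phi> d =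
     num_relations \<phi> + CARD('n) * (D_const d + (\<Prod>i\<in>UNIV. d i) ^ CARD('n) + 1)"

definition P_const :: "'v description \<Rightarrow> ('n :: finite \<Rightarrow> nat) \<Rightarrow> nat" where
  "P_const \<phi> d = max (max_degree \<phi>) (MAX j. d j)"

definition s_const :: "'v description \<Rightarrow> ('n :: finite \<Rightarrow> nat) \<Rightarrow> nat" where
  "s_const \<phi> d =
     3 * S_const \<phi> d ^ (2 ^ (D_const d + CARD('n)))
       * P_const \<phi> d ^ ((16 ^ (D_const d + CARD('n)) - 1)
            * nat \<lceil>ln (real (P_const \<phi> d)) / ln 2\<rceil>)"

text \<open>The division by 3 in the exponent is exact.\<close>

definition p_const :: "'v description \<Rightarrow> ('n :: finite \<Rightarrow> nat) \<Rightarrow> nat" where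
  "p_const \<phi> d =
     4 ^ ((4 ^ (D_const d + CARD('n)) - 1) div 3)
       * P_const \<phi> d ^ (4 ^ (D_const d + CARD('n)))"

definition M1 :: "'v description \<Rightarrow> ('n :: finite \<Rightarrow> nat) \<Rightarrow> real" where
  "M1 \<phi> d =
     real (\<Prod>i\<in>UNIV. d i) ^ CARD('n) *
       (2 ^ (CARD('n) ^ 2) * (MAX i. E1 (d i))
        + 2 ^ (CARD('n) * (2 * D_const d + 1) + 1)
          * real (p_const \<phi> d)
          * (2 * real (p_const \<phi> d) - 1) ^ (CARD('n) + s_const \<phi> d - 1))"

end

theory Submission
  imports Defs
begin

text \<open>
  Neither quantifier elimination nor the counting of connected components is needed.  A point of
  \<open>(\<real>\<^sup>n)\<^sup>n\<close> has \<open>n\<^sup>2\<close> coordinates.  For each of them the normalised counting measure on the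
  algebraic numbers of degree \<open>d\<close> and height at most \<open>H\<close> is close, on every interval, to the
  measure with density \<open>\<rho>\<^sub>d / (2 \<zeta>(d + 1))\<close> (Koleda).  Replacing one of these factors of the
  product measure by the other one coordinate at a time only involves sections of \<open>Z(t)\<close> along
  coordinate lines, and these are unions of at most \<open>2 s(Z) p(Z) + 1\<close> intervals, since they are
  described by \<open>s(Z)\<close> univariate polynomials of degree at most \<open>p(Z)\<close>.

  The same one-coordinate-at-a-time principle yields the one-dimensional estimate.  The sum over
  the integer polynomials of height at most \<open>H\<close> of the number of roots in an interval is compared
  with the corresponding integral: if a single coefficient varies, the number of roots is a sum of
  \<open>2 d + 3\<close> indicators of intervals.  The area formula identifies the integral, a sieve passes to
  primitive polynomials, and a count of factorisations removes the reducible ones.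

  The constants obtained are tiny compared with the doubly exponential \<open>M\<^sub>1\<close>.
\<close>

section \<open>Product measures differing in the factors\<close>

text \<open>The exchange of factors is used twice: for the \<open>d + 1\<close> coefficients of a
  polynomial, scaled into [-1, 1], and for the entries of the matrix. Hence the one-dimensional
  statements are about arbitrary intervals, unbounded ones included, with an error that does not see
  the interval. Frozen coordinates may be arbitrary reals, so degenerate lines have to be covered as
  well, for instance a polynomial in which only the varying coefficient can be nonzero.

  The limiting density has the denominator 2 zeta(d + 1): zeta(d + 1) enters when polynomials are
  restricted to content 1, and 2 because a minimal polynomial and its negative have the same roots.
  The logarithm for d = 2 comes from products of two linear polynomials: summing over the height of
  one factor produces a harmonic sum, while for d at least 3 the analogous sums converge.\<close>

definition mass_le :: "real measure \<Rightarrow> real \<Rightarrow> bool" where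
  "mass_le M c \<longleftrightarrow> sets M = sets borel \<and> finite_measure M \<and> measure M UNIV \<le> c"

lemma mass_leD:
  assumes "mass_le M c"
  shows "sets M = sets borel" "space M = UNIV" "finite_measure M" "measure M UNIV \<le> c" "0 \<le> c"
proof -
  show 1: "sets M = sets borel" "finite_measure M" "measure M UNIV \<le> c"
    using assms by (auto simp: mass_le_def)
  show "space M = UNIV" using sets_eq_imp_space_eq[OF 1(1)] by simp
  show "0 \<le> c" using 1(3) measure_nonneg order_trans by blast
qed

lemma PiM_mass:
  assumes "\<And>i. mass_le (M i) (m i)" "finite I"
  shows "finite_measure (Pi\<^sub>M I M)" "measure (Pi\<^sub>M I M) (space (Pi\<^sub>M I M)) \<le> (\<Prod>i\<in>I. m i)"
proof -
  note D = mass_leD[OF assms(1)]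
  interpret product_sigma_finite M
    using D(3) by (auto simp: product_sigma_finite_def finite_measure_def)
  have "emeasure (Pi\<^sub>M I M) (space (Pi\<^sub>M I M)) = (\<Prod>i\<in>I. emeasure (M i) (space (M i)))"
    unfolding space_PiM by (rule emeasure_PiM) (use assms in auto)
  also have "\<dots> = (\<Prod>i\<in>I. ennreal (measure (M i) UNIV))"
    using D(2,3) by (intro prod.cong refl) (metis finite_measure.emeasure_eq_measure)
  also have "\<dots> = ennreal (\<Prod>i\<in>I. measure (M i) UNIV)"
    by (simp add: prod_ennreal)
  finally have e: "emeasure (Pi\<^sub>M I M) (space (Pi\<^sub>M I M)) = ennreal (\<Prod>i\<in>I. measure (M i) UNIV)" .
  show "finite_measure (Pi\<^sub>M I M)"
    by (rule finite_measureI) (simp add: e)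
  have "measure (Pi\<^sub>M I M) (space (Pi\<^sub>M I M)) = (\<Prod>i\<in>I. measure (M i) UNIV)"
    unfolding measure_def[of "Pi\<^sub>M I M"] e by (simp add: prod_nonneg)
  also have "\<dots> \<le> (\<Prod>i\<in>I. m i)"
    using D by (intro prod_mono) auto
  finally show "measure (Pi\<^sub>M I M) (space (Pi\<^sub>M I M)) \<le> (\<Prod>i\<in>I. m i)" .
qed

text \<open>Fubini isolates the coordinate \<open>i\<close>. On the other coordinates the two
  products are the same measure, so the difference of the integrals is an integral of differences on
  lines; \<open>line\<close> bounds these by \<open>e\<close>, and the product of the
  \<open>m j\<close> bounds the mass of what is integrated over.\<close>

lemma PiM_integral_change_one:
  fixes f :: "('i \<Rightarrow> real) \<Rightarrow> real"
  assumes M: "\<And>j. mass_le (M j) (m j)" and N: "\<And>j. mass_le (N j) (m j)"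
    and I: "finite I" "i \<in> I" and agree: "\<And>j. j \<noteq> i \<Longrightarrow> M j = N j"
    and f: "f \<in> borel_measurable (Pi\<^sub>M I (\<lambda>_. borel))"
    and B: "\<And>x. \<bar>f x\<bar> \<le> B"
    and line: "\<And>x. x \<in> space (Pi\<^sub>M (I - {i}) (\<lambda>_. borel :: real measure)) \<Longrightarrow>
       \<bar>(\<integral>y. f (x(i := y)) \<partial>M i) - (\<integral>y. f (x(i := y)) \<partial>N i)\<bar> \<le> e"
  shows "\<bar>(\<integral>x. f x \<partial>Pi\<^sub>M I M) - (\<integral>x. f x \<partial>Pi\<^sub>M I N)\<bar> \<le> e * (\<Prod>j\<in>I - {i}. m j)"
proof -
  note DM = mass_leD[OF M] and DN = mass_leD[OF N]
  interpret PM: product_sigma_finite M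
    using DM(3) by (auto simp: product_sigma_finite_def finite_measure_def)
  interpret PN: product_sigma_finite N
    using DN(3) by (auto simp: product_sigma_finite_def finite_measure_def)
  let ?J = "I - {i}"
  have J: "finite ?J" "i \<notin> ?J" and ins: "insert i ?J = I" using I by auto
  have eq: "Pi\<^sub>M ?J M = Pi\<^sub>M ?J N" using agree by (intro PiM_cong) auto
  have sp: "space (Pi\<^sub>M ?J N) = space (Pi\<^sub>M ?J (\<lambda>_. borel :: real measure))"
    using DN(2) by (simp add: space_PiM)
  have seM: "sets (Pi\<^sub>M A M) = sets (Pi\<^sub>M A (\<lambda>_. borel))" for A
    using DM(1) by (intro sets_PiM_cong) auto
  have seN: "sets (Pi\<^sub>M A N) = sets (Pi\<^sub>M A (\<lambda>_. borel))" for A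
    using DN(1) by (intro sets_PiM_cong) auto
  have fM: "f \<in> borel_measurable (Pi\<^sub>M I M)" using f measurable_cong_sets[OF seM refl] by blast
  have fN: "f \<in> borel_measurable (Pi\<^sub>M I N)" using f measurable_cong_sets[OF seN refl] by blast
  interpret FM: finite_measure "Pi\<^sub>M I M" by (rule PiM_mass[OF M I(1)])
  interpret FN: finite_measure "Pi\<^sub>M I N" by (rule PiM_mass[OF N I(1)])
  interpret FJ: finite_measure "Pi\<^sub>M ?J N" by (rule PiM_mass[OF N J(1)])
  have iM: "integrable (Pi\<^sub>M (insert i ?J) M) f"
    unfolding ins by (rule FM.integrable_const_bound[of _ B]) (use B fM in auto)
  have iN: "integrable (Pi\<^sub>M (insert i ?J) N) f"
    unfolding ins by (rule FN.integrable_const_bound[of _ B]) (use B fN in auto)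
  have B0: "0 \<le> B" using B[of undefined] by linarith
  \<comment> \<open>The sign of \<open>e\<close> can be read off \<open>line\<close> only at a point
    of the product space, hence the condition; that the space is nonempty is settled where the bound
    is used.\<close>
  have e0: "0 \<le> e" if "space (Pi\<^sub>M ?J N) \<noteq> {}"
    using that line unfolding sp by (meson abs_ge_zero all_not_in_conv order_trans)
  have upd: "(\<lambda>p. (fst p)(i := snd p)) \<in> (Pi\<^sub>M ?J (\<lambda>_. borel)) \<Otimes>\<^sub>M borel \<rightarrow>\<^sub>M Pi\<^sub>M I (\<lambda>_. borel :: real measure)"
    using measurable_add_dim[of i ?J "\<lambda>_. borel :: real measure"] unfolding ins
    by (simp add: case_prod_unfold)
  have jm: "(\<lambda>(x, y). f (x(i := y))) \<in> borel_measurable (Pi\<^sub>M ?J (\<lambda>_. borel) \<Otimes>\<^sub>M borel)"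
    using measurable_comp[OF upd f] by (simp add: comp_def case_prod_unfold)
  have gM: "(\<lambda>x. \<integral>y. f (x(i := y)) \<partial>M i) \<in> borel_measurable (Pi\<^sub>M ?J N)"
  proof (rule sigma_finite_measure.borel_measurable_lebesgue_integral)
    show "sigma_finite_measure (M i)" using DM(3) by (rule finite_measure.axioms)
    show "(\<lambda>(x, y). f (x(i := y))) \<in> borel_measurable (Pi\<^sub>M ?J N \<Otimes>\<^sub>M M i)"
      using jm measurable_cong_sets[OF sets_pair_measure_cong[OF seN[of ?J] DM(1)[of i]] refl] by blast
  qed
  have gN: "(\<lambda>x. \<integral>y. f (x(i := y)) \<partial>N i) \<in> borel_measurable (Pi\<^sub>M ?J N)"
  proof (rule sigma_finite_measure.borel_measurable_lebesgue_integral)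
    show "sigma_finite_measure (N i)" using DN(3) by (rule finite_measure.axioms)
    show "(\<lambda>(x, y). f (x(i := y))) \<in> borel_measurable (Pi\<^sub>M ?J N \<Otimes>\<^sub>M N i)"
      using jm measurable_cong_sets[OF sets_pair_measure_cong[OF seN[of ?J] DN(1)[of i]] refl] by blast
  qed
  have bnd: "norm (\<integral>y. f (x(i := y)) \<partial>K) \<le> B * c" if "mass_le K c" for K x c
  proof -
    interpret finite_measure K by (rule mass_leD[OF that])
    have "norm (\<integral>y. f (x(i := y)) \<partial>K) \<le> (\<integral>y. norm (f (x(i := y))) \<partial>K)" by (rule integral_norm_bound)
    also have "\<dots> \<le> (\<integral>y. B \<partial>K)" 
      by (rule integral_mono') (use B in \<open>auto simp: B0\<close>)
    also have "\<dots> \<le> B * c" using mult_left_mono[OF mass_leD(4)[OF that] B0] mass_leD(2)[OF that] by (simp add: mult.commute)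
    finally show ?thesis .
  qed
  have hM: "integrable (Pi\<^sub>M ?J N) (\<lambda>x. \<integral>y. f (x(i := y)) \<partial>M i)"
    by (rule FJ.integrable_const_bound[of _ "B * m i"]) (use gM bnd[OF M] in auto)
  have hN: "integrable (Pi\<^sub>M ?J N) (\<lambda>x. \<integral>y. f (x(i := y)) \<partial>N i)"
    by (rule FJ.integrable_const_bound[of _ "B * m i"]) (use gN bnd[OF N] in auto)
  have "(\<integral>x. f x \<partial>Pi\<^sub>M I M) - (\<integral>x. f x \<partial>Pi\<^sub>M I N)
      = (\<integral>x. (\<integral>y. f (x(i := y)) \<partial>M i) \<partial>Pi\<^sub>M ?J N) - (\<integral>x. (\<integral>y. f (x(i := y)) \<partial>N i) \<partial>Pi\<^sub>M ?J N)"
    using PM.product_integral_insert[OF J iM] PN.product_integral_insert[OF J iN] unfolding ins eq by simp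
  also have "\<dots> = (\<integral>x. (\<integral>y. f (x(i := y)) \<partial>M i) - (\<integral>y. f (x(i := y)) \<partial>N i) \<partial>Pi\<^sub>M ?J N)"
    using hM hN by simp
  finally have diff: "(\<integral>x. f x \<partial>Pi\<^sub>M I M) - (\<integral>x. f x \<partial>Pi\<^sub>M I N)
      = (\<integral>x. (\<integral>y. f (x(i := y)) \<partial>M i) - (\<integral>y. f (x(i := y)) \<partial>N i) \<partial>Pi\<^sub>M ?J N)" .
  have "\<bar>(\<integral>x. f x \<partial>Pi\<^sub>M I M) - (\<integral>x. f x \<partial>Pi\<^sub>M I N)\<bar> \<le>
      (\<integral>x. norm ((\<integral>y. f (x(i := y)) \<partial>M i) - (\<integral>y. f (x(i := y)) \<partial>N i)) \<partial>Pi\<^sub>M ?J N)"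
    unfolding diff real_norm_def[symmetric] by (rule integral_norm_bound)
  also have "\<dots> \<le> (\<integral>x. e \<partial>Pi\<^sub>M ?J N)"
    by (rule integral_mono) (use line hM hN in \<open>simp_all add: sp\<close>)
  also have "\<dots> = measure (Pi\<^sub>M ?J N) (space (Pi\<^sub>M ?J N)) * e" by simp
  also have "\<dots> \<le> (\<Prod>j\<in>?J. m j) * e"
  proof (cases "space (Pi\<^sub>M ?J N) = {}")
    case True
    then have False using DN(2) by (auto simp: space_PiM PiE_eq_empty_iff)
    then show ?thesis ..
  next
    case False
    then show ?thesis using e0 PiM_mass(2)[OF N J(1)] by (intro mult_right_mono) auto
  qed
  finally show ?thesis by (simp add: mult.commute)
qed

text \<open>A hybrid argument: \<open>K J\<close> has the new factors on \<open>J\<close> and the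
  old ones elsewhere, so enlarging \<open>J\<close> by one index changes a single factor and the
  errors add up.\<close>

lemma PiM_integral_change_all:
  fixes f :: "('i \<Rightarrow> real) \<Rightarrow> real"
  assumes M: "\<And>j. mass_le (M j) (m j)" and N: "\<And>j. mass_le (N j) (m j)"
    and I: "finite I"
    and f: "f \<in> borel_measurable (Pi\<^sub>M I (\<lambda>_. borel))"
    and B: "\<And>x. \<bar>f x\<bar> \<le> B"
    and line: "\<And>i x. i \<in> I \<Longrightarrow> x \<in> space (Pi\<^sub>M (I - {i}) (\<lambda>_. borel :: real measure)) \<Longrightarrow>
       \<bar>(\<integral>y. f (x(i := y)) \<partial>M i) - (\<integral>y. f (x(i := y)) \<partial>N i)\<bar> \<le> e i"
  shows "\<bar>(\<integral>x. f x \<partial>Pi\<^sub>M I M) - (\<integral>x. f x \<partial>Pi\<^sub>M I N)\<bar> \<le> (\<Sum>i\<in>I. e i * (\<Prod>j\<in>I - {i}. m j))"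
proof -
  define K where "K = (\<lambda>J i. if i \<in> J then N i else M i)"
  have KJ: "mass_le (K J i) (m i)" for J i using M N by (auto simp: K_def)
  have "J \<subseteq> I \<Longrightarrow> \<bar>(\<integral>x. f x \<partial>Pi\<^sub>M I M) - (\<integral>x. f x \<partial>Pi\<^sub>M I (K J))\<bar> \<le> (\<Sum>i\<in>J. e i * (\<Prod>j\<in>I - {i}. m j))" for J
  proof (induction J rule: infinite_finite_induct)
    case (insert i J)
    have "\<bar>(\<integral>x. f x \<partial>Pi\<^sub>M I (K J)) - (\<integral>x. f x \<partial>Pi\<^sub>M I (K (insert i J)))\<bar> \<le> e i * (\<Prod>j\<in>I - {i}. m j)"
      using insert by (intro PiM_integral_change_one[where m=m and B=B] KJ I f B) (auto simp: K_def intro: line)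
    with insert show ?case by auto
  qed (use I finite_subset in \<open>auto simp: K_def\<close>)
  from this[of I] have "\<bar>(\<integral>x. f x \<partial>Pi\<^sub>M I M) - (\<integral>x. f x \<partial>Pi\<^sub>M I (K I))\<bar> \<le> (\<Sum>i\<in>I. e i * (\<Prod>j\<in>I - {i}. m j))" by simp
  moreover have "Pi\<^sub>M I (K I) = Pi\<^sub>M I N" by (intro PiM_cong) (auto simp: K_def)
  ultimately show ?thesis by simp
qed

text \<open>\<open>point_measure\<close> lives on the subsets of \<open>S\<close>; pushing it
  forward along the identity to \<open>borel\<close> gives a measure on the whole line, as
  \<open>mass_le\<close> demands.\<close>

definition point_masses :: "real set \<Rightarrow> real \<Rightarrow> real measure" where
  "point_masses S w = distr (point_measure S (\<lambda>_. ennreal w)) borel (\<lambda>x. x)"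

lemma sets_point_masses [simp]: "sets (point_masses S w) = sets borel"
  by (simp add: point_masses_def)

lemma integral_point_masses:
  fixes f :: "real \<Rightarrow> real"
  assumes "finite S" "0 \<le> w" "f \<in> borel_measurable borel"
  shows "(\<integral>x. f x \<partial>point_masses S w) = (\<Sum>x\<in>S. w * f x)"
  using assms unfolding point_masses_def
  by (subst integral_distr) (auto simp: measurable_point_measure_eq1 lebesgue_integral_point_measure_finite)

lemma emeasure_point_masses:
  assumes "finite S" "0 \<le> w" "A \<in> sets borel"
  shows "emeasure (point_masses S w) A = ennreal (w * card (A \<inter> S))"
proof -
  have "emeasure (point_masses S w) A = (\<Sum>x | x \<in> S \<and> x \<in> A. ennreal w)"
    using assms unfolding point_masses_def
    by (subst emeasure_distr) (simp_all add: measurable_point_measure_eq1 space_point_measure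
       emeasure_point_measure_finite vimage_def Int_def conj_commute subset_eq)
  also have "\<dots> = ennreal (w * card (A \<inter> S))"
    using assms(2) by (simp add: ennreal_of_nat_eq_real_of_nat ennreal_mult mult.commute Int_def conj_commute)
  finally show ?thesis .
qed

lemma mass_le_point_masses:
  fixes w c :: real
  assumes "finite S" "0 \<le> w" "w * card S \<le> c"
  shows "mass_le (point_masses S w) c"
proof -
  have sp: "space (point_masses S w) = UNIV" by (simp add: point_masses_def)
  have e: "emeasure (point_masses S w) UNIV = ennreal (w * card S)"
    using emeasure_point_masses[OF assms(1,2), of UNIV] by simp
  show ?thesis
    unfolding mass_le_def measure_def e using assms
    by (auto intro!: finite_measureI simp: sp e)
qed

lemma measurable_fun_upd_line:
  fixes f :: "('i \<Rightarrow> real) \<Rightarrow> real"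
  assumes "f \<in> borel_measurable (Pi\<^sub>M I (\<lambda>_. borel))" "i \<in> I"
    "x \<in> space (Pi\<^sub>M (I - {i}) (\<lambda>_. borel :: real measure))"
  shows "(\<lambda>y. f (x(i := y))) \<in> borel_measurable borel"
proof -
  have "insert i (I - {i}) = I" using assms(2) by auto
  then have "(\<lambda>y. x(i := y)) \<in> borel \<rightarrow>\<^sub>M Pi\<^sub>M I (\<lambda>_. borel :: real measure)"
    using measurable_component_update[OF assms(3), of i] by simp
  from measurable_comp[OF this assms(1)] show ?thesis by (simp add: comp_def)
qed

text \<open>Recovers counting from the discrete product measure: Fubini, one coordinate at a time,
  turns the integral into a weighted sum over a finite box. For \<open>f\<close> a number of roots
  or an indicator, this sum is the quantity to be estimated.\<close>

lemma integral_PiM_point_masses: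
  fixes f :: "('i \<Rightarrow> real) \<Rightarrow> real"
  assumes I: "finite I" and S: "\<And>i. finite (S i)" and w: "\<And>i. 0 \<le> w i"
    and f: "f \<in> borel_measurable (Pi\<^sub>M I (\<lambda>_. borel))" and B: "\<And>x. \<bar>f x\<bar> \<le> B"
  shows "(\<integral>x. f x \<partial>Pi\<^sub>M I (\<lambda>i. point_masses (S i) (w i))) = (\<Prod>i\<in>I. w i) * (\<Sum>x\<in>Pi\<^sub>E I S. f x)"
  using I f B
proof (induction I arbitrary: f rule: finite_induct)
  case empty
  then show ?case by (simp add: PiM_empty lebesgue_integral_count_space_finite)
next
  case (insert i I)
  let ?M = "\<lambda>i. point_masses (S i) (w i)"
  have M: "mass_le (?M i) (w i * card (S i))" for i by (rule mass_le_point_masses) (use S w in auto)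
  note DM = mass_leD[OF M]
  interpret PM: product_sigma_finite ?M
    using DM(3) by (auto simp: product_sigma_finite_def finite_measure_def)
  have seM: "sets (Pi\<^sub>M A ?M) = sets (Pi\<^sub>M A (\<lambda>_. borel))" for A
    using DM(1) by (intro sets_PiM_cong) auto
  have spM: "space (Pi\<^sub>M A ?M) = space (Pi\<^sub>M A (\<lambda>_. borel :: real measure))" for A
    using seM by (rule sets_eq_imp_space_eq)
  interpret FM: finite_measure "Pi\<^sub>M (insert i I) ?M" by (rule PiM_mass[OF M]) (use insert in auto)
  have fM: "f \<in> borel_measurable (Pi\<^sub>M (insert i I) ?M)" using insert.prems(1) measurable_cong_sets[OF seM refl] by blast
  have int: "integrable (Pi\<^sub>M (insert i I) ?M) f"
    by (rule FM.integrable_const_bound[of _ B]) (use insert.prems fM in auto)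
  have fix_meas: "(\<lambda>x. f (x(i := y))) \<in> borel_measurable (Pi\<^sub>M I (\<lambda>_. borel))" for y
  proof -
    have "(\<lambda>x. x(i := y)) \<in> Pi\<^sub>M I (\<lambda>_. borel) \<rightarrow>\<^sub>M Pi\<^sub>M (insert i I) (\<lambda>_. borel :: real measure)"
      by (rule measurable_fun_upd[where J=I]) auto
    from measurable_comp[OF this insert.prems(1)] show ?thesis by (simp add: comp_def)
  qed
  have "(\<integral>x. f x \<partial>Pi\<^sub>M (insert i I) ?M) = (\<integral>x. (\<integral>y. f (x(i := y)) \<partial>?M i) \<partial>Pi\<^sub>M I ?M)"
    by (rule PM.product_integral_insert[OF insert(1,2) int])
  also have "\<dots> = (\<integral>x. (\<Sum>y\<in>S i. w i * f (x(i := y))) \<partial>Pi\<^sub>M I ?M)"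
  proof (rule Bochner_Integration.integral_cong[OF refl])
    fix x assume "x \<in> space (Pi\<^sub>M I ?M)"
    then have x: "x \<in> space (Pi\<^sub>M (insert i I - {i}) (\<lambda>_. borel :: real measure))" using spM insert(2) by simp
    show "(\<integral>y. f (x(i := y)) \<partial>?M i) = (\<Sum>y\<in>S i. w i * f (x(i := y)))"
      by (rule integral_point_masses[OF S w measurable_fun_upd_line[OF insert.prems(1) _ x]]) auto
  qed
  also have "\<dots> = (\<Prod>i\<in>I. w i) * (\<Sum>x\<in>Pi\<^sub>E I S. \<Sum>y\<in>S i. w i * f (x(i := y)))"
  proof -
    interpret FI: finite_measure "Pi\<^sub>M I ?M" by (rule PiM_mass[OF M]) (use insert in auto)
    have "integrable (Pi\<^sub>M I ?M) (\<lambda>x. f (x(i := y)))" for y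
      by (rule FI.integrable_const_bound[of _ B])
        (use insert.prems(2) fix_meas[of y] measurable_cong_sets[OF seM refl, of I "borel :: real measure"] in auto)
    then have "(\<integral>x. (\<Sum>y\<in>S i. w i * f (x(i := y))) \<partial>Pi\<^sub>M I ?M) = (\<Sum>y\<in>S i. w i * (\<integral>x. f (x(i := y)) \<partial>Pi\<^sub>M I ?M))"
      by simp
    also have "\<dots> = (\<Sum>y\<in>S i. w i * ((\<Prod>i\<in>I. w i) * (\<Sum>x\<in>Pi\<^sub>E I S. f (x(i := y)))))"
      by (intro sum.cong refl arg_cong2[where f="(*)"] insert.IH[OF fix_meas insert.prems(2)])
    finally show ?thesis
      by (subst sum.swap) (simp add: sum_distrib_left mult.left_commute)
  qed
  also have "(\<Sum>x\<in>Pi\<^sub>E I S. \<Sum>y\<in>S i. w i * f (x(i := y))) = w i * (\<Sum>x\<in>Pi\<^sub>E (insert i I) S. f x)"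
  proof -
    have "(\<Sum>x\<in>Pi\<^sub>E (insert i I) S. f x) = (\<Sum>(y, x)\<in>S i \<times> Pi\<^sub>E I S. f (x(i := y)))"
      unfolding PiE_insert_eq using inj_combinator[OF insert(2), of S]
      by (subst sum.reindex) (auto simp: comp_def case_prod_unfold)
    then show ?thesis
      by (subst sum.swap) (simp add: sum.cartesian_product sum_distrib_left case_prod_unfold)
  qed
  finally show ?case using insert by (simp add: mult_ac)
qed

section \<open>Cells of the line and intervals of coefficients\<close>

text \<open>
  The level sets of this monotone function are the points of \<open>R\<close> and the
  components of the complement of \<open>R\<close>.
\<close>

definition cell_index :: "real set \<Rightarrow> real \<Rightarrow> nat" where
  "cell_index R x = card {r \<in> R. r < x} + card {r \<in> R. r \<le> x}"

definition cell :: "real set \<Rightarrow> nat \<Rightarrow> real set" where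
  "cell R k = {x. cell_index R x = k}"

lemma cell_index_le: "finite R \<Longrightarrow> cell_index R x \<le> 2 * card R"
  unfolding cell_index_def
  using card_mono[of R "{r \<in> R. r < x}"] card_mono[of R "{r \<in> R. r \<le> x}"] by auto

lemma cell_index_mono: "finite R \<Longrightarrow> x \<le> y \<Longrightarrow> cell_index R x \<le> cell_index R y"
  unfolding cell_index_def by (intro add_mono card_mono) auto

text \<open>Both counts in \<open>cell_index\<close> are monotone, so equal sums force both to be
  equal, and nested finite sets of equal size coincide. Hence no point of \<open>R\<close> separates
  \<open>x\<close> from \<open>y\<close> or equals one of them.\<close>

lemma cell_index_eqD:
  assumes "finite R" "cell_index R x = cell_index R y" "x < y" "r \<in> R"
  shows "r < x \<or> y < r"
proof -
  have a: "card {r \<in> R. r < x} \<le> card {r \<in> R. r < y}" "card {r \<in> R. r \<le> x} \<le> card {r \<in> R. r \<le> y}"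
    by (rule card_mono; use assms(1,3) in \<open>auto\<close>)+
  then have b: "card {r \<in> R. r < x} = card {r \<in> R. r < y}" "card {r \<in> R. r \<le> x} = card {r \<in> R. r \<le> y}"
    using assms(2) unfolding cell_index_def by auto
  have "{r \<in> R. r < x} = {r \<in> R. r < y}" "{r \<in> R. r \<le> x} = {r \<in> R. r \<le> y}"
    by (rule card_subset_eq; use assms b in auto)+
  then have "r < x \<longleftrightarrow> r < y" "r \<le> x \<longleftrightarrow> r \<le> y" using assms(4) by blast+
  then show ?thesis using assms(3) by linarith
qed

lemma is_interval_cell:
  assumes F: "finite R"
  shows "is_interval (cell R k)"
  unfolding is_interval_1
proof (intro ballI allI impI)
  fix a b x assume "a \<in> cell R k" "b \<in> cell R k" "a \<le> x \<and> x \<le> b"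
  then show "x \<in> cell R k"
    using cell_index_mono[OF F, of a x] cell_index_mono[OF F, of x b] by (simp add: cell_def)
qed

text \<open>One of the two counts in \<open>cell_index\<close> jumps on arriving at a point of
  \<open>R\<close>, the other on leaving it, so such a point shares its index with no other
  point.\<close>

lemma cell_cases:
  assumes "finite R"
  shows "(\<exists>r\<in>R. cell R k = {r}) \<or> cell R k \<inter> R = {}"
proof (cases "cell R k \<inter> R = {}")
  case False
  then obtain r where r: "r \<in> R" "cell_index R r = k" by (auto simp: cell_def)
  have "x = r" if x: "cell_index R x = k" for x
  proof (rule linorder_cases[of x r])
    assume "x < r" then show ?thesis using cell_index_eqD[OF assms, of x r r] r x by simp
  next
    assume "r < x" then show ?thesis using cell_index_eqD[OF assms, of r x r] r x by simp
  qed
  then have "cell R k = {r}" using r unfolding cell_def by blast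
  with r(1) show ?thesis by (intro disjI1) (rule bexI[of _ r])
qed (rule disjI2)

text \<open>An interval is the intersection of its upward and its downward closure, and the
  indicators of these are monotone up to sign. This treats all kinds of endpoints at once.\<close>

lemma is_interval_borel:
  fixes S :: "real set"
  assumes "is_interval S"
  shows "S \<in> sets borel"
proof -
  have m1: "mono (indicator {x. \<exists>a\<in>S. a \<le> x} :: real \<Rightarrow> real)"
  proof (rule monoI)
    fix x y :: real assume "x \<le> y"
    then have "(\<exists>a\<in>S. a \<le> x) \<Longrightarrow> (\<exists>a\<in>S. a \<le> y)" by (meson order_trans)
    then show "indicator {x. \<exists>a\<in>S. a \<le> x} x \<le> (indicator {x. \<exists>a\<in>S. a \<le> x} y :: real)"
      by (simp add: indicator_def del: bex_simps)
  qed
  have m2: "mono (\<lambda>x. - indicator {x. \<exists>b\<in>S. x \<le> b} x :: real)"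
  proof (rule monoI)
    fix x y :: real assume "x \<le> y"
    then have "(\<exists>a\<in>S. y \<le> a) \<Longrightarrow> (\<exists>a\<in>S. x \<le> a)" by (meson order_trans)
    then show "- indicator {x. \<exists>a\<in>S. x \<le> a} x \<le> (- indicator {x. \<exists>a\<in>S. x \<le> a} y :: real)"
      by (simp add: indicator_def del: bex_simps)
  qed
  have "(indicator {x. \<exists>a\<in>S. a \<le> x} :: real \<Rightarrow> real) \<in> borel_measurable borel"
    using m1 by (rule borel_measurable_mono)
  moreover have "(\<lambda>x. - (- indicator {x. \<exists>b\<in>S. x \<le> b} x) :: real) \<in> borel_measurable borel"
    by (intro borel_measurable_uminus borel_measurable_mono m2)
  ultimately have "{x. \<exists>a\<in>S. a \<le> x} \<inter> {x. \<exists>b\<in>S. x \<le> b} \<in> sets borel"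
    by (auto simp: borel_measurable_indicator_iff)
  also have "{x. \<exists>a\<in>S. a \<le> x} \<inter> {x. \<exists>b\<in>S. x \<le> b} = S"
    using assms unfolding is_interval_1 by auto
  finally show ?thesis .
qed

section \<open>Lattice points in intervals of the line\<close>

definition grid :: "real \<Rightarrow> real set" where
  "grid H = (\<lambda>z::int. of_int z / H) ` {z. \<bar>of_int z\<bar> \<le> H}"

lemma finite_ints_le: "finite {z::int. \<bar>of_int z\<bar> \<le> (H::real)}"
proof (rule finite_subset)
  show "{z::int. \<bar>of_int z\<bar> \<le> H} \<subseteq> {-\<lfloor>H\<rfloor>..\<lfloor>H\<rfloor>}" by (auto simp: abs_le_iff le_floor_iff minus_le_iff)
qed auto

lemma finite_grid: "finite (grid H)"
  unfolding grid_def using finite_ints_le by auto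

lemma card_grid_le:
  fixes H :: real
  assumes "0 < H" shows "card (grid H) \<le> 2 * H + 1"
proof -
  have "{z::int. \<bar>of_int z\<bar> \<le> H} \<subseteq> {-\<lfloor>H\<rfloor>..\<lfloor>H\<rfloor>}" by (auto simp: abs_le_iff le_floor_iff minus_le_iff)
  then have "card {z::int. \<bar>of_int z\<bar> \<le> H} \<le> card {-\<lfloor>H\<rfloor>..\<lfloor>H\<rfloor>}" by (intro card_mono) auto
  also have "\<dots> = nat (2 * \<lfloor>H\<rfloor> + 1)" by simp
  finally have "real (card {z::int. \<bar>of_int z\<bar> \<le> H}) \<le> real (nat (2 * \<lfloor>H\<rfloor> + 1))" by linarith
  moreover have "card (grid H) \<le> card {z::int. \<bar>of_int z\<bar> \<le> H}"
    unfolding grid_def by (rule card_image_le[OF finite_ints_le])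
  moreover have "real (nat (2 * \<lfloor>H\<rfloor> + 1)) \<le> 2 * H + 1" using assms by (auto simp: of_nat_nat)
  ultimately show ?thesis by linarith
qed

text \<open>Up to its endpoints \<open>K\<close> is the interval from its infimum to its supremum,
  and adding or removing endpoints leaves the count of integers within 1 of the scaled
  length.\<close>

lemma card_grid_interval:
  fixes H :: real
  assumes K: "is_interval K" "K \<subseteq> {-1..1}" and H: "0 < H"
  shows "\<bar>card (K \<inter> grid H) / H - measure lborel K\<bar> \<le> 1 / H"
proof (cases "K = {}")
  case False
  define a b where "a = Inf K" and "b = Sup K"
  have bdd: "bdd_below K" "bdd_above K" using K(2) by (auto intro: bdd_below_mono bdd_above_mono)
  have up: "K \<subseteq> {a..b}" using bdd by (auto simp: a_def b_def intro: cInf_lower cSup_upper)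
  have lo: "{a<..<b} \<subseteq> K"
  proof
    fix x assume "x \<in> {a<..<b}"
    then obtain u v where "u \<in> K" "u < x" "v \<in> K" "x < v"
      using False bdd by (auto simp: a_def b_def cInf_less_iff less_cSup_iff)
    then show "x \<in> K" using K(1) unfolding is_interval_1 by (metis less_imp_le)
  qed
  have ab: "a \<le> b" using up False by fastforce
  have Km: "K \<in> sets lborel" using is_interval_borel[OF K(1)] by simp
  have fin: "emeasure lborel {a..b} < \<infinity>" by (simp add: ab)
  have "measure lborel {a<..<b} \<le> measure lborel K"
    using lo Km order.strict_trans1[OF emeasure_mono fin, of K] up
    by (intro measure_mono_fmeasurable) (auto simp: fmeasurable_def)
  moreover have "measure lborel K \<le> measure lborel {a..b}"
    using up Km fin by (intro measure_mono_fmeasurable) (auto simp: fmeasurable_def)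
  ultimately have meas: "measure lborel K = b - a" using ab by simp
  have eq: "K \<inter> grid H = (\<lambda>z::int. of_int z / H) ` {z. of_int z / H \<in> K}"
  proof -
    have "\<bar>of_int z\<bar> \<le> H" if "of_int z / H \<in> K" for z :: int
    proof -
      have "of_int z / H \<in> {-1..1}" using that K(2) by blast
      then show ?thesis using H by (simp add: field_simps abs_le_iff)
    qed
    then show ?thesis by (auto simp: grid_def)
  qed
  have card: "card (K \<inter> grid H) = card {z::int. of_int z / H \<in> K}"
    unfolding eq using H by (intro card_image) (auto simp: inj_on_def)
  \<comment> \<open>The open interval contains at least \<open>(b - a) * H - 1\<close> scaled
    integers, the closed one at most \<open>(b - a) * H + 1\<close>; \<open>K\<close> lies between
    the two.\<close>
  have s1: "{\<lfloor>a * H\<rfloor> + 1..\<lceil>b * H\<rceil> - 1} \<subseteq> {z::int. of_int z / H \<in> K}"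
  proof
    fix z assume "z \<in> {\<lfloor>a * H\<rfloor> + 1..\<lceil>b * H\<rceil> - 1}"
    then have "a * H < of_int z" "of_int z < b * H" by (simp, linarith)+
    then show "z \<in> {z::int. of_int z / H \<in> K}"
      using lo H by (auto simp: field_simps)
  qed
  have s2: "{z::int. of_int z / H \<in> K} \<subseteq> {\<lceil>a * H\<rceil>..\<lfloor>b * H\<rfloor>}"
  proof
    fix z :: int assume "z \<in> {z. of_int z / H \<in> K}"
    then have "a \<le> of_int z / H" "of_int z / H \<le> b" using up by auto
    then show "z \<in> {\<lceil>a * H\<rceil>..\<lfloor>b * H\<rfloor>}" using H by (auto simp: field_simps ceiling_le_iff le_floor_iff)
  qed
  have "nat (\<lceil>b * H\<rceil> - 1 - \<lfloor>a * H\<rfloor>) \<le> card {z::int. of_int z / H \<in> K}"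
    using card_mono[OF finite_subset[OF s2] s1] by simp
  then have l: "b * H - a * H - 1 \<le> card (K \<inter> grid H)"
    unfolding card by linarith
  have "card {z::int. of_int z / H \<in> K} \<le> nat (\<lfloor>b * H\<rfloor> - \<lceil>a * H\<rceil> + 1)"
    using card_mono[OF _ s2] by simp
  moreover have "a * H \<le> b * H" using ab H by simp
  ultimately have u: "card (K \<inter> grid H) \<le> b * H - a * H + 1"
    unfolding card by linarith
  have "card (K \<inter> grid H) / H - measure lborel K = (card (K \<inter> grid H) - (b * H - a * H)) / H"
    using H by (simp add: meas field_simps)
  then show ?thesis using l u H by (simp add: abs_le_iff divide_right_mono)
qed (use H in auto)

text \<open>Lebesgue measure on [-1, 1], kept as a measure on the whole line so that it can be
  exchanged with discrete measures there, and written as a density so that its powers are densities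
  of product Lebesgue measure.\<close>

definition unit_box :: "real measure" where
  "unit_box = density lborel (\<lambda>x. indicator {-1..1} x)"

lemma sets_unit_box [simp]: "sets unit_box = sets borel"
  by (simp add: unit_box_def)

lemma emeasure_unit_box: "A \<in> sets borel \<Longrightarrow> emeasure unit_box A = emeasure lborel (A \<inter> {-1..1})"
  unfolding unit_box_def
  by (subst emeasure_density) (auto simp flip: indicator_inter_arith simp: Int_commute)

lemma mass_le_unit_box: "2 \<le> c \<Longrightarrow> mass_le unit_box c"
proof -
  assume c: "2 \<le> c"
  have sp: "space unit_box = UNIV" by (simp add: unit_box_def)
  have e: "emeasure unit_box UNIV = ennreal 2"
    using emeasure_unit_box[of UNIV] by simp
  show ?thesis
    unfolding mass_le_def measure_def e using c
    by (auto intro!: finite_measureI simp: sp e)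
qed

text \<open>Coefficients are divided by \<open>H\<close>, so that for every height the lattice is
  compared with one and the same cube; the weight \<open>1 / H\<close> is the spacing of the
  grid.\<close>

definition grid_box :: "real \<Rightarrow> real measure" where
  "grid_box H = point_masses (grid H) (1 / H)"

text \<open>The constant 3 comes from \<open>2 * H + 1 \<le> 3 * H\<close>; it is the base of the
  powers of 3 in all later constants.\<close>

lemma mass_le_grid_box:
  assumes "1 \<le> H" "3 \<le> c"
  shows "mass_le (grid_box H) c"
  unfolding grid_box_def
proof (rule mass_le_point_masses)
  have "real (card (grid H)) \<le> 3 * H" using card_grid_le[of H] assms by linarith
  then have "1 / H * real (card (grid H)) \<le> 3" using assms by (simp add: field_simps)
  then show "1 / H * real (card (grid H)) \<le> c" using assms by linarith
qed (use finite_grid assms in auto)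

text \<open>The form in which lattice sums are compared on a line: the integrand is a combination of
  indicators of intervals, disjoint or not, and only the number of intervals enters the
  error.\<close>

lemma grid_box_intervals:
  fixes w :: "'k \<Rightarrow> real" and H :: real
  assumes H: "1 \<le> H" and A: "finite A" and G: "\<And>k. k \<in> A \<Longrightarrow> is_interval (G k)"
    and w: "\<And>k. k \<in> A \<Longrightarrow> \<bar>w k\<bar> \<le> 1"
  shows "\<bar>(\<integral>c. (\<Sum>k\<in>A. w k * indicator (G k) c) \<partial>grid_box H) - (\<integral>c. (\<Sum>k\<in>A. w k * indicator (G k) c) \<partial>unit_box)\<bar>
     \<le> card A / H"
proof -
  have Gb: "G k \<in> sets borel" if "k \<in> A" for k using is_interval_borel G that by blast
  note D1 = mass_leD[OF mass_le_grid_box[OF H order_refl]] and D2 = mass_leD[OF mass_le_unit_box[OF order_refl]]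
  interpret g: finite_measure "grid_box H" by (rule D1)
  interpret u: finite_measure unit_box by (rule D2)
  have i1: "(\<integral>c. (\<Sum>k\<in>A. w k * indicator (G k) c) \<partial>grid_box H) = (\<Sum>k\<in>A. w k * measure (grid_box H) (G k))"
    using Gb D1(1,2) by (subst Bochner_Integration.integral_sum) (auto intro!: integrable_real_indicator simp: g.emeasure_finite less_top[symmetric])
  have i2: "(\<integral>c. (\<Sum>k\<in>A. w k * indicator (G k) c) \<partial>unit_box) = (\<Sum>k\<in>A. w k * measure unit_box (G k))"
    using Gb D2(1,2) by (subst Bochner_Integration.integral_sum) (auto intro!: integrable_real_indicator simp: u.emeasure_finite less_top[symmetric])
  have m: "\<bar>measure (grid_box H) (G k) - measure unit_box (G k)\<bar> \<le> 1 / H" if k: "k \<in> A" for k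
  proof -
    have 1: "is_interval (G k \<inter> {-1..1})" using G[OF k] by (auto simp: is_interval_1)
    have sub: "grid H \<subseteq> {-1..1}" using H by (auto simp: grid_def field_simps abs_le_iff)
    have "emeasure (grid_box H) (G k) = ennreal (1 / H * card (G k \<inter> grid H))"
      unfolding grid_box_def by (rule emeasure_point_masses) (use finite_grid H Gb[OF k] in auto)
    then have "measure (grid_box H) (G k) = card (G k \<inter> grid H) / H" using H by (simp add: measure_def)
    moreover have "G k \<inter> grid H = (G k \<inter> {-1..1}) \<inter> grid H" using sub by auto
    moreover have "measure unit_box (G k) = measure lborel (G k \<inter> {-1..1})"
      using emeasure_unit_box[OF Gb[OF k]] by (simp add: measure_def)
    ultimately show ?thesis using card_grid_interval[OF 1, of H] H by simp
  qed
  have "\<bar>(\<Sum>k\<in>A. w k * measure (grid_box H) (G k)) - (\<Sum>k\<in>A. w k * measure unit_box (G k))\<bar>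
     = \<bar>\<Sum>k\<in>A. w k * (measure (grid_box H) (G k) - measure unit_box (G k))\<bar>"
    by (simp add: sum_subtractf right_diff_distrib)
  also have "\<dots> \<le> (\<Sum>k\<in>A. 1 * (1 / H))"
    by (rule order_trans[OF sum_abs]) (intro sum_mono, unfold abs_mult, intro mult_mono m w, auto)
  finally show ?thesis unfolding i1 i2 by simp
qed

section \<open>The number of roots as a function of one coefficient\<close>

definition poly_of :: "nat \<Rightarrow> (nat \<Rightarrow> real) \<Rightarrow> real poly" where
  "poly_of d a = (\<Sum>k\<le>d. monom (a k) k)"

lemma coeff_poly_of: "coeff (poly_of d a) k = (if k \<le> d then a k else 0)"
  by (simp add: poly_of_def coeff_sum if_distrib cong: if_cong)

lemma degree_poly_of: "degree (poly_of d a) \<le> d"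
  by (rule degree_le) (simp add: coeff_poly_of)

lemma poly_poly_of: "poly (poly_of d a) x = (\<Sum>k\<le>d. a k * x ^ k)"
  by (simp add: poly_of_def poly_sum poly_monom)

lemma poly_of_eq_0_iff: "poly_of d a = 0 \<longleftrightarrow> (\<forall>k\<le>d. a k = 0)"
  by (metis coeff_0 coeff_poly_of leading_coeff_0_iff degree_poly_of)

lemma poly_of_upd:
  "j \<le> d \<Longrightarrow> poly_of d (a(j := c)) = poly_of d (a(j := 0)) + monom c j"
  by (intro poly_eqI) (auto simp: coeff_poly_of)

lemma root_upd_iff:
  "j \<le> d \<Longrightarrow> poly (poly_of d (a(j := c))) x = 0 \<longleftrightarrow> poly (poly_of d (a(j := 0))) x + c * x ^ j = 0"
  by (subst poly_of_upd) (auto simp: poly_monom)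

lemma root_upd_iff_nonzero:
  "j \<le> d \<Longrightarrow> x \<noteq> 0 \<Longrightarrow>
    poly (poly_of d (a(j := c))) x = 0 \<longleftrightarrow> c = - (poly (poly_of d (a(j := 0))) x / x ^ j)"
  by (subst root_upd_iff) (auto simp: field_simps add_eq_0_iff)

text \<open>
  The zero polynomial counts \<open>card I\<close> roots, which is 0 for infinite \<open>I\<close>; it is a null set in
  coefficient space and a single lattice point.
\<close>

definition nroots :: "nat \<Rightarrow> real set \<Rightarrow> (nat \<Rightarrow> real) \<Rightarrow> real" where
  "nroots d I a = real (card {x \<in> I. poly (poly_of d a) x = 0})"

text \<open>
  The zeros of \<open>poly_of d a + c x\<^sup>j\<close> other than 0 are the points where \<open>- poly_of d a / x\<^sup>j\<close>
  takes the value \<open>c\<close>; this polynomial vanishes at the critical points of that quotient.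
\<close>

definition crit_poly :: "nat \<Rightarrow> nat \<Rightarrow> (nat \<Rightarrow> real) \<Rightarrow> real poly" where
  "crit_poly d j a = poly_of d (\<lambda>k. (real k - real j) * a k)"

definition crit_points :: "nat \<Rightarrow> nat \<Rightarrow> (nat \<Rightarrow> real) \<Rightarrow> real set" where
  "crit_points d j a = insert 0 {x. poly (crit_poly d j a) x = 0}"

text \<open>The right-hand side is \<open>x ^ (j + 1)\<close> times the derivative of
  \<open>poly_of d a / x ^ j\<close>, so away from 0 the zeros of \<open>crit_poly\<close> are the
  critical points of that quotient.\<close>

lemma poly_crit_poly:
  "poly (crit_poly d j a) x = x * poly (pderiv (poly_of d a)) x - real j * poly (poly_of d a) x"
proof -
  have "crit_poly d j a = pCons 0 (pderiv (poly_of d a)) - smult (real j) (poly_of d a)"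
    by (rule poly_eqI)
      (auto simp: crit_poly_def coeff_poly_of coeff_pderiv coeff_pCons left_diff_distrib split: nat.split)
  then show ?thesis by simp
qed

text \<open>Multiplying the \<open>k\<close>-th coefficient by \<open>k - j\<close> can annihilate
  only the \<open>j\<close>-th one, which has been set to 0 beforehand.\<close>

lemma crit_poly_nonzero:
  assumes "poly_of d (a(j := 0)) \<noteq> 0"
  shows "crit_poly d j (a(j := 0)) \<noteq> 0"
  using assms unfolding crit_poly_def poly_of_eq_0_iff by (auto split: if_splits)

lemma crit_points_finite:
  assumes "poly_of d (a(j := 0)) \<noteq> 0"
  shows "finite (crit_points d j (a(j := 0)))" "card (crit_points d j (a(j := 0))) \<le> d + 1"
proof -
  note n = crit_poly_nonzero[OF assms]
  show "finite (crit_points d j (a(j := 0)))" 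
    using poly_roots_finite[OF n] by (simp add: crit_points_def)
  have "card {x. poly (crit_poly d j (a(j := 0))) x = 0} \<le> d"
    using card_poly_roots_bound[OF n] degree_poly_of unfolding crit_poly_def by (meson order_trans)
  then show "card (crit_points d j (a(j := 0))) \<le> d + 1"
    unfolding crit_points_def by (simp add: card_insert_if poly_roots_finite[OF n])
qed

text \<open>Rolle's theorem: at two different roots the quotient \<open>P / z ^ j\<close> takes the
  same value \<open>- c\<close>, so it has a critical point between them. The quotient must be
  defined in between, which is why 0 is counted among the \<open>crit_points\<close>.\<close>

lemma root_unique_off_crit_points:
  assumes j: "j \<le> d" and J: "is_interval J" "J \<inter> crit_points d j (a(j := 0)) = {}"
    and xy: "x \<in> J" "y \<in> J" "poly (poly_of d (a(j := c))) x = 0" "poly (poly_of d (a(j := c))) y = 0"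
  shows "x = y"
proof -
  define P where "P = poly_of d (a(j := 0))"
  have False if xy: "u \<in> J" "v \<in> J" "poly (poly_of d (a(j := c))) u = 0" "poly (poly_of d (a(j := c))) v = 0"
    "u < v" for u v
  proof -
    have J': "z \<in> J" if "u \<le> z" "z \<le> v" for z using J(1) xy that unfolding is_interval_1 by blast
    have n0: "z \<noteq> 0" if "z \<in> J" for z using that J(2) by (auto simp: crit_points_def)
    have g: "poly P u / u ^ j = - c" "poly P v / v ^ j = - c"
      using xy(3,4) root_upd_iff_nonzero[OF j n0[OF xy(1)]] root_upd_iff_nonzero[OF j n0[OF xy(2)]]
      by (simp_all add: P_def)
    have der: "((\<lambda>z. poly P z / z ^ j) has_real_derivative
        ((poly (pderiv P) z * z ^ j - poly P z * (real j * z ^ (j - 1))) / (z ^ j * z ^ j))) (at z)" if "z \<in> J" for z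
      using n0[OF that] by (auto intro!: derivative_eq_intros)
    obtain z where z: "u < z" "z < v" and
      "poly P v / v ^ j - poly P u / u ^ j =
        (v - u) * ((poly (pderiv P) z * z ^ j - poly P z * (real j * z ^ (j - 1))) / (z ^ j * z ^ j))"
      using MVT2[OF \<open>u < v\<close> der] J' by blast
    then have d0: "(poly (pderiv P) z * z ^ j - poly P z * (real j * z ^ (j - 1))) / (z ^ j * z ^ j) = 0"
      using g \<open>u < v\<close> by simp
    have zJ: "z \<in> J" using J' z by simp
    have "z ^ j * z ^ j \<noteq> 0" using n0[OF zJ] by simp
    with d0 have "poly (pderiv P) z * z ^ j - poly P z * (real j * z ^ (j - 1)) = 0"
      unfolding divide_eq_0_iff by blast
    then have "poly (pderiv P) z * z ^ j = poly P z * (real j * z ^ (j - 1))"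
      by simp
    then have "z * poly (pderiv P) z * z ^ j = poly P z * (real j * (z ^ (j - 1) * z))"
      by (simp add: mult_ac)
    also have "real j * (z ^ (j - 1) * z) = real j * z ^ j" by (cases j) auto
    finally have "z * poly (pderiv P) z = real j * poly P z"
      using n0[OF zJ] by simp
    then have "z \<in> crit_points d j (a(j := 0))"
      unfolding crit_points_def by (simp add: poly_crit_poly flip: P_def)
    then show False using J(2) zJ by blast
  qed
  then show ?thesis using xy by (metis linorder_neqE)
qed

definition coeff_set :: "nat \<Rightarrow> nat \<Rightarrow> (nat \<Rightarrow> real) \<Rightarrow> real set \<Rightarrow> real set" where
  "coeff_set d j a J = {c. \<exists>x\<in>J. poly (poly_of d (a(j := c))) x = 0}"

text \<open>For a single point \<open>r\<close> the condition on \<open>c\<close> is a linear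
  equation, solved by one value if \<open>r ^ j \<noteq> 0\<close> and by all or none otherwise.
  Without critical points in \<open>J\<close> the point 0 is avoided, and the set is the image of
  \<open>J\<close> under a continuous function.\<close>

lemma is_interval_coeff_set:
  assumes j: "j \<le> d" and J: "is_interval J" "(\<exists>r. J = {r}) \<or> J = {} \<or> J \<inter> crit_points d j (a(j := 0)) = {}"
  shows "is_interval (coeff_set d j a J)"
  using J(2)
proof (elim disjE exE)
  fix r assume r: "J = {r}"
  show ?thesis
    unfolding is_interval_1 coeff_set_def r
  proof (clarsimp simp: root_upd_iff[OF j])
    fix u v c :: real assume *: "poly (poly_of d (a(j := 0))) r + u * r ^ j = 0"
      "poly (poly_of d (a(j := 0))) r + v * r ^ j = 0" "u \<le> c" "c \<le> v"
    show "poly (poly_of d (a(j := 0))) r + c * r ^ j = 0"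
    proof (cases "r ^ j = 0")
      case False
      then have "u = v" using * by (metis add_left_cancel mult_right_cancel)
      then show ?thesis using * by auto
    next
      case True
      show ?thesis using *(1) by (simp only: True mult_zero_right)
    qed
  qed
next
  assume J0: "J \<inter> crit_points d j (a(j := 0)) = {}"
  have n0: "z \<noteq> 0" if "z \<in> J" for z using that J0 by (auto simp: crit_points_def)
  have "coeff_set d j a J = (\<lambda>x. - (poly (poly_of d (a(j := 0))) x / x ^ j)) ` J"
    unfolding coeff_set_def using n0
    by (auto simp: root_upd_iff_nonzero[OF j] image_iff)
  moreover have "connected \<dots>"
    using J(1) n0 by (intro connected_continuous_image continuous_intros) (auto simp: is_interval_connected_1)
  ultimately show ?thesis by (simp add: is_interval_connected_1)
qed (auto simp: coeff_set_def is_interval_empty)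

lemma is_interval_coeff_set_cell:
  assumes j: "j \<le> d" and P: "poly_of d (a(j := 0)) \<noteq> 0" and I: "is_interval I"
  defines "R \<equiv> crit_points d j (a(j := 0))"
  shows "is_interval (coeff_set d j a (I \<inter> cell R k))"
proof (rule is_interval_coeff_set[OF j])
  have F: "finite R" using crit_points_finite(1)[OF P] by (simp add: R_def)
  show "is_interval (I \<inter> cell R k)" using I is_interval_cell[OF F] by (rule is_interval_Int)
  show "(\<exists>r. I \<inter> cell R k = {r}) \<or> I \<inter> cell R k = {} \<or> I \<inter> cell R k \<inter> crit_points d j (a(j := 0)) = {}"
  proof (cases "cell R k \<inter> R = {}")
    case True
    then show ?thesis by (auto simp: R_def)
  next
    case False
    then obtain r where r: "cell R k = {r}" using cell_cases[OF F, of k] by auto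
    show ?thesis unfolding r by (cases "r \<in> I") auto
  qed
qed

text \<open>Each cell carries at most one root, since it is either a single point or free of
  critical points. There are at most \<open>d + 1\<close> critical points, so the cell indices run
  from 0 to \<open>2 * (d + 1)\<close>.\<close>

lemma nroots_eq_sum_indicator:
  assumes j: "j \<le> d" and P: "poly_of d (a(j := 0)) \<noteq> 0"
  defines "R \<equiv> crit_points d j (a(j := 0))"
  shows "nroots d I (a(j := c)) = (\<Sum>k\<le>2 * (d + 1). indicator (coeff_set d j a (I \<inter> cell R k)) c)"
proof -
  note F = crit_points_finite[OF P, folded R_def]
  let ?Z = "{x. poly (poly_of d (a(j := c))) x = 0}"
  have le: "cell_index R x \<le> 2 * (d + 1)" for x
    by (rule order_trans[OF cell_index_le[OF F(1)] mult_le_mono2[OF F(2)]])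
  have uniq: "x = y" if "x \<in> cell R k" "y \<in> cell R k" "x \<in> ?Z" "y \<in> ?Z" for x y k
  proof (cases "\<exists>r. cell R k = {r}")
    case False
    then have "cell R k \<inter> R = {}" using cell_cases[OF F(1), of k] by auto
    then show ?thesis using root_unique_off_crit_points[OF j is_interval_cell[OF F(1)], of k a x y c] that
      by (auto simp: R_def)
  qed (use that in auto)
  have c1: "real (card (I \<inter> cell R k \<inter> ?Z)) = indicator (coeff_set d j a (I \<inter> cell R k)) c" for k
  proof (cases "c \<in> coeff_set d j a (I \<inter> cell R k)")
    case True
    then obtain x where x: "x \<in> I" "x \<in> cell R k" "x \<in> ?Z" by (auto simp: coeff_set_def)
    then have "I \<inter> cell R k \<inter> ?Z = {x}" using uniq by blast
    then show ?thesis using True by simp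
  next
    case False
    then have "I \<inter> cell R k \<inter> ?Z = {}" by (auto simp: coeff_set_def)
    then show ?thesis using False by simp
  qed
  have fin: "finite (I \<inter> cell R k \<inter> ?Z)" for k
  proof (cases "I \<inter> cell R k \<inter> ?Z = {}")
    case False
    then obtain x where "x \<in> I \<inter> cell R k \<inter> ?Z" by blast
    then have "I \<inter> cell R k \<inter> ?Z \<subseteq> {x}" using uniq by blast
    then show ?thesis by (rule finite_subset) simp
  qed simp
  have "{x \<in> I. poly (poly_of d (a(j := c))) x = 0} = (\<Union>k\<le>2 * (d + 1). I \<inter> cell R k \<inter> ?Z)"
    using le by (auto simp: cell_def)
  then have "nroots d I (a(j := c)) = real (\<Sum>k\<le>2 * (d + 1). card (I \<inter> cell R k \<inter> ?Z))"
    unfolding nroots_def by (subst card_UN_disjoint[symmetric]) (use fin in \<open>auto simp: cell_def\<close>)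
  then show ?thesis using c1 by simp
qed

text \<open>Holds because \<open>card\<close> is 0 on infinite sets: a finite interval has at most
  one point. It bounds what the zero polynomial contributes to the number of roots.\<close>

lemma card_interval_le_1:
  fixes I :: "real set"
  assumes I: "is_interval I"
  shows "card I \<le> 1"
proof (cases "finite I")
  case True
  have no: False if "x \<in> I" "y \<in> I" "x < y" for x y
  proof -
    have "{x..y} \<subseteq> I"
      using I[unfolded is_interval_1, rule_format, OF that(1,2)] by (simp add: subset_eq)
    with True have "finite {x..y}" by (rule rev_finite_subset)
    then show False using infinite_Icc[OF that(3)] by contradiction
  qed
  have "x = y" if "x \<in> I" "y \<in> I" for x y
    using no[OF that] no[OF that(2,1)] by (cases "x < y"; cases "y < x") (simp_all add: not_less)
  then show ?thesis using card_le_Suc0_iff_eq[OF True] by simp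
qed simp

text \<open>The numerator \<open>2 * d + 3\<close> is the number of cells. If all coefficients but
  the \<open>j\<close>-th vanish there is no suitable set of critical points; then the polynomial is
  \<open>c x\<^sup>j\<close>, whose number of roots is constant for \<open>c \<noteq> 0\<close>, and
  three intervals suffice.\<close>

lemma nroots_line:
  assumes j: "j \<le> d" and I: "is_interval I" and H: "1 \<le> H"
  shows "\<bar>(\<integral>c. nroots d I (a(j := c)) \<partial>grid_box H) - (\<integral>c. nroots d I (a(j := c)) \<partial>unit_box)\<bar> \<le> (2 * d + 3) / H"
proof (cases "poly_of d (a(j := 0)) = 0")
  case False
  define R where "R = crit_points d j (a(j := 0))"
  define G where "G = (\<lambda>k. coeff_set d j a (I \<inter> cell R k))"
  have int: "is_interval (G k)" for k
    unfolding G_def R_def by (rule is_interval_coeff_set_cell[OF j False I])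
  have "nroots d I (a(j := c)) = (\<Sum>k\<le>2 * (d + 1). 1 * indicator (G k) c)" for c
    using nroots_eq_sum_indicator[OF j False, of I c] by (simp add: G_def R_def)
  then show ?thesis
    using grid_box_intervals[OF H, of "{..2 * (d + 1)}" G "\<lambda>_. 1"] int by (simp add: algebra_simps)
next
  case True
  \<comment> \<open>\<open>v\<close> is the number of roots for every \<open>c \<noteq> 0\<close>,
    and \<open>w\<close> the conventional value at \<open>c = 0\<close>, where the polynomial
    vanishes identically.\<close>
  define v where "v = (if 0 < j \<and> 0 \<in> I then 1 else 0 :: real)"
  define w where "w = nroots d I (a(j := 0))"
  have eq: "poly_of d (a(j := c)) = monom c j" for c using poly_of_upd[OF j, of a c] True by simp
  have w: "0 \<le> w" "w \<le> 1"
  proof -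
    have "card I \<le> 1" by (rule card_interval_le_1[OF I])
    then show "0 \<le> w" "w \<le> 1" by (auto simp: w_def nroots_def eq)
  qed
  have n: "nroots d I (a(j := c)) = v" if "c \<noteq> 0" for c
  proof -
    have "{x \<in> I. poly (poly_of d (a(j := c))) x = 0} = (if 0 < j \<and> 0 \<in> I then {0} else {})"
      using that by (auto simp: eq poly_monom)
    then show ?thesis by (simp add: nroots_def v_def)
  qed
  define G where "G = (\<lambda>k::nat. if k = 0 then {..<0} else if k = 1 then {0} else {0<..} :: real set)"
  define u where "u = (\<lambda>k::nat. if k = 1 then w else v)"
  have "nroots d I (a(j := c)) = (\<Sum>k\<le>2. u k * indicator (G k) c)" for c
    using n[of c] by (cases "c = 0") (auto simp: numeral_2_eq_2 G_def u_def w_def indicator_def)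
  moreover have "\<bar>(\<integral>c. (\<Sum>k\<le>2. u k * indicator (G k) c) \<partial>grid_box H) - (\<integral>c. (\<Sum>k\<le>2. u k * indicator (G k) c) \<partial>unit_box)\<bar> \<le> card {..2::nat} / H"
    using w by (intro grid_box_intervals[OF H]) (auto simp: G_def u_def v_def is_interval_1)
  moreover have "card {..2::nat} / H \<le> (2 * d + 3) / H" using H by (intro divide_right_mono) auto
  ultimately show ?thesis by simp
qed

section \<open>Measurability of the number of roots\<close>

text \<open>The quantifier over \<open>C\<close> is uncountable. By compactness a root exists iff
  the absolute value gets arbitrarily small on \<open>C\<close>, and by continuity this may be
  tested on a countable dense subset.\<close>

lemma root_exists_measurable:
  fixes c :: "'a \<Rightarrow> nat \<Rightarrow> real"
  assumes c: "\<And>k. k \<le> d \<Longrightarrow> (\<lambda>\<omega>. c \<omega> k) \<in> borel_measurable M" and C: "compact C"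
  shows "{\<omega> \<in> space M. \<exists>x\<in>C. poly (poly_of d (c \<omega>)) x = 0} \<in> sets M"
proof -
  obtain T where T: "countable T" "T \<subseteq> C" "C \<subseteq> closure T" by (rule separable)
  have eq: "(\<exists>x\<in>C. poly p x = 0) \<longleftrightarrow> (\<forall>n. \<exists>q\<in>T. \<bar>poly p q\<bar> < inverse (real (Suc n)))" for p
  proof
    assume "\<exists>x\<in>C. poly p x = 0"
    then obtain x where x: "x \<in> C" "poly p x = 0" by auto
    show "\<forall>n. \<exists>q\<in>T. \<bar>poly p q\<bar> < inverse (real (Suc n))"
    proof
      fix n
      have "isCont (poly p) x" by simp
      then obtain \<delta> where \<delta>: "\<delta> > 0" "\<And>y. dist y x < \<delta> \<Longrightarrow> dist (poly p y) (poly p x) < inverse (real (Suc n))"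
        unfolding continuous_at_eps_delta by (metis of_nat_0_less_iff positive_imp_inverse_positive zero_less_Suc)
      obtain y where "y \<in> T" "dist y x < \<delta>" using x T(3) \<delta>(1) by (meson closure_approachable subsetD)
      then show "\<exists>q\<in>T. \<bar>poly p q\<bar> < inverse (real (Suc n))" using \<delta>(2)[of y] x by (auto simp: dist_real_def)
    qed
  next
    assume *: "\<forall>n. \<exists>q\<in>T. \<bar>poly p q\<bar> < inverse (real (Suc n))"
    then have "C \<noteq> {}" using T(2) by blast
    moreover have "continuous_on C (\<lambda>x. \<bar>poly p x\<bar>)" by (intro continuous_intros)
    ultimately obtain x where x: "x \<in> C" "\<And>y. y \<in> C \<Longrightarrow> \<bar>poly p x\<bar> \<le> \<bar>poly p y\<bar>"
      using continuous_attains_inf[OF C] by blast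
    have "\<bar>poly p x\<bar> < inverse (real (Suc n))" for n
    proof -
      obtain q where "q \<in> T" "\<bar>poly p q\<bar> < inverse (real (Suc n))" using * by blast
      then show ?thesis using x(2)[of q] T(2) by fastforce
    qed
    then have "\<not> 0 < \<bar>poly p x\<bar>" using reals_Archimedean by (meson less_asym)
    then show "\<exists>x\<in>C. poly p x = 0" using x(1) by auto
  qed
  have [measurable]: "(\<lambda>\<omega>. \<bar>poly (poly_of d (c \<omega>)) q\<bar>) \<in> borel_measurable M" for q
    unfolding poly_poly_of using c by measurable
  have "{\<omega> \<in> space M. \<bar>poly (poly_of d (c \<omega>)) q\<bar> < inverse (real (Suc n))} \<in> sets M" for q n
    by measurable
  then have "{\<omega> \<in> space M. \<forall>n. \<exists>q\<in>T. \<bar>poly (poly_of d (c \<omega>)) q\<bar> < inverse (real (Suc n))} \<in> sets M"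
    by (intro sets.sets_Collect_countable_All sets.sets_Collect_countable_Ex'[OF _ T(1)])
  then show ?thesis unfolding eq .
qed

text \<open>A class that contains all intervals, is stable under cutting with open half-lines, and
  for which the existence of a root is a countable union of the compact case.\<close>

definition sigma_compact :: "real set \<Rightarrow> bool" where
  "sigma_compact I \<longleftrightarrow> (\<exists>\<C>. countable \<C> \<and> (\<forall>C\<in>\<C>. compact C) \<and> I = \<Union>\<C>)"

lemma sigma_compact_Int:
  assumes "sigma_compact I" "sigma_compact J"
  shows "sigma_compact (I \<inter> J)"
proof -
  obtain \<C> where C: "countable \<C>" "\<forall>C\<in>\<C>. compact C" "I = \<Union>\<C>"
    using assms(1) unfolding sigma_compact_def by auto
  obtain \<D> where D: "countable \<D>" "\<forall>C\<in>\<D>. compact C" "J = \<Union>\<D>"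
    using assms(2) unfolding sigma_compact_def by auto
  have "countable ((\<lambda>(C, D). C \<inter> D) ` (\<C> \<times> \<D>))" using C D by auto
  moreover have "\<forall>C\<in>(\<lambda>(C, D). C \<inter> D) ` (\<C> \<times> \<D>). compact C" using C D by (auto intro: compact_Int)
  moreover have "I \<inter> J = \<Union>((\<lambda>(C, D). C \<inter> D) ` (\<C> \<times> \<D>))" unfolding C D by auto
  ultimately show ?thesis unfolding sigma_compact_def by (intro exI conjI)
qed

lemma is_interval_realD:
  "is_interval (I::real set) \<Longrightarrow> a \<in> I \<Longrightarrow> b \<in> I \<Longrightarrow> a \<le> x \<Longrightarrow> x \<le> b \<Longrightarrow> x \<in> I"
  by (rule is_interval_1[THEN iffD1, rule_format, of I a b x]) (assumption | rule conjI)+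

lemma sigma_compact_interval:
  assumes "is_interval I"
  shows "sigma_compact I"
proof -
  \<comment> \<open>The rationals alone would miss endpoints that belong to \<open>I\<close>. Where
    \<open>Inf I\<close> or \<open>Sup I\<close> is not a genuine endpoint in \<open>I\<close>, the
    intersection with \<open>I\<close> makes the value harmless.\<close>
  define D where "D = (\<rat> \<union> {Inf I, Sup I}) \<inter> I"
  have D: "countable D" "D \<subseteq> I" by (auto simp: D_def countable_rat)
  let ?\<C> = "(\<lambda>(x, y). {x..y}) ` (D \<times> D)"
  have lo: "\<exists>x\<in>D. x \<le> z" if z: "z \<in> I" for z
  proof (cases "\<exists>w\<in>I. w < z")
    case True
    then obtain w where w: "w \<in> I" "w < z" by auto
    obtain q where q: "q \<in> \<rat>" "w < q" "q < z" using Rats_dense_in_real[OF w(2)] by auto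
    have "q \<in> D" using is_interval_realD[OF assms w(1) z, of q] q by (simp add: D_def)
    then show ?thesis using q(3) by (intro bexI[of _ q]) auto
  next
    case False
    then have "Inf I = z" using z by (intro cInf_eq_minimum) (auto simp: not_less)
    then show ?thesis using z by (auto simp: D_def)
  qed
  have hi: "\<exists>x\<in>D. z \<le> x" if z: "z \<in> I" for z
  proof (cases "\<exists>w\<in>I. z < w")
    case True
    then obtain w where w: "w \<in> I" "z < w" by auto
    obtain q where q: "q \<in> \<rat>" "z < q" "q < w" using Rats_dense_in_real[OF w(2)] by auto
    have "q \<in> D" using is_interval_realD[OF assms z w(1), of q] q by (simp add: D_def)
    then show ?thesis using q(2) by (intro bexI[of _ q]) auto
  next
    case False
    then have "Sup I = z" using z by (intro cSup_eq_maximum) (auto simp: not_less)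
    then show ?thesis using z by (auto simp: D_def)
  qed
  have "I = \<Union>?\<C>"
  proof
    show "I \<subseteq> \<Union>?\<C>"
    proof
      fix z assume "z \<in> I"
      then obtain x y where "x \<in> D" "x \<le> z" "y \<in> D" "z \<le> y" using lo[of z] hi[of z] by auto
      then show "z \<in> \<Union>?\<C>" by (intro UnionI[of "{x..y}"]) auto
    qed
    show "\<Union>?\<C> \<subseteq> I"
    proof
      fix z assume "z \<in> \<Union>?\<C>"
      then obtain x y where "x \<in> D" "y \<in> D" "x \<le> z" "z \<le> y" by auto
      then show "z \<in> I" using is_interval_realD[OF assms, of x y z] D(2) by auto
    qed
  qed
  moreover have "countable ?\<C>" using D(1) by auto
  moreover have "\<forall>C\<in>?\<C>. compact C" by auto
  ultimately show ?thesis unfolding sigma_compact_def by (intro exI conjI)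
qed

text \<open>Induction on the number of roots: a rational \<open>q\<close> separates the largest of
  \<open>m + 1\<close> roots from the others, so the event is a countable union over
  \<open>q\<close> of having \<open>m\<close> roots to the left of \<open>q\<close> and one to its
  right.\<close>

lemma many_roots_measurable:
  fixes c :: "'a \<Rightarrow> nat \<Rightarrow> real"
  assumes c: "\<And>k. k \<le> d \<Longrightarrow> (\<lambda>\<omega>. c \<omega> k) \<in> borel_measurable M" and I: "sigma_compact I"
  shows "{\<omega> \<in> space M. \<exists>S\<subseteq>I. finite S \<and> card S = m \<and> (\<forall>x\<in>S. poly (poly_of d (c \<omega>)) x = 0)} \<in> sets M"
  using I
proof (induction m arbitrary: I)
  case 0
  have "{\<omega> \<in> space M. \<exists>S\<subseteq>I. finite S \<and> card S = 0 \<and> (\<forall>x\<in>S. poly (poly_of d (c \<omega>)) x = 0)} = space M"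
    by (auto intro!: exI[of _ "{}"])
  then show ?case by (simp only: sets.top)
next
  case (Suc m)
  let ?P = "\<lambda>m I \<omega>. \<exists>S\<subseteq>I. finite S \<and> card S = m \<and> (\<forall>x\<in>S. poly (poly_of d (c \<omega>)) x = 0)"
  have one: "{\<omega> \<in> space M. \<exists>x\<in>J. poly (poly_of d (c \<omega>)) x = 0} \<in> sets M" if J: "sigma_compact J" for J
  proof -
    obtain \<C> where C: "countable \<C>" "\<forall>C\<in>\<C>. compact C" "J = \<Union>\<C>"
      using J unfolding sigma_compact_def by auto
    have "{\<omega> \<in> space M. \<exists>x\<in>J. poly (poly_of d (c \<omega>)) x = 0} = {\<omega> \<in> space M. \<exists>C\<in>\<C>. \<exists>x\<in>C. poly (poly_of d (c \<omega>)) x = 0}"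
      unfolding C(3) by auto
    also have "\<dots> \<in> sets M"
      using C(2) by (intro sets.sets_Collect_countable_Ex'[OF _ C(1)] root_exists_measurable c) auto
    finally show ?thesis .
  qed
  have eq: "?P (Suc m) I \<omega> \<longleftrightarrow> (\<exists>q\<in>\<rat>. ?P m (I \<inter> {..<q}) \<omega> \<and> (\<exists>x\<in>I \<inter> {q<..}. poly (poly_of d (c \<omega>)) x = 0))" for \<omega>
  proof
    assume "?P (Suc m) I \<omega>"
    then obtain S where S: "S \<subseteq> I" "finite S" "card S = Suc m" "\<forall>x\<in>S. poly (poly_of d (c \<omega>)) x = 0" by blast
    define x where "x = Max S"
    have ne: "S \<noteq> {}" using S(3) by auto
    have x: "x \<in> S" "\<And>y. y \<in> S \<Longrightarrow> y \<le> x" using S(2) ne by (auto simp: x_def)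
    obtain l where l: "l < x" "\<And>y. y \<in> S - {x} \<Longrightarrow> y \<le> l"
    proof (cases "S - {x} = {}")
      case True
      then show ?thesis using that[of "x - 1"] by auto
    next
      case False
      have "Max (S - {x}) \<in> S - {x}" using S(2) False by (intro Max_in) auto
      then have "Max (S - {x}) < x" using x(2) by (metis DiffD1 DiffD2 insertI1 order_le_imp_less_or_eq)
      then show ?thesis using S(2) by (intro that[of "Max (S - {x})"]) auto
    qed
    obtain q where q: "q \<in> \<rat>" "l < q" "q < x" using Rats_dense_in_real l(1) by blast
    have "S - {x} \<subseteq> I \<inter> {..<q}" using S(1) l(2) q(2) by fastforce
    moreover have "card (S - {x}) = m" using S(2,3) x(1) by simp
    ultimately have "?P m (I \<inter> {..<q}) \<omega>" using S(2,4) by (intro exI[of _ "S - {x}"]) auto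
    moreover have "\<exists>x\<in>I \<inter> {q<..}. poly (poly_of d (c \<omega>)) x = 0" using x(1) S(1,4) q(3) by (intro bexI[of _ x]) auto
    ultimately show "\<exists>q\<in>\<rat>. ?P m (I \<inter> {..<q}) \<omega> \<and> (\<exists>x\<in>I \<inter> {q<..}. poly (poly_of d (c \<omega>)) x = 0)" using q(1) by blast
  next
    assume "\<exists>q\<in>\<rat>. ?P m (I \<inter> {..<q}) \<omega> \<and> (\<exists>x\<in>I \<inter> {q<..}. poly (poly_of d (c \<omega>)) x = 0)"
    then obtain q S x where S: "S \<subseteq> I \<inter> {..<q}" "finite S" "card S = m" "\<forall>x\<in>S. poly (poly_of d (c \<omega>)) x = 0"
      and x: "x \<in> I" "q < x" "poly (poly_of d (c \<omega>)) x = 0" by (elim bexE conjE exE) auto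
    have "x \<notin> S" using S(1) x(2) by auto
    then show "?P (Suc m) I \<omega>" using S x by (intro exI[of _ "insert x S"]) auto
  qed
  have "sigma_compact (I \<inter> {..<q})" "sigma_compact (I \<inter> {q<..})" for q
    by (intro sigma_compact_Int[OF Suc.prems] sigma_compact_interval; simp add: is_interval_1)+
  then have "{\<omega> \<in> space M. ?P m (I \<inter> {..<q}) \<omega> \<and> (\<exists>x\<in>I \<inter> {q<..}. poly (poly_of d (c \<omega>)) x = 0)} \<in> sets M" for q
    by (intro sets.sets_Collect_conj Suc.IH one)
  then show ?case
    unfolding eq by (intro sets.sets_Collect_countable_Ex' countable_rat)
qed

lemma nroots_bounds:
  assumes "is_interval I"
  shows "0 \<le> nroots d I a" "nroots d I a \<le> d + 1" "poly_of d a \<noteq> 0 \<Longrightarrow> nroots d I a \<le> d"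
proof -
  show "0 \<le> nroots d I a" by (simp add: nroots_def)
  have 1: "nroots d I a \<le> d" if "poly_of d a \<noteq> 0"
  proof -
    have "card {x \<in> I. poly (poly_of d a) x = 0} \<le> card {x. poly (poly_of d a) x = 0}"
      using poly_roots_finite[OF that] by (intro card_mono) auto
    also have "\<dots> \<le> d" using card_poly_roots_bound[OF that] degree_poly_of[of d a] by linarith
    finally show ?thesis by (simp add: nroots_def)
  qed
  then show "poly_of d a \<noteq> 0 \<Longrightarrow> nroots d I a \<le> d" .
  show "nroots d I a \<le> d + 1"
  proof (cases "poly_of d a = 0")
    case True
    then show ?thesis using card_interval_le_1[OF assms] by (simp add: nroots_def)
  qed (use 1 in auto)
qed

text \<open>A cardinality is the sum over \<open>m\<close> of the indicators of having at least
  \<open>m\<close> elements; for a nonzero polynomial the first \<open>d\<close> terms suffice. The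
  zero polynomial forms a measurable case of its own.\<close>

lemma nroots_measurable:
  fixes c :: "'a \<Rightarrow> nat \<Rightarrow> real"
  assumes c: "\<And>k. k \<le> d \<Longrightarrow> (\<lambda>\<omega>. c \<omega> k) \<in> borel_measurable M" and I: "is_interval I"
  shows "(\<lambda>\<omega>. nroots d I (c \<omega>)) \<in> borel_measurable M"
proof -
  let ?P = "\<lambda>m \<omega>. \<exists>S\<subseteq>I. finite S \<and> card S = m \<and> (\<forall>x\<in>S. poly (poly_of d (c \<omega>)) x = 0)"
  have P: "{\<omega> \<in> space M. ?P m \<omega>} \<in> sets M" for m
    by (intro many_roots_measurable c sigma_compact_interval I)
  have z: "(\<forall>k\<in>{..d}. c \<omega> k = 0) = (poly_of d (c \<omega>) = 0)" for \<omega>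
    by (auto simp: poly_of_eq_0_iff)
  have "{\<omega> \<in> space M. \<forall>k\<in>{..d}. c \<omega> k = 0} \<in> sets M"
    using c by (intro sets.sets_Collect_finite_All') (auto intro: borel_measurable_eq)
  then have Z: "{\<omega> \<in> space M. poly_of d (c \<omega>) = 0} \<in> sets M"
    unfolding z .
  have eq: "nroots d I (c \<omega>) = (if poly_of d (c \<omega>) = 0 then real (card I) else (\<Sum>m=1..d. of_bool (?P m \<omega>)))" for \<omega>
  proof (cases "poly_of d (c \<omega>) = 0")
    case False
    let ?Z = "{x \<in> I. poly (poly_of d (c \<omega>)) x = 0}"
    have fin: "finite ?Z" using poly_roots_finite[OF False] by simp
    have le: "card ?Z \<le> d" using nroots_bounds(3)[OF I False] by (simp add: nroots_def)
    have "?P m \<omega> \<longleftrightarrow> m \<le> card ?Z" for m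
    proof
      assume "?P m \<omega>"
      then obtain S where S: "S \<subseteq> I" "card S = m" "\<forall>x\<in>S. poly (poly_of d (c \<omega>)) x = 0" by auto
      then have "S \<subseteq> ?Z" by auto
      then show "m \<le> card ?Z" using card_mono[OF fin] S(2) by auto
    next
      assume "m \<le> card ?Z"
      then obtain S where "S \<subseteq> ?Z" "card S = m" "finite S" by (rule obtain_subset_with_card_n)
      then show "?P m \<omega>" by (intro exI[of _ S]) auto
    qed
    then have "(\<Sum>m=1..d. of_bool (?P m \<omega>)) = (\<Sum>m=1..d. of_bool (m \<le> card ?Z) :: real)" by simp
    also have "\<dots> = real (card ({1..d} \<inter> {m. m \<le> card ?Z}))" by (simp add: of_bool_def sum.If_cases)
    also have "{1..d} \<inter> {m. m \<le> card ?Z} = {1..card ?Z}" using le by auto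
    finally show ?thesis using False by (simp add: nroots_def)
  qed (simp add: nroots_def)
  have ofm: "(\<lambda>\<omega>. of_bool (?P m \<omega>) :: real) \<in> borel_measurable M" for m
    unfolding of_bool_def using P by (intro measurable_If) auto
  have "(\<lambda>\<omega>. if poly_of d (c \<omega>) = 0 then real (card I) else (\<Sum>m=1..d. of_bool (?P m \<omega>))) \<in> borel_measurable M"
    by (intro measurable_If borel_measurable_sum borel_measurable_const ofm Z)
  then show ?thesis unfolding eq .
qed

text \<open>Change of variables for the constant function 1 on the image, which is integrable there
  because the image is bounded.\<close>

lemma area_formula:
  fixes g g' :: "real \<Rightarrow> real"
  assumes S: "S \<in> sets borel" and g': "\<And>x. x \<in> S \<Longrightarrow> (g has_field_derivative g' x) (at x)"
    and inj: "inj_on g S" and gS: "g ` S \<in> sets borel" "bounded (g ` S)"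
  shows "(\<integral>\<^sup>+x. ennreal (indicator S x * \<bar>g' x\<bar>) \<partial>lborel) = emeasure lborel (g ` S)"
proof -
  have lm: "g ` S \<in> lmeasurable" using gS by (simp add: bounded_set_imp_lmeasurable)
  have "(\<lambda>x. 1 :: real) absolutely_integrable_on (g ` S) \<and> integral (g ` S) (\<lambda>x. 1) = measure lebesgue (g ` S)"
    using lm by (simp add: lmeasure_integral absolutely_integrable_on_const)
  then have "(\<lambda>x. \<bar>g' x\<bar> * (1::real)) absolutely_integrable_on S \<and> integral S (\<lambda>x. \<bar>g' x\<bar> * 1) = measure lebesgue (g ` S)"
    using S g' inj
    by (subst has_absolute_integral_change_of_variables_1'[where f = "\<lambda>_. 1"]) (auto intro: has_field_derivative_at_within)
  then have "((\<lambda>x. \<bar>g' x\<bar>) has_integral measure lebesgue (g ` S)) S"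
    by (auto simp: has_integral_integrable_integral dest: set_lebesgue_integral_eq_integral(1))
  then have "((\<lambda>x. if x \<in> S then \<bar>g' x\<bar> else 0) has_integral measure lebesgue (g ` S)) UNIV"
    by (simp only: has_integral_restrict_UNIV)
  moreover have "(\<lambda>x. if x \<in> S then \<bar>g' x\<bar> else 0) = (\<lambda>x. indicator S x * \<bar>g' x\<bar>)"
    by (auto simp: indicator_def)
  ultimately have "((\<lambda>x. indicator S x * \<bar>g' x\<bar>) has_integral measure lebesgue (g ` S)) UNIV" by simp
  then have "(\<integral>\<^sup>+x. ennreal (indicator S x * \<bar>g' x\<bar>) \<partial>lebesgue) = ennreal (measure lebesgue (g ` S))"
    by (subst (asm) has_integral_iff_nn_integral_lebesgue) auto
  also have "\<dots> = emeasure lebesgue (g ` S)" using emeasure_eq_ennreal_measure[OF fmeasurableD2[OF lm]] by simp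
  finally show ?thesis using gS(1) by (simp add: nn_integral_completion)
qed

section \<open>Koleda's density\<close>

text \<open>Both measures agree on boxes, where the integral of a product of functions of separate
  coordinates factorises. Used for the cube of coefficients and for the product of the root
  densities.\<close>

lemma PiM_density_lborel:
  fixes f :: "'i \<Rightarrow> real \<Rightarrow> ennreal"
  assumes I: "finite I" and f: "\<And>i. f i \<in> borel_measurable borel"
    and fin: "\<And>i. finite_measure (density lborel (f i))"
  shows "Pi\<^sub>M I (\<lambda>i. density lborel (f i)) = density (Pi\<^sub>M I (\<lambda>_. lborel)) (\<lambda>x. \<Prod>i\<in>I. f i (x i))"
proof -
  interpret D: product_sigma_finite "\<lambda>i. density lborel (f i)"
    using fin by (auto simp: product_sigma_finite_def finite_measure_def)
  interpret L: product_sigma_finite "\<lambda>_::'i. lborel :: real measure" by standard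
  show ?thesis
  proof (rule D.PiM_eqI[OF I, symmetric])
    show "sets (density (Pi\<^sub>M I (\<lambda>_. lborel)) (\<lambda>x. \<Prod>i\<in>I. f i (x i))) = sets (Pi\<^sub>M I (\<lambda>i. density lborel (f i)))"
      by (simp cong: sets_PiM_cong)
    fix A assume A: "\<And>i. i \<in> I \<Longrightarrow> A i \<in> sets (density lborel (f i))"
    then have A': "i \<in> I \<Longrightarrow> A i \<in> sets borel" for i by simp
    have fm: "(\<lambda>x. f i (x i)) \<in> borel_measurable (Pi\<^sub>M I (\<lambda>_. lborel))" if "i \<in> I" for i
      by (rule measurable_compose[OF measurable_component_singleton[OF that]]) (simp add: f)
    have "emeasure (density (Pi\<^sub>M I (\<lambda>_. lborel)) (\<lambda>x. \<Prod>i\<in>I. f i (x i))) (Pi\<^sub>E I A)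
        = (\<integral>\<^sup>+x. (\<Prod>i\<in>I. f i (x i)) * indicator (Pi\<^sub>E I A) x \<partial>Pi\<^sub>M I (\<lambda>_. lborel))"
      using I A' fm by (intro emeasure_density borel_measurable_prod sets_PiM_I_finite) auto
    also have "\<dots> = (\<integral>\<^sup>+x. (\<Prod>i\<in>I. f i (x i) * indicator (A i) (x i)) \<partial>Pi\<^sub>M I (\<lambda>_. lborel))"
    proof (rule nn_integral_cong)
      fix x assume "x \<in> space (Pi\<^sub>M I (\<lambda>_. lborel :: real measure))"
      then have "indicator (Pi\<^sub>E I A) x = (\<Prod>i\<in>I. indicator (A i) (x i) :: ennreal)"
        using I by (auto simp: indicator_def space_PiM PiE_iff prod_zero_iff)
      then show "(\<Prod>i\<in>I. f i (x i)) * indicator (Pi\<^sub>E I A) x = (\<Prod>i\<in>I. f i (x i) * indicator (A i) (x i))"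
        by (simp add: prod.distrib)
    qed
    also have "\<dots> = (\<Prod>i\<in>I. \<integral>\<^sup>+x. f i x * indicator (A i) x \<partial>lborel)"
      using f A' by (intro L.product_nn_integral_prod I) auto
    also have "\<dots> = (\<Prod>i\<in>I. emeasure (density lborel (f i)) (A i))"
      using f A' by (intro prod.cong refl emeasure_density[symmetric]) auto
    finally show "emeasure (density (Pi\<^sub>M I (\<lambda>_. lborel)) (\<lambda>x. \<Prod>i\<in>I. f i (x i))) (Pi\<^sub>E I A)
        = (\<Prod>i\<in>I. emeasure (density lborel (f i)) (A i))" .
  qed
qed

lemma PiM_unit_box:
  assumes I: "finite I"
  shows "Pi\<^sub>M I (\<lambda>_. unit_box) = density (Pi\<^sub>M I (\<lambda>_. lborel)) (\<lambda>x. ennreal (\<Prod>i\<in>I. indicator {-1..1} (x i)))"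
proof -
  have "Pi\<^sub>M I (\<lambda>_. density lborel (indicator {-1..1})) = density (Pi\<^sub>M I (\<lambda>_. lborel)) (\<lambda>x. \<Prod>i\<in>I. indicator {-1..1 :: real} (x i))"
    using mass_leD(3)[OF mass_le_unit_box[OF order_refl]] unfolding unit_box_def
    by (intro PiM_density_lborel[OF I]) auto
  then show ?thesis
    unfolding unit_box_def by (simp add: prod_ennreal flip: ennreal_indicator)
qed

lemma unit_box_indicator_measurable:
  "(\<lambda>p. \<Prod>i\<in>I. indicator {-1..1 :: real} (p i) :: real) \<in> borel_measurable (Pi\<^sub>M I (\<lambda>_. lborel))"
proof (rule borel_measurable_prod)
  fix i assume "i \<in> I"
  then show "(\<lambda>p. indicator {-1..1 :: real} (p i) :: real) \<in> borel_measurable (Pi\<^sub>M I (\<lambda>_. lborel))"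
    by (rule measurable_compose[OF measurable_component_singleton]) (rule borel_measurable_indicator, simp)
qed

lemma poly_of_deriv: "poly (pderiv (poly_of d a)) x = (\<Sum>k=1..d. real k * a k * x ^ (k - 1))"
proof (induction d)
  case (Suc d)
  have "poly_of (Suc d) a = poly_of d a + monom (a (Suc d)) (Suc d)" by (simp add: poly_of_def)
  then show ?case using Suc by (simp add: pderiv_add pderiv_monom poly_monom)
qed (simp add: poly_of_def monom_0)

lemma poly_of_deriv_upd_0:
  "poly (pderiv (poly_of d (a(0 := 0)))) x = (\<Sum>k=1..d. real k * a k * x ^ (k - 1))"
  unfolding poly_of_deriv by (intro sum.cong refl) auto

lemma poly_of_upd_0: "poly (poly_of d (a(0 := 0))) x = (\<Sum>k=1..d. a k * x ^ k)"
proof -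
  have "(\<Sum>k\<in>{..d}. (a(0 := 0)) k * x ^ k) = (\<Sum>k\<in>{1..d}. (a(0 := 0)) k * x ^ k)"
    by (rule sum.mono_neutral_right) auto
  then show ?thesis by (simp add: poly_poly_of)
qed

text \<open>The source of the density: \<open>x\<close> is a root exactly for the constant
  coefficient \<open>- P x\<close>, so the left-hand side measures with multiplicity the part of the
  image of \<open>I\<close> under \<open>- P\<close> in [-1, 1]. Cutting at the critical points
  makes \<open>- P\<close> injective and the area formula applies.\<close>

lemma nn_integral_nroots_constant_coeff:
  fixes a :: "nat \<Rightarrow> real" and d :: nat
  assumes I: "is_interval I"
  defines "P \<equiv> poly_of d (a(0 := 0))"
  shows "(\<integral>\<^sup>+c. ennreal (nroots d I (a(0 := c))) \<partial>unit_box) =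
    (\<integral>\<^sup>+x. ennreal (indicator I x * (\<bar>poly (pderiv P) x\<bar> * indicator {-1..1} (poly P x))) \<partial>lborel)"
proof (cases "P = 0")
  case True
  \<comment> \<open>Here the polynomial is the constant \<open>c\<close>; it has no roots except for
    the null set \<open>c = 0\<close>, and the right-hand side vanishes with the derivative.\<close>
  have z: "nroots d I (a(0 := c)) = 0" if "c \<noteq> 0" for c
    using that True root_upd_iff[of 0 d a c] by (simp add: nroots_def P_def)
  have "AE c in unit_box. c \<noteq> 0"
    unfolding unit_box_def using AE_lborel_singleton[of 0]
    by (subst AE_density) auto
  then have "(\<integral>\<^sup>+c. ennreal (nroots d I (a(0 := c))) \<partial>unit_box) = (\<integral>\<^sup>+c. 0 \<partial>unit_box)"
    by (intro nn_integral_cong_AE) (auto simp: z elim: eventually_mono)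
  then show ?thesis by (simp add: True)
next
  case False
  define R where "R = crit_points d 0 (a(0 := 0))"
  define G where "G = (\<lambda>k. coeff_set d 0 a (I \<inter> cell R k))"
  define S where "S = (\<lambda>k. (I \<inter> cell R k) \<inter> poly P -` {-1..1})"
  have F: "finite R" "card R \<le> d + 1" using crit_points_finite[OF False[unfolded P_def]] by (simp_all add: R_def)
  have Sb: "S k \<in> sets borel" for k
  proof -
    have "poly P \<in> borel_measurable borel" by (intro borel_measurable_continuous_onI continuous_intros)
    then have "poly P -` {-1..1} \<in> sets borel" by (rule measurable_sets_borel) simp
    moreover have "I \<inter> cell R k \<in> sets borel"
      by (intro sets.Int is_interval_borel[OF I] is_interval_borel[OF is_interval_cell[OF F(1)]])
    ultimately show ?thesis unfolding S_def by (rule sets.Int[rotated])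
  qed
  have rt: "poly (poly_of d (a(0 := c))) x = 0 \<longleftrightarrow> c = - poly P x" for c x
    using root_upd_iff[of 0 d a c x] by (auto simp: P_def)
  have GS: "G k \<inter> {-1..1} = (\<lambda>x. - poly P x) ` S k" for k
    unfolding G_def coeff_set_def rt S_def by force
  have Gi: "is_interval (G k)" for k
    unfolding G_def R_def by (rule is_interval_coeff_set_cell[OF _ False[unfolded P_def] I]) simp
  have inj: "inj_on (\<lambda>x. - poly P x) (S k)" for k
  proof (rule inj_onI)
    fix x y assume xy: "x \<in> S k" "y \<in> S k" "- poly P x = - poly P y"
    then have c: "x \<in> cell R k" "y \<in> cell R k" by (auto simp: S_def)
    show "x = y"
    proof (cases "cell R k \<inter> R = {}")
      case True
      show ?thesis
      proof (rule root_unique_off_crit_points)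
        show "is_interval (cell R k)" by (rule is_interval_cell[OF F(1)])
        show "cell R k \<inter> crit_points d 0 (a(0 := 0)) = {}" using True by (simp only: R_def)
        show "poly (poly_of d (a(0 := - poly P x))) x = 0" "poly (poly_of d (a(0 := - poly P x))) y = 0"
          unfolding rt using xy(3) by simp_all
      qed (use c in simp_all)
    next
      case False
      then obtain r where r: "cell R k = {r}" using cell_cases[OF F(1), of k] by auto
      then show ?thesis using c by simp
    qed
  qed
  have "(\<integral>\<^sup>+c. ennreal (nroots d I (a(0 := c))) \<partial>unit_box) = (\<integral>\<^sup>+c. (\<Sum>k\<le>2 * (d + 1). indicator (G k) c) \<partial>unit_box)"
  proof (rule nn_integral_cong)
    fix c
    have "nroots d I (a(0 := c)) = (\<Sum>k\<le>2 * (d + 1). indicator (G k) c)"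
      unfolding G_def R_def by (rule nroots_eq_sum_indicator[OF _ False[unfolded P_def]]) simp
    then show "ennreal (nroots d I (a(0 := c))) = (\<Sum>k\<le>2 * (d + 1). indicator (G k) c)"
      by (simp only: ennreal_indicator[symmetric]) (subst sum_ennreal, simp_all)
  qed
  also have "\<dots> = (\<Sum>k\<le>2 * (d + 1). emeasure unit_box (G k))"
    using is_interval_borel[OF Gi] by (subst nn_integral_sum) (auto intro: borel_measurable_indicator)
  also have "\<dots> = (\<Sum>k\<le>2 * (d + 1). emeasure lborel ((\<lambda>x. - poly P x) ` S k))"
    using is_interval_borel[OF Gi] by (simp add: emeasure_unit_box GS)
  also have "\<dots> = (\<Sum>k\<le>2 * (d + 1). \<integral>\<^sup>+x. ennreal (indicator (S k) x * \<bar>- poly (pderiv P) x\<bar>) \<partial>lborel)"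
  proof (intro sum.cong refl area_formula[symmetric] Sb inj)
    fix k x
    show "((\<lambda>x. - poly P x) has_field_derivative - poly (pderiv P) x) (at x)"
      by (auto intro!: derivative_eq_intros)
    show "(\<lambda>x. - poly P x) ` S k \<in> sets borel"
      unfolding GS[symmetric] using is_interval_borel[OF Gi] by auto
    show "bounded ((\<lambda>x. - poly P x) ` S k)"
      unfolding GS[symmetric] by (rule bounded_subset[of "{-1..1}"]) auto
  qed
  also have "\<dots> = (\<integral>\<^sup>+x. (\<Sum>k\<le>2 * (d + 1). ennreal (indicator (S k) x * \<bar>- poly (pderiv P) x\<bar>)) \<partial>lborel)"
  proof -
    have "(\<lambda>x. \<bar>- poly (pderiv P) x\<bar>) \<in> borel_measurable borel"
      by (intro borel_measurable_continuous_onI continuous_intros)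
    then show ?thesis using Sb by (subst nn_integral_sum) auto
  qed
  also have "\<dots> = (\<integral>\<^sup>+x. ennreal (indicator I x * (\<bar>poly (pderiv P) x\<bar> * indicator {-1..1} (poly P x))) \<partial>lborel)"
  proof (rule nn_integral_cong)
    fix x
    have le: "cell_index R x \<le> 2 * (d + 1)" 
      by (rule order_trans[OF cell_index_le[OF F(1)] mult_le_mono2[OF F(2)]])
    have "(\<Sum>k\<le>2 * (d + 1). ennreal (indicator (S k) x * \<bar>- poly (pderiv P) x\<bar>))
        = ennreal (\<Sum>k\<le>2 * (d + 1). indicator (S k) x * \<bar>- poly (pderiv P) x\<bar>)" by (subst sum_ennreal) auto
    also have "(\<Sum>k\<le>2 * (d + 1). indicator (S k) x * \<bar>- poly (pderiv P) x\<bar>)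
       = (\<Sum>k\<le>2 * (d + 1). if k = cell_index R x then indicator I x * (\<bar>poly (pderiv P) x\<bar> * indicator {-1..1} (poly P x)) else 0)"
      by (intro sum.cong refl) (auto simp: S_def cell_def indicator_def)
    also have "\<dots> = indicator I x * (\<bar>poly (pderiv P) x\<bar> * indicator {-1..1} (poly P x))"
      using le by simp
    finally show "(\<Sum>k\<le>2 * (d + 1). ennreal (indicator (S k) x * \<bar>- poly (pderiv P) x\<bar>)) =
        ennreal (indicator I x * (\<bar>poly (pderiv P) x\<bar> * indicator {-1..1} (poly P x)))" .
  qed
  finally show ?thesis .
qed

text \<open>Moves the box condition of \<open>Delta\<close> into the measure, leaving the condition
  on the value at \<open>x\<close> in the integrand. The extensionality hidden in
  \<open>Delta\<close> holds for every point of the product space.\<close>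

lemma rho_eq_unit_box:
  "rho d x = (\<integral>p. \<bar>\<Sum>k=1..d. real k * p k * x ^ (k - 1)\<bar> * indicator {-1..1} (\<Sum>k=1..d. p k * x ^ k) \<partial>Pi\<^sub>M {1..d} (\<lambda>_. unit_box))"
proof -
  let ?g = "\<lambda>p::nat \<Rightarrow> real. \<bar>\<Sum>k=1..d. real k * p k * x ^ (k - 1)\<bar> * indicator {-1..1} (\<Sum>k=1..d. p k * x ^ k)"
  have g: "?g \<in> borel_measurable (Pi\<^sub>M {1..d} (\<lambda>_. lborel))" by measurable
  have b: "(\<lambda>p. \<Prod>i\<in>{1..d}. indicator {-1..1 :: real} (p i) :: real) \<in> borel_measurable (Pi\<^sub>M {1..d} (\<lambda>_. lborel))"
    by (rule unit_box_indicator_measurable)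
  have "rho d x = (\<integral>p. (\<Prod>i\<in>{1..d}. indicator {-1..1} (p i)) *\<^sub>R ?g p \<partial>Pi\<^sub>M {1..d} (\<lambda>_. lborel))"
    unfolding rho_def set_lebesgue_integral_def
  proof (intro Bochner_Integration.integral_cong refl)
    fix p :: "nat \<Rightarrow> real" assume "p \<in> space (Pi\<^sub>M {1..d} (\<lambda>_. lborel :: real measure))"
    then have "p \<in> extensional {1..d}" by (auto simp: space_PiM PiE_def)
    then have 1: "p \<in> {1..d} \<rightarrow>\<^sub>E {-1..1} \<longleftrightarrow> (\<forall>i\<in>{1..d}. p i \<in> {-1..1})" by (auto simp: PiE_def)
    have 2: "(\<Prod>i\<in>{1..d}. indicator {-1..1} (p i)) = (if \<forall>i\<in>{1..d}. p i \<in> {-1..1} then 1 else 0 :: real)"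
      by (auto simp: indicator_def prod_zero_iff)
    show "indicat_real (Delta d x) p *\<^sub>R \<bar>\<Sum>k = 1..d. real k * p k * x ^ (k - 1)\<bar> = (\<Prod>i\<in>{1..d}. indicator {-1..1} (p i)) *\<^sub>R ?g p"
      unfolding 2 Delta_def using 1 by (auto simp: indicator_def abs_le_iff)
  qed
  also have "\<dots> = (\<integral>p. ?g p \<partial>Pi\<^sub>M {1..d} (\<lambda>_. unit_box))"
    unfolding PiM_unit_box[OF finite_atLeastAtMost]
    by (rule integral_density[symmetric]) (use g b in \<open>auto intro!: prod_nonneg\<close>)
  finally show ?thesis .
qed

lemma rho_nonneg: "0 \<le> rho d x"
  unfolding rho_eq_unit_box by (intro integral_nonneg_AE) auto

text \<open>Integrability has to be shown for the two kinds of integral to agree: on the cube, which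
  carries the whole measure, the integrand is bounded by a polynomial in
  \<open>\<bar>x\<bar>\<close>.\<close>

lemma nn_integral_rho:
  "(\<integral>\<^sup>+p. ennreal (\<bar>\<Sum>k=1..d. real k * p k * x ^ (k - 1)\<bar> * indicator {-1..1} (\<Sum>k=1..d. p k * x ^ k)) \<partial>Pi\<^sub>M {1..d} (\<lambda>_. unit_box))
    = ennreal (rho d x)"
  unfolding rho_eq_unit_box
proof (rule nn_integral_eq_integral)
  let ?M = "Pi\<^sub>M {1..d} (\<lambda>_. unit_box)"
  let ?g = "\<lambda>p::nat \<Rightarrow> real. \<bar>\<Sum>k=1..d. real k * p k * x ^ (k - 1)\<bar> * indicator {-1..1} (\<Sum>k=1..d. p k * x ^ k)"
  interpret finite_measure ?M by (rule PiM_mass[OF mass_le_unit_box[OF order_refl]]) simp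
  have se: "sets ?M = sets (Pi\<^sub>M {1..d} (\<lambda>_. borel))" by (intro sets_PiM_cong) auto
  have g: "?g \<in> borel_measurable (Pi\<^sub>M {1..d} (\<lambda>_. borel))" by measurable
  then have g: "?g \<in> borel_measurable ?M" using measurable_cong_sets[OF se refl] by blast
  have b: "(\<lambda>p. ennreal (\<Prod>i\<in>{1..d}. indicator {-1..1} (p i))) \<in> borel_measurable (Pi\<^sub>M {1..d} (\<lambda>_. lborel :: real measure))"
    by (intro measurable_compose[OF unit_box_indicator_measurable]) simp
  have "AE p in ?M. \<forall>i\<in>{1..d}. p i \<in> {-1..1}"
    unfolding PiM_unit_box[OF finite_atLeastAtMost] AE_density[OF b]
  proof (intro AE_I2 impI ballI, rule ccontr)
    fix p :: "nat \<Rightarrow> real" and i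
    assume pos: "0 < ennreal (\<Prod>i\<in>{1..d}. indicator {-1..1} (p i))" and i: "i \<in> {1..d}" "p i \<notin> {-1..1}"
    have "(\<Prod>i\<in>{1..d}. indicator {-1..1} (p i)) = (0 :: real)"
      by (rule prod_zero) (use i in \<open>auto intro!: bexI[of _ i]\<close>)
    with pos show False by (simp only: ennreal_0 less_irrefl)
  qed
  then have "AE p in ?M. norm (?g p) \<le> (\<Sum>k=1..d. real k * \<bar>x\<bar> ^ (k - 1))"
  proof (rule eventually_mono)
    fix p assume p: "\<forall>i\<in>{1..d}. p i \<in> {-1..1 :: real}"
    have "norm (?g p) \<le> \<bar>\<Sum>k=1..d. real k * p k * x ^ (k - 1)\<bar>" by (simp add: indicator_def)
    also have "\<dots> \<le> (\<Sum>k=1..d. \<bar>real k * p k * x ^ (k - 1)\<bar>)" by (rule sum_abs)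
    also have "\<dots> \<le> (\<Sum>k=1..d. real k * \<bar>x\<bar> ^ (k - 1))"
    proof (rule sum_mono)
      fix k assume "k \<in> {1..d}"
      then have "\<bar>p k\<bar> \<le> 1" using p by (auto simp: abs_le_iff)
      then have "real k * \<bar>p k\<bar> \<le> real k * 1" by (intro mult_left_mono) auto
      then show "\<bar>real k * p k * x ^ (k - 1)\<bar> \<le> real k * \<bar>x\<bar> ^ (k - 1)"
        unfolding abs_mult power_abs by (intro mult_right_mono) auto
    qed
    finally show "norm (?g p) \<le> (\<Sum>k=1..d. real k * \<bar>x\<bar> ^ (k - 1))" .
  qed
  then show "integrable ?M ?g" using g by (rule integrable_const_bound)
qed auto

text \<open>Not normalised: the cube has volume \<open>2 ^ (d + 1)\<close>. In this form it is the
  coefficient of the main term \<open>H ^ (d + 1)\<close> in the lattice count.\<close>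

definition root_mean :: "nat \<Rightarrow> real set \<Rightarrow> real" where
  "root_mean d I = (\<integral>a. nroots d I a \<partial>Pi\<^sub>M {..d} (\<lambda>_. unit_box))"

lemma nroots_PiM_measurable: "is_interval I \<Longrightarrow> nroots d I \<in> borel_measurable (Pi\<^sub>M {..d} (\<lambda>_. borel))"
  by (rule nroots_measurable[where c = "\<lambda>a. a"]) auto

lemma rho_measurable: "rho d \<in> borel_measurable borel"
proof -
  let ?M = "Pi\<^sub>M {1..d} (\<lambda>_. unit_box)"
  have se: "sets (borel \<Otimes>\<^sub>M ?M) = sets (borel \<Otimes>\<^sub>M Pi\<^sub>M {1..d} (\<lambda>_. borel :: real measure))"
    by (intro sets_pair_measure_cong sets_PiM_cong) auto
  interpret finite_measure ?M by (rule PiM_mass[OF mass_le_unit_box[OF order_refl]]) simp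
  have "(\<lambda>(x, p). \<bar>\<Sum>k=1..d. real k * p k * x ^ (k - 1)\<bar> * indicator {-1..1} (\<Sum>k=1..d. p k * x ^ k) :: real)
     \<in> borel_measurable (borel \<Otimes>\<^sub>M Pi\<^sub>M {1..d} (\<lambda>_. borel :: real measure))"
    by measurable
  then have "(\<lambda>(x, p). \<bar>\<Sum>k=1..d. real k * p k * x ^ (k - 1)\<bar> * indicator {-1..1} (\<Sum>k=1..d. p k * x ^ k) :: real)
     \<in> borel_measurable (borel \<Otimes>\<^sub>M ?M)"
    using measurable_cong_sets[OF se refl] by blast
  then have "(\<lambda>x. \<integral>p. \<bar>\<Sum>k=1..d. real k * p k * x ^ (k - 1)\<bar> * indicator {-1..1} (\<Sum>k=1..d. p k * x ^ k) \<partial>?M) \<in> borel_measurable borel"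
    by (rule borel_measurable_lebesgue_integral)
  then show ?thesis unfolding rho_eq_unit_box[symmetric] by simp
qed

text \<open>Integrating over the constant coefficient alone yields an integral over
  \<open>x\<close>; exchanging it with the integral over the other \<open>d\<close> coefficients
  produces \<open>rho\<close>, which is why the latter has \<open>d\<close> variables and not
  \<open>d + 1\<close>.\<close>

lemma ennreal_root_mean:
  assumes I: "is_interval I"
  shows "ennreal (root_mean d I) = (\<integral>\<^sup>+x. ennreal (indicator I x * rho d x) \<partial>lborel)"
proof -
  let ?M = "Pi\<^sub>M {1..d} (\<lambda>_. unit_box)"
  let ?F = "\<lambda>a x. indicator I x * (\<bar>\<Sum>k=1..d. real k * a k * x ^ (k - 1)\<bar> * indicator {-1..1} (\<Sum>k=1..d. a k * x ^ k)) :: real"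
  note ub = mass_le_unit_box[OF order_refl]
  interpret P: product_sigma_finite "\<lambda>_::nat. unit_box"
    using mass_leD(3)[OF ub] by (auto simp: product_sigma_finite_def finite_measure_def)
  interpret D: finite_measure "Pi\<^sub>M {..d} (\<lambda>_. unit_box)" by (rule PiM_mass[OF ub]) simp
  interpret M: finite_measure ?M by (rule PiM_mass[OF ub]) simp
  interpret PS: pair_sigma_finite ?M "lborel :: real measure" by standard
  have se: "sets (Pi\<^sub>M A (\<lambda>_. unit_box)) = sets (Pi\<^sub>M A (\<lambda>_. borel))" for A :: "nat set" by (intro sets_PiM_cong) auto
  have nm: "nroots d I \<in> borel_measurable (Pi\<^sub>M {..d} (\<lambda>_. unit_box))"
    using nroots_PiM_measurable[OF I] measurable_cong_sets[OF se refl] by blast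
  have ins: "{..d} = insert 0 {1..d}" by auto
  have Ib[measurable]: "I \<in> sets borel" using I by (rule is_interval_borel)
  have int: "integrable (Pi\<^sub>M {..d} (\<lambda>_. unit_box)) (nroots d I)"
    by (rule D.integrable_const_bound[of _ "d + 1"]) (use nroots_bounds[OF I] nm in auto)
  have Fm: "(\<lambda>(a, x). ennreal (?F a x)) \<in> borel_measurable (Pi\<^sub>M {1..d} (\<lambda>_. borel :: real measure) \<Otimes>\<^sub>M borel)"
    by measurable
  have sp: "sets (?M \<Otimes>\<^sub>M lborel) = sets (Pi\<^sub>M {1..d} (\<lambda>_. borel :: real measure) \<Otimes>\<^sub>M borel)"
    by (intro sets_pair_measure_cong se) simp
  have Fm: "(\<lambda>(a, x). ennreal (?F a x)) \<in> borel_measurable (?M \<Otimes>\<^sub>M lborel)"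
    using Fm measurable_cong_sets[OF sp refl] by blast
  have "ennreal (root_mean d I) = (\<integral>\<^sup>+a. ennreal (nroots d I a) \<partial>Pi\<^sub>M {..d} (\<lambda>_. unit_box))"
    unfolding root_mean_def using nroots_bounds(1)[OF I] by (intro nn_integral_eq_integral[symmetric] int) auto
  also have "\<dots> = (\<integral>\<^sup>+a. (\<integral>\<^sup>+c. ennreal (nroots d I (a(0 := c))) \<partial>unit_box) \<partial>?M)"
    unfolding ins using nm[unfolded ins] by (intro P.product_nn_integral_insert) auto
  also have "\<dots> = (\<integral>\<^sup>+a. (\<integral>\<^sup>+x. ennreal (?F a x) \<partial>lborel) \<partial>?M)"
    unfolding nn_integral_nroots_constant_coeff[OF I] poly_of_deriv_upd_0 poly_of_upd_0 ..
  also have "\<dots> = (\<integral>\<^sup>+x. (\<integral>\<^sup>+a. ennreal (?F a x) \<partial>?M) \<partial>lborel)"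
    by (rule PS.Fubini'[symmetric]) (rule Fm)
  also have "\<dots> = (\<integral>\<^sup>+x. ennreal (indicator I x * rho d x) \<partial>lborel)"
  proof (rule nn_integral_cong)
    fix x
    show "(\<integral>\<^sup>+a. ennreal (?F a x) \<partial>?M) = ennreal (indicator I x * rho d x)"
      using nn_integral_rho[where d = d and x = x] by (cases "x \<in> I") auto
  qed
  finally show ?thesis .
qed

text \<open>Each of the \<open>d + 1\<close> coefficients is exchanged at the price
  \<open>(2 * d + 3) / H\<close>, multiplied by the mass bound \<open>3 ^ d\<close> of the
  \<open>d\<close> other factors.\<close>

lemma nroots_grid_sum:
  assumes I: "is_interval I" and H: "1 \<le> H"
  shows "\<bar>(1 / H) ^ (d + 1) * (\<Sum>a\<in>{..d} \<rightarrow>\<^sub>E grid H. nroots d I a) - root_mean d I\<bar> \<le> (d + 1) * (2 * d + 3) * 3 ^ d / H"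
proof -
  have "\<bar>(\<integral>a. nroots d I a \<partial>Pi\<^sub>M {..d} (\<lambda>_. grid_box H)) - (\<integral>a. nroots d I a \<partial>Pi\<^sub>M {..d} (\<lambda>_. unit_box))\<bar>
    \<le> (\<Sum>i\<in>{..d}. (2 * d + 3) / H * (\<Prod>j\<in>{..d} - {i}. 3))"
    by (rule PiM_integral_change_all[where B = "d + 1"])
      (use nroots_bounds[OF I] in \<open>auto intro!: mass_le_grid_box[OF H] mass_le_unit_box nroots_PiM_measurable[OF I] nroots_line[OF _ I H, simplified]\<close>)
  also have "(\<Sum>i\<in>{..d}. (2 * d + 3) / H * (\<Prod>j\<in>{..d} - {i}. 3)) = (\<Sum>i\<in>{..d}. (2 * d + 3) / H * 3 ^ d)"
    by (intro sum.cong refl) simp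
  also have "\<dots> = (d + 1) * (2 * d + 3) * 3 ^ d / H" by (simp add: algebra_simps add_divide_distrib)
  also have "(\<integral>a. nroots d I a \<partial>Pi\<^sub>M {..d} (\<lambda>_. grid_box H)) = (\<Prod>i\<in>{..d}. 1 / H) * (\<Sum>a\<in>{..d} \<rightarrow>\<^sub>E grid H. nroots d I a)"
    unfolding grid_box_def
    by (rule integral_PiM_point_masses[where B = "d + 1"])
      (use nroots_bounds[OF I] H finite_grid nroots_PiM_measurable[OF I] in auto)
  finally show ?thesis
    unfolding root_mean_def prod_constant card_atMost Suc_eq_plus1
      of_nat_mult of_nat_add of_nat_power of_nat_numeral of_nat_1 .
qed

section \<open>Integer polynomials and the sieve\<close>

text \<open>The degree is only bounded, so that the set corresponds to a full box of lattice points;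
  polynomials of smaller degree are removed at the end as exceptions.\<close>

definition int_box :: "nat \<Rightarrow> real \<Rightarrow> int poly set" where
  "int_box d X = {p. degree p \<le> d \<and> (\<forall>k. real_of_int \<bar>coeff p k\<bar> \<le> X)}"

definition zroots :: "real set \<Rightarrow> int poly \<Rightarrow> real" where
  "zroots I p = real (card {x \<in> I. poly (map_poly real_of_int p) x = 0})"

lemma poly_map_of_int: "poly (map_poly real_of_int p) x = (\<Sum>k\<le>degree p. real_of_int (coeff p k) * x ^ k)"
  by (simp add: poly_altdef coeff_map_poly degree_map_poly)

lemma map_poly_of_int_eq_0_iff: "map_poly real_of_int p = 0 \<longleftrightarrow> p = 0"
  by (simp add: map_poly_eq_0_iff)

definition grid_coeffs :: "nat \<Rightarrow> real \<Rightarrow> int poly \<Rightarrow> nat \<Rightarrow> real" where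
  "grid_coeffs d H p = restrict (\<lambda>k. real_of_int (coeff p k) / H) {..d}"

lemma grid_coeffs_bij:
  assumes H: "0 < H"
  shows "bij_betw (grid_coeffs d H) (int_box d H) ({..d} \<rightarrow>\<^sub>E grid H)"
proof (rule bij_betwI[where g = "\<lambda>a. \<Sum>k\<le>d. monom \<lfloor>a k * H\<rfloor> k"])
  have c: "coeff (\<Sum>k\<le>d. monom (f k) k) n = (if n \<le> d then f n else 0)" for f :: "nat \<Rightarrow> int" and n
    by (simp add: coeff_sum if_distrib cong: if_cong)
  have fl: "of_int \<lfloor>x * H\<rfloor> = x * H \<and> \<bar>x * H\<bar> \<le> H" if "x \<in> grid H" for x
    using that H by (auto simp: grid_def)
  show "grid_coeffs d H \<in> int_box d H \<rightarrow> {..d} \<rightarrow>\<^sub>E grid H"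
  proof
    fix p assume "p \<in> int_box d H"
    then show "grid_coeffs d H p \<in> {..d} \<rightarrow>\<^sub>E grid H"
      unfolding grid_coeffs_def restrict_PiE_iff by (auto simp: int_box_def grid_def)
  qed
  show "(\<lambda>a. \<Sum>k\<le>d. monom \<lfloor>a k * H\<rfloor> k) \<in> ({..d} \<rightarrow>\<^sub>E grid H) \<rightarrow> int_box d H"
  proof
    fix a assume a: "a \<in> {..d} \<rightarrow>\<^sub>E grid H"
    have "real_of_int \<bar>coeff (\<Sum>k\<le>d. monom \<lfloor>a k * H\<rfloor> k) n\<bar> \<le> H" for n
    proof (cases "n \<le> d")
      case True
      then have g: "a n \<in> grid H" using a by auto
      show ?thesis using True conjunct2[OF fl[OF g]]
        by (simp only: c if_True of_int_abs conjunct1[OF fl[OF g]])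
    qed (use H in \<open>simp add: c\<close>)
    then show "(\<Sum>k\<le>d. monom \<lfloor>a k * H\<rfloor> k) \<in> int_box d H"
      by (auto simp: int_box_def intro!: degree_le simp: c)
  qed
  show "(\<Sum>k\<le>d. monom \<lfloor>grid_coeffs d H p k * H\<rfloor> k) = p" if "p \<in> int_box d H" for p
    using that H by (intro poly_eqI) (auto simp: c grid_coeffs_def int_box_def coeff_eq_0)
  show "grid_coeffs d H (\<Sum>k\<le>d. monom \<lfloor>a k * H\<rfloor> k) = a" if a: "a \<in> {..d} \<rightarrow>\<^sub>E grid H" for a
  proof
    fix k
    show "grid_coeffs d H (\<Sum>k\<le>d. monom \<lfloor>a k * H\<rfloor> k) k = a k"
    proof (cases "k \<le> d")
      case True
      then have g: "a k \<in> grid H" using a by auto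
      have "grid_coeffs d H (\<Sum>k\<le>d. monom \<lfloor>a k * H\<rfloor> k) k = of_int \<lfloor>a k * H\<rfloor> / H"
        using True by (simp only: grid_coeffs_def c restrict_apply atMost_iff if_True)
      then show ?thesis using H unfolding conjunct1[OF fl[OF g]] by simp
    next
      case False
      then show ?thesis using a by (auto simp: grid_coeffs_def PiE_def extensional_def)
    qed
  qed
qed

lemma finite_int_box: "finite (int_box d X)"
proof (cases "0 < X")
  case True
  have "finite ({..d} \<rightarrow>\<^sub>E grid X)" by (intro finite_PiE) (auto intro: finite_grid)
  then show ?thesis using bij_betw_finite[OF grid_coeffs_bij[OF True, of d]] by simp
next
  case False
  have "int_box d X \<subseteq> {0}"
  proof
    fix p assume "p \<in> int_box d X"
    then have "real_of_int \<bar>coeff p k\<bar> \<le> X" for k by (simp add: int_box_def)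
    then have "real_of_int \<bar>coeff p k\<bar> \<le> 0" for k using False by (meson not_less order_trans)
    then have "coeff p k = 0" for k by (metis abs_le_zero_iff of_int_le_0_iff)
    then have "p = 0" by (intro poly_eqI) simp
    then show "p \<in> {0}" by simp
  qed
  then show ?thesis by (rule finite_subset) simp
qed

lemma card_int_box:
  fixes X :: real
  assumes "1 \<le> X"
  shows "card (int_box d X) \<le> (3 * X) ^ (d + 1)"
proof -
  have "card (int_box d X) = card ({..d} \<rightarrow>\<^sub>E grid X)"
    using assms by (intro bij_betw_same_card[OF grid_coeffs_bij]) auto
  also have "\<dots> = card (grid X) ^ (d + 1)" by (simp add: card_PiE)
  finally have "real (card (int_box d X)) = real (card (grid X)) ^ (d + 1)" by simp
  also have "\<dots> \<le> (3 * X) ^ (d + 1)" using card_grid_le[of X] assms by (intro power_mono) auto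
  finally show ?thesis .
qed

lemma zroots_bounds:
  assumes "p \<noteq> 0"
  shows "0 \<le> zroots I p" "zroots I p \<le> degree p"
proof -
  show "0 \<le> zroots I p" by (simp add: zroots_def)
  have n: "map_poly real_of_int p \<noteq> 0" using assms map_poly_of_int_eq_0_iff by blast
  have "card {x \<in> I. poly (map_poly real_of_int p) x = 0} \<le> card {x. poly (map_poly real_of_int p) x = 0}"
    using poly_roots_finite[OF n] by (intro card_mono) auto
  also have "\<dots> \<le> degree p" using card_poly_roots_bound[OF n] by (simp add: degree_map_poly)
  finally show "zroots I p \<le> degree p" by (simp add: zroots_def)
qed

lemma zroots_smult: "e \<noteq> 0 \<Longrightarrow> zroots I (smult e p) = zroots I p"
  by (simp add: zroots_def map_poly_smult)

lemma sum_grid_eq_sum_int_box: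
  assumes H: "0 < H"
  shows "(\<Sum>a\<in>{..d} \<rightarrow>\<^sub>E grid H. nroots d I a) = (\<Sum>p\<in>int_box d H. zroots I p)"
proof (subst sum.reindex_bij_betw[OF grid_coeffs_bij[OF H], symmetric], rule sum.cong[OF refl])
  fix p assume p: "p \<in> int_box d H"
  have "poly_of d (grid_coeffs d H p) = smult (1 / H) (map_poly real_of_int p)"
    using p by (intro poly_eqI) (auto simp: coeff_poly_of grid_coeffs_def coeff_map_poly int_box_def coeff_eq_0)
  then show "nroots d I (grid_coeffs d H p) = zroots I p"
    using H by (simp add: nroots_def zroots_def)
qed

section \<open>From all integer polynomials to primitive ones\<close>

definition zcount :: "nat \<Rightarrow> real set \<Rightarrow> real \<Rightarrow> real" where
  "zcount d I H = (\<Sum>p\<in>int_box d H - {0}. zroots I p)"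

definition prim_count :: "nat \<Rightarrow> real set \<Rightarrow> real \<Rightarrow> real" where
  "prim_count d I H = (\<Sum>p\<in>{p \<in> int_box d H. content p = 1}. zroots I p)"

text \<open>The constant of \<open>nroots_grid_sum\<close>, plus 1 for leaving out the zero
  polynomial, whose conventional number of roots is at most 1.\<close>

definition lattice_const :: "nat \<Rightarrow> real" where
  "lattice_const d = (real d + 1) * (2 * real d + 3) * 3 ^ d + 1"

lemma zcount_asymp:
  assumes I: "is_interval I" and H: "1 \<le> H"
  shows "\<bar>zcount d I H - root_mean d I * H ^ (d + 1)\<bar> \<le> lattice_const d * H ^ d"
proof -
  let ?S = "\<Sum>p\<in>int_box d H. zroots I p" and ?C = "(real d + 1) * (2 * real d + 3) * 3 ^ d"
  have 0: "0 \<in> int_box d H" using H by (simp add: int_box_def)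
  have "?S = zroots I 0 + zcount d I H"
    unfolding zcount_def using 0 finite_int_box by (simp add: sum.remove)
  moreover have "0 \<le> zroots I 0" "zroots I 0 \<le> 1"
    using card_interval_le_1[OF I] by (auto simp: zroots_def)
  ultimately have 1: "\<bar>zcount d I H - ?S\<bar> \<le> 1 * H ^ d" using one_le_power[OF H, of d] by linarith
  have "\<bar>(1 / H) ^ (d + 1) * ?S - root_mean d I\<bar> \<le> ?C / H"
    using nroots_grid_sum[OF I H, of d] sum_grid_eq_sum_int_box[of H d I] H by simp
  then have "\<bar>(1 / H) ^ (d + 1) * ?S - root_mean d I\<bar> * H ^ (d + 1) \<le> ?C / H * H ^ (d + 1)"
    using H by (intro mult_right_mono) auto
  also have "\<bar>(1 / H) ^ (d + 1) * ?S - root_mean d I\<bar> * H ^ (d + 1) = \<bar>((1 / H) ^ (d + 1) * ?S - root_mean d I) * H ^ (d + 1)\<bar>"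
    using H by (simp add: abs_mult)
  also have "((1 / H) ^ (d + 1) * ?S - root_mean d I) * H ^ (d + 1) = ?S - root_mean d I * H ^ (d + 1)"
    using H by (simp add: power_one_over field_simps)
  also have "?C / H * H ^ (d + 1) = ?C * H ^ d" using H by simp
  finally have "\<bar>zcount d I H - root_mean d I * H ^ (d + 1)\<bar> \<le> ?C * H ^ d + 1 * H ^ d" using 1 by linarith
  then show ?thesis by (simp only: lattice_const_def distrib_right)
qed

lemma content_le:
  assumes "p \<in> int_box d H" "p \<noteq> 0"
  shows "0 < content p" "real_of_int (content p) \<le> H"
proof -
  have "content p \<noteq> 0" using assms(2) by simp
  moreover have "\<bar>content p\<bar> = content p" using normalize_content[of p] by simp
  ultimately show pos: "0 < content p" by linarith
  have "content p dvd lead_coeff p" by (rule content_dvd_coeff)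
  then have "content p \<le> \<bar>lead_coeff p\<bar>" using assms(2) by (intro zdvd_imp_le) auto
  then show "real_of_int (content p) \<le> H"
    using assms(1) order_trans[of "real_of_int (content p)" "real_of_int \<bar>lead_coeff p\<bar>" H]
    by (simp add: int_box_def)
qed

text \<open>Polynomials are grouped by their content \<open>e\<close>. Dividing by \<open>e\<close>
  preserves the roots and gives the primitive polynomials of height at most \<open>H / e\<close>;
  the zero polynomial, of content 0, fits into no group.\<close>

lemma zcount_eq_sum_prim_count:
  "zcount d I H = (\<Sum>e=1..nat \<lfloor>H\<rfloor>. prim_count d I (H / e))"
proof -
  have g: "(\<lambda>p. nat (content p)) ` (int_box d H - {0}) \<subseteq> {1..nat \<lfloor>H\<rfloor>}"
  proof
    fix e assume "e \<in> (\<lambda>p. nat (content p)) ` (int_box d H - {0})"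
    then obtain p where p: "p \<in> int_box d H" "p \<noteq> 0" "e = nat (content p)" by auto
    show "e \<in> {1..nat \<lfloor>H\<rfloor>}" using content_le[OF p(1,2)] p(3) by (auto simp: le_floor_iff nat_le_iff)
  qed
  have "zcount d I H = (\<Sum>e\<in>{1..nat \<lfloor>H\<rfloor>}. \<Sum>p\<in>{p \<in> int_box d H - {0}. nat (content p) = e}. zroots I p)"
    unfolding zcount_def using finite_int_box g by (intro sum.group[symmetric]) auto
  also have "\<dots> = (\<Sum>e=1..nat \<lfloor>H\<rfloor>. prim_count d I (H / e))"
  proof (rule sum.cong[OF refl])
    fix e assume "e \<in> {1..nat \<lfloor>H\<rfloor>}"
    then have e: "0 < e" by simp
    have box: "smult (int e) q \<in> int_box d H \<longleftrightarrow> q \<in> int_box d (H / e)" for q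
      using e by (simp add: int_box_def abs_mult field_simps)
    have "bij_betw (smult (int e)) {p \<in> int_box d (H / e). content p = 1} {p \<in> int_box d H - {0}. nat (content p) = e}"
    proof (rule bij_betwI[where g = primitive_part])
      show "smult (int e) \<in> {p \<in> int_box d (H / e). content p = 1} \<rightarrow> {p \<in> int_box d H - {0}. nat (content p) = e}"
        using e box by auto
      show "primitive_part \<in> {p \<in> int_box d H - {0}. nat (content p) = e} \<rightarrow> {p \<in> int_box d (H / e). content p = 1}"
      proof
        fix p assume p: "p \<in> {p \<in> int_box d H - {0}. nat (content p) = e}"
        then have "content p = int e" using content_le(1)[of p d H] by auto
        then have "smult (int e) (primitive_part p) = p" by (metis content_times_primitive_part)
        then show "primitive_part p \<in> {p \<in> int_box d (H / e). content p = 1}"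
          using p box[of "primitive_part p"] by (simp add: content_primitive_part)
      qed
      show "primitive_part (smult (int e) p) = p" if "p \<in> {p \<in> int_box d (H / e). content p = 1}" for p
        using that e by (simp add: primitive_part_smult primitive_part_prim unit_factor_int_def sgn_if)
      show "smult (int e) (primitive_part p) = p" if "p \<in> {p \<in> int_box d H - {0}. nat (content p) = e}" for p
      proof -
        have "content p = int e" using that content_le(1)[of p d H] by auto
        then show ?thesis by (metis content_times_primitive_part)
      qed
    qed
    from sum.reindex_bij_betw[OF this, of "zroots I"]
    show "(\<Sum>p\<in>{p \<in> int_box d H - {0}. nat (content p) = e}. zroots I p) = prim_count d I (H / e)"
      using e unfolding prim_count_def by (simp add: zroots_smult)
  qed
  finally show ?thesis .
qed

lemma prim_count_small: "H < 1 \<Longrightarrow> prim_count d I H = 0"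
proof -
  assume H: "H < 1"
  have e: "{p \<in> int_box d H. content p = 1} = {}"
  proof safe
    fix p assume p: "p \<in> int_box d H" "content p = 1"
    then have "p \<noteq> 0" by auto
    with content_le(2)[OF p(1)] p(2) H show "p \<in> {}" by simp
  qed
  show ?thesis unfolding prim_count_def e by simp
qed

text \<open>Telescoping that starts from the exact first value 1/4 = 3/4 - 1/2. Telescoping from the
  first term on would give the bound 1, and the sieve needs a bound below 1.\<close>

lemma sum_inverse_squares_le: "(\<Sum>k<Suc n. 1 / real (k + 2) ^ 2) \<le> 3 / 4 - 1 / real (n + 2)"
proof (induction n)
  case (Suc n)
  have "1 / real (Suc n + 2) ^ 2 \<le> 1 / real (n + 2) - 1 / real (Suc n + 2)"
  proof -
    have "1 / real (n + 2) - 1 / real (Suc n + 2) = 1 / (real (n + 2) * real (Suc n + 2))"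
      by (simp add: field_simps)
    also have "\<dots> \<ge> 1 / real (Suc n + 2) ^ 2"
      unfolding power2_eq_square by (intro divide_left_mono mult_right_mono) auto
    finally show ?thesis .
  qed
  then show ?case using Suc by simp
qed (simp add: power2_eq_square)

lemma inverse_squares_tail:
  "summable (\<lambda>k. 1 / real (k + 2) ^ 2)" "suminf (\<lambda>k. 1 / real (k + 2) ^ 2) \<le> 3 / 4"
proof -
  have "summable (\<lambda>n. inverse (real n ^ 2))" by (rule inverse_power_summable) simp
  from summable_ignore_initial_segment[OF this, of 2] show s: "summable (\<lambda>k. 1 / real (k + 2) ^ 2)"
    unfolding inverse_eq_divide .
  show "suminf (\<lambda>k. 1 / real (k + 2) ^ 2) \<le> 3 / 4"
  proof (rule suminf_le_const[OF s])
    fix n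
    show "(\<Sum>k<n. 1 / real (k + 2) ^ 2) \<le> 3 / 4"
    proof (cases n)
      case (Suc m)
      have "0 \<le> 1 / real (m + 2)" by simp
      then show ?thesis using sum_inverse_squares_le[of m] unfolding Suc by linarith
    qed simp
  qed
qed

lemma zeta_sums:
  assumes "2 \<le> s"
  shows "(\<lambda>k. 1 / real (Suc k) ^ s) sums zeta s" "1 \<le> zeta s"
proof -
  have "summable (\<lambda>n. inverse (real n ^ s))" by (rule inverse_power_summable[OF assms])
  from summable_ignore_initial_segment[OF this, of 1] have s: "summable (\<lambda>k. 1 / real (Suc k) ^ s)"
    unfolding inverse_eq_divide Suc_eq_plus1 .
  then show "(\<lambda>k. 1 / real (Suc k) ^ s) sums zeta s" unfolding zeta_def by (rule summable_sums)
  have "(\<Sum>k\<in>{0::nat}. 1 / real (Suc k) ^ s) \<le> zeta s"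
    unfolding zeta_def by (rule sum_le_suminf[OF s]) auto
  then show "1 \<le> zeta s" by simp
qed

text \<open>
  Inverts \<open>T H = \<Sum>\<^sub>e P (H / e)\<close> without the Moebius function: the errors \<open>W\<close> of \<open>P\<close> sum
  up to the error of \<open>T\<close>, and \<open>\<Sum>\<^sub>e\<^sub>\<ge>\<^sub>2 e\<^sup>-\<^sup>d \<le> 3/4\<close> lets the terms with \<open>e \<ge> 2\<close> be absorbed.
\<close>

lemma sieve:
  fixes T P :: "real \<Rightarrow> real"
  assumes d: "2 \<le> d" and V: "0 \<le> V" "V \<le> C"
    and T: "\<And>H. 1 \<le> H \<Longrightarrow> T H = (\<Sum>e=1..nat \<lfloor>H\<rfloor>. P (H / e))"
    and small: "\<And>H. H < 1 \<Longrightarrow> P H = 0"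
    and err: "\<And>H. 1 \<le> H \<Longrightarrow> \<bar>T H - V * H ^ (d + 1)\<bar> \<le> C * H ^ d"
    and H: "0 < H"
  shows "\<bar>P H - V / zeta (d + 1) * H ^ (d + 1)\<bar> \<le> 4 * C * H ^ d"
  using H
proof (induction "nat \<lfloor>H\<rfloor>" arbitrary: H rule: less_induct)
  case less
  note H = less.prems
  define W where "W = (\<lambda>H. P H - V / zeta (d + 1) * H ^ (d + 1))"
  have z: "1 \<le> zeta (d + 1)" using d by (intro zeta_sums) auto
  have C: "0 \<le> C" using V by simp
  have "\<bar>W H\<bar> \<le> 4 * C * H ^ d"
  proof (cases "H < 1")
    \<comment> \<open>Such arguments do occur: to produce \<open>zeta\<close> the series runs over
      all \<open>e\<close>, also those with \<open>H / e < 1\<close>, where \<open>P\<close>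
      vanishes but the main term does not.\<close>
    case True
    have "\<bar>W H\<bar> = V / zeta (d + 1) * (H * H ^ d)" using small[OF True] V H z by (simp add: W_def abs_mult)
    also have "\<dots> \<le> C * (1 * H ^ d)"
    proof (intro mult_mono)
      have "V * 1 \<le> C * zeta (d + 1)" using V z by (intro mult_mono) auto
      then show "V / zeta (d + 1) \<le> C" using z by (simp add: divide_le_eq)
    qed (use True H C in auto)
    also have "\<dots> \<le> 4 * C * H ^ d" using C H by simp
    finally show ?thesis .
  next
    case False
    then have H1: "1 \<le> H" by simp
    define w where "w = (\<lambda>k. W (H / real (Suc k)))"
    have "(\<lambda>k. P (H / real (Suc k))) sums (\<Sum>k<nat \<lfloor>H\<rfloor>. P (H / real (Suc k)))"
    proof (rule sums_finite)
      fix k assume "k \<notin> {..<nat \<lfloor>H\<rfloor>}"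
      then have "H < real (Suc k)" using H1 by (auto simp: not_less) linarith
      then show "P (H / real (Suc k)) = 0" using H by (intro small) (simp add: field_simps)
    qed auto
    also have "(\<Sum>k<nat \<lfloor>H\<rfloor>. P (H / real (Suc k))) = T H"
      unfolding T[OF H1] by (rule sum.reindex_bij_witness[of _ "\<lambda>e. e - 1" Suc]) auto
    finally have "(\<lambda>k. P (H / real (Suc k))) sums T H" .
    moreover have "(\<lambda>k. V / zeta (d + 1) * H ^ (d + 1) * (1 / real (Suc k) ^ (d + 1))) sums (V / zeta (d + 1) * H ^ (d + 1) * zeta (d + 1))"
      using d by (intro sums_mult zeta_sums) auto
    ultimately have "(\<lambda>k. P (H / real (Suc k)) - V / zeta (d + 1) * H ^ (d + 1) * (1 / real (Suc k) ^ (d + 1))) sums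
        (T H - V / zeta (d + 1) * H ^ (d + 1) * zeta (d + 1))" by (rule sums_diff)
    moreover have "(\<lambda>k. P (H / real (Suc k)) - V / zeta (d + 1) * H ^ (d + 1) * (1 / real (Suc k) ^ (d + 1))) = w"
      unfolding w_def W_def power_divide by simp
    moreover have "V / zeta (d + 1) * H ^ (d + 1) * zeta (d + 1) = V * H ^ (d + 1)" using z by simp
    ultimately have "w sums (T H - V * H ^ (d + 1))" by (simp only:)
    then have "(\<lambda>k. w (Suc k)) sums (T H - V * H ^ (d + 1) - w 0)" by (simp add: sums_Suc_iff)
    then have w: "w 0 = (T H - V * H ^ (d + 1)) - suminf (\<lambda>k. w (Suc k))" "summable (\<lambda>k. w (Suc k))"
      by (auto simp: sums_iff)
    \<comment> \<open>Dividing \<open>H \<ge> 1\<close> by \<open>k + 2 \<ge> 2\<close> lowers the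
      integer part, so the induction hypothesis covers every term but the one with
      \<open>e = 1\<close>.\<close>
    have wb: "norm (w (Suc k)) \<le> 4 * C * H ^ d * (1 / real (k + 2) ^ 2)" for k
    proof -
      have "H / real (Suc (Suc k)) \<le> H / 2" using H by (intro divide_left_mono) auto
      then have "nat \<lfloor>H / real (Suc (Suc k))\<rfloor> \<le> nat \<lfloor>H / 2\<rfloor>" by (intro nat_mono floor_mono)
      also have "\<dots> < nat \<lfloor>H\<rfloor>"
      proof -
        have F: "1 \<le> \<lfloor>H\<rfloor>" using H1 by simp
        have a: "real_of_int \<lfloor>H / 2\<rfloor> \<le> H / 2" by (rule of_int_floor_le)
        have b: "H < real_of_int \<lfloor>H\<rfloor> + 1" by (rule real_of_int_floor_add_one_gt)
        have c: "real_of_int 1 \<le> real_of_int \<lfloor>H\<rfloor>" by (simp only: of_int_le_iff F)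
        have "real_of_int \<lfloor>H / 2\<rfloor> < real_of_int \<lfloor>H\<rfloor>" using a b c[unfolded of_int_1] by linarith
        then have "\<lfloor>H / 2\<rfloor> < \<lfloor>H\<rfloor>" by (simp only: of_int_less_iff)
        then show ?thesis using H1 by simp
      qed
      finally have "\<bar>W (H / real (Suc (Suc k)))\<bar> \<le> 4 * C * (H / real (Suc (Suc k))) ^ d"
        unfolding W_def using H by (intro less.hyps) auto
      also have "\<dots> = 4 * C * H ^ d * (1 / real (k + 2) ^ d)" by (simp add: power_divide)
      also have "\<dots> \<le> 4 * C * H ^ d * (1 / real (k + 2) ^ 2)"
        using d C H by (intro mult_left_mono divide_left_mono power_increasing mult_pos_pos) auto
      finally show ?thesis by (simp add: w_def)
    qed
    have "norm (suminf (\<lambda>k. w (Suc k))) \<le> suminf (\<lambda>k. 4 * C * H ^ d * (1 / real (k + 2) ^ 2))"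
      using wb by (intro norm_suminf_le summable_mult inverse_squares_tail) auto
    also have "\<dots> = 4 * C * H ^ d * suminf (\<lambda>k. 1 / real (k + 2) ^ 2)"
      by (rule suminf_mult[OF inverse_squares_tail(1)])
    also have "\<dots> \<le> 4 * C * H ^ d * (3 / 4)"
      using C H by (intro mult_left_mono inverse_squares_tail) auto
    finally have "\<bar>suminf (\<lambda>k. w (Suc k))\<bar> \<le> 3 * C * H ^ d" by simp
    \<comment> \<open>The factor 4 reproduces itself: the error \<open>C\<close> of \<open>T\<close>
      plus three quarters of \<open>4 * C\<close>.\<close>
    then have "\<bar>w 0\<bar> \<le> 4 * C * H ^ d" using w(1) err[OF H1] by linarith
    then show ?thesis by (simp add: w_def)
  qed
  then show ?case by (simp add: W_def)
qed

lemma root_mean_bounds: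
  assumes I: "is_interval I"
  shows "0 \<le> root_mean d I" "root_mean d I \<le> (d + 1) * 2 ^ (d + 1)"
proof -
  let ?M = "Pi\<^sub>M {..d} (\<lambda>_. unit_box)"
  interpret finite_measure ?M by (rule PiM_mass[OF mass_le_unit_box[OF order_refl]]) simp
  show "0 \<le> root_mean d I" unfolding root_mean_def using nroots_bounds[OF I] by (intro integral_nonneg_AE) auto
  have "root_mean d I \<le> (\<integral>a. real (d + 1) \<partial>?M)"
    unfolding root_mean_def using nroots_bounds[OF I] by (intro integral_mono') auto
  also have "\<dots> = real (d + 1) * measure ?M (space ?M)" by simp
  also have "\<dots> \<le> real (d + 1) * (\<Prod>i\<in>{..d}. 2 :: real)"
    by (intro mult_left_mono PiM_mass[OF mass_le_unit_box[OF order_refl]]) auto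
  finally show "root_mean d I \<le> (d + 1) * 2 ^ (d + 1)" by (simp add: algebra_simps)
qed

lemma prim_count_asymp:
  assumes I: "is_interval I" and d: "2 \<le> d" and H: "0 < H"
  shows "\<bar>prim_count d I H - root_mean d I / zeta (d + 1) * H ^ (d + 1)\<bar>
    \<le> 4 * lattice_const d * H ^ d"
proof -
  have "root_mean d I \<le> (real d + 1) * (2 * 2 ^ d)" using root_mean_bounds(2)[OF I, of d] by (simp add: algebra_simps)
  also have "\<dots> \<le> (real d + 1) * ((2 * real d + 3) * 3 ^ d)"
    by (intro mult_left_mono mult_mono power_mono) auto
  finally have V: "root_mean d I \<le> lattice_const d" by (simp add: lattice_const_def mult.assoc)
  show ?thesis
    by (rule sieve[where T = "zcount d I", OF d root_mean_bounds(1)[OF I] V zcount_eq_sum_prim_count prim_count_small zcount_asymp[OF I] H])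
qed

section \<open>Reducible polynomials\<close>

lemma coeff_prod_linear_bound:
  fixes c :: "nat \<Rightarrow> real"
  assumes "finite Y" "\<And>j. j \<in> Y \<Longrightarrow> \<bar>c j\<bar> \<le> B" "0 \<le> B"
  shows "\<bar>coeff (\<Prod>j\<in>Y. [:- c j, 1:]) k\<bar> \<le> (B + 1) ^ card Y"
  using assms(1,2)
proof (induction Y arbitrary: k rule: finite_induct)
  case empty
  then show ?case by (cases k) (simp_all add: one_pCons coeff_pCons)
next
  case (insert j Y)
  let ?f = "\<Prod>j\<in>Y. [:- c j, 1:]"
  have IH: "\<bar>coeff ?f k\<bar> \<le> (B + 1) ^ card Y" for k using insert by auto
  have "coeff (\<Prod>j\<in>insert j Y. [:- c j, 1:]) k = - c j * coeff ?f k + (if k = 0 then 0 else coeff ?f (k - 1))"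
    using insert.hyps by (auto simp: coeff_pCons split: nat.split)
  also have "\<bar>\<dots>\<bar> \<le> \<bar>- c j * coeff ?f k\<bar> + \<bar>if k = 0 then 0 else coeff ?f (k - 1)\<bar>"
    by (rule abs_triangle_ineq)
  also have "\<dots> = \<bar>c j\<bar> * \<bar>coeff ?f k\<bar> + (if k = 0 then 0 else \<bar>coeff ?f (k - 1)\<bar>)"
    by (simp add: abs_mult)
  also have "\<dots> \<le> B * (B + 1) ^ card Y + (B + 1) ^ card Y"
    using IH insert.prems assms(3) by (intro add_mono mult_mono) auto
  also have "\<dots> = (B + 1) ^ card (insert j Y)" using insert.hyps by (simp add: algebra_simps)
  finally show ?case .
qed

text \<open>Lagrange interpolation. Distinct integer nodes have differences of absolute value at
  least 1, so the denominators do no harm, and the basis polynomials have coefficients bounded by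
  \<open>(d + 1) ^ a\<close>.\<close>

lemma coeff_bound_interpolation:
  fixes q :: "real poly"
  assumes q: "degree q \<le> a" and X: "X \<subseteq> {0..d}" "card X = a + 1" and ad: "a \<le> d"
    and m: "\<And>j. j \<in> X \<Longrightarrow> \<bar>poly q (real j)\<bar> \<le> m"
  shows "\<bar>coeff q k\<bar> \<le> (real d + 1) ^ (d + 1) * m"
proof -
  have fX: "finite X" using X by (meson finite_atLeastAtMost finite_subset)
  have m0: "0 \<le> m"
  proof -
    obtain j where "j \<in> X" using X(2) by (cases "X = {}") auto
    then show ?thesis using m[of j] by linarith
  qed
  define L where "L = (\<lambda>i. \<Prod>j\<in>X - {i}. [:- real j, 1:])"
  define D where "D = (\<lambda>i. \<Prod>j\<in>X - {i}. real i - real j)"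
  define f where "f = (\<Sum>i\<in>X. smult (poly q (real i) / D i) (L i))"
  have D1: "1 \<le> \<bar>D i\<bar>" for i
  proof -
    have "1 \<le> \<bar>real i - real j\<bar>" if "j \<in> X - {i}" for j using that by auto
    then have "(\<Prod>j\<in>X - {i}. 1) \<le> (\<Prod>j\<in>X - {i}. \<bar>real i - real j\<bar>)" by (intro prod_mono) auto
    then show ?thesis by (simp add: D_def abs_prod)
  qed
  have Lp: "poly (L i) (real j) = (if i = j then D i else 0)" if "i \<in> X" "j \<in> X" for i j
    using that fX by (auto simp: L_def D_def poly_prod prod_zero_iff)
  have degL: "degree (L i) \<le> a" if "i \<in> X" for i
  proof -
    have "degree (L i) \<le> (\<Sum>j\<in>X - {i}. degree [:- real j, 1:])"
      unfolding L_def using degree_prod_sum_le[of "X - {i}" "\<lambda>j. [:- real j, 1:]"] fX by (simp add: comp_def)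
    also have "\<dots> = card (X - {i})" by simp
    also have "\<dots> = a" using that X(2) fX by simp
    finally show ?thesis .
  qed
  have "f = q"
  proof (rule ccontr)
    assume "f \<noteq> q"
    then have n: "f - q \<noteq> 0" by simp
    have "degree (f - q) \<le> a"
      unfolding f_def by (intro degree_diff_le degree_sum_le q fX) (auto intro: order_trans[OF degree_smult_le] degL)
    moreover have "real ` X \<subseteq> {x. poly (f - q) x = 0}"
    proof
      fix x assume "x \<in> real ` X"
      then obtain j where j: "j \<in> X" "x = real j" by auto
      have "poly f (real j) = (\<Sum>i\<in>X. if i = j then poly q (real i) / D i * D i else 0)"
        unfolding f_def using j by (auto simp: poly_sum Lp intro!: sum.cong)
      also have "\<dots> = poly q (real j)" using j fX D1[of j] by auto
      finally show "x \<in> {x. poly (f - q) x = 0}" using j by simp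
    qed
    then have "card (real ` X) \<le> card {x. poly (f - q) x = 0}"
      using poly_roots_finite[OF n] by (intro card_mono) auto
    moreover have "card (real ` X) = a + 1" using X(2) by (subst card_image) (auto simp: inj_on_def)
    ultimately show False using card_poly_roots_bound[OF n] by linarith
  qed
  then have "\<bar>coeff q k\<bar> = \<bar>\<Sum>i\<in>X. poly q (real i) / D i * coeff (L i) k\<bar>"
    unfolding f_def by (metis (no_types, lifting) coeff_smult coeff_sum sum.cong)
  also have "\<dots> \<le> (\<Sum>i\<in>X. \<bar>poly q (real i) / D i * coeff (L i) k\<bar>)" by (rule sum_abs)
  also have "\<dots> \<le> (\<Sum>i\<in>X. m * (real d + 1) ^ a)"
  proof (rule sum_mono)
    fix i assume i: "i \<in> X"
    have "\<bar>poly q (real i) / D i\<bar> \<le> m / 1"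
      unfolding abs_divide using m[OF i] D1[of i] m0 by (intro frac_le) auto
    moreover have "\<bar>coeff (L i) k\<bar> \<le> (real d + 1) ^ card (X - {i})"
      unfolding L_def using fX X(1) by (intro coeff_prod_linear_bound) auto
    ultimately show "\<bar>poly q (real i) / D i * coeff (L i) k\<bar> \<le> m * (real d + 1) ^ a"
      unfolding abs_mult using m0 i X(2) fX by (intro mult_mono) auto
  qed
  also have "\<dots> = (real a + 1) * (real d + 1) ^ a * m" using X(2) by simp
  also have "\<dots> \<le> (real d + 1) * (real d + 1) ^ d * m"
    using ad m0 by (intro mult_right_mono mult_mono power_increasing) auto
  finally show ?thesis by simp
qed

lemma coeff_le_naive_height: "\<bar>coeff p k\<bar> \<le> naive_height p"
proof (cases "k \<le> degree p")
  case True
  then show ?thesis unfolding naive_height_def by (intro Max_ge) auto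
next
  case False
  then have "\<bar>coeff p k\<bar> \<le> \<bar>coeff p 0\<bar>" by (simp add: coeff_eq_0)
  also have "\<dots> \<le> naive_height p" unfolding naive_height_def by (intro Max_ge) auto
  finally show ?thesis .
qed

lemma naive_height_attained: "\<exists>k\<le>degree p. naive_height p = \<bar>coeff p k\<bar>"
proof -
  have "naive_height p \<in> (\<lambda>k. \<bar>coeff p k\<bar>) ` {..degree p}"
    unfolding naive_height_def by (intro Max_in) auto
  then show ?thesis by auto
qed

lemma naive_height_pos:
  assumes "p \<noteq> 0"
  shows "1 \<le> naive_height p"
proof -
  have "1 \<le> \<bar>lead_coeff p\<bar>" using assms by (simp add: int_one_le_iff_zero_less)
  also have "\<dots> \<le> naive_height p" by (rule coeff_le_naive_height)
  finally show ?thesis .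
qed

lemma int_box_iff: "p \<in> int_box d X \<longleftrightarrow> degree p \<le> d \<and> real_of_int (naive_height p) \<le> X"
proof -
  have "real_of_int \<bar>coeff p k\<bar> \<le> X" if "real_of_int (naive_height p) \<le> X" for k
    using coeff_le_naive_height[of p k] that by (meson of_int_le_iff order_trans)
  moreover have "real_of_int (naive_height p) \<le> X" if "\<forall>k. real_of_int \<bar>coeff p k\<bar> \<le> X"
    using naive_height_attained[of p] that by metis
  ultimately show ?thesis unfolding int_box_def by auto
qed

text \<open>If there were one more such point, interpolation at \<open>degree q + 1\<close> of them
  would make every coefficient smaller than the height, which is the absolute value of one of
  them.\<close>

lemma few_small_values:
  fixes q :: "int poly"
  assumes "q \<noteq> 0" "degree q \<le> d"
  shows "card {j \<in> {0..d}. (real d + 1) ^ (d + 1) * \<bar>poly (map_poly real_of_int q) (real j)\<bar> < naive_height q} \<le> degree q"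
    (is "card ?S \<le> _")
proof (rule ccontr)
  assume "\<not> card ?S \<le> degree q"
  then have "degree q + 1 \<le> card ?S" by simp
  then obtain X where X: "X \<subseteq> ?S" "card X = degree q + 1" by (rule obtain_subset_with_card_n)
  let ?v = "\<lambda>j. \<bar>poly (map_poly real_of_int q) (real j)\<bar>"
  have fX: "finite X" "X \<noteq> {}" using X(2) by (auto intro: card_ge_0_finite)
  obtain k where k: "naive_height q = \<bar>coeff q k\<bar>" using naive_height_attained by blast
  have "Max (?v ` X) \<in> ?v ` X" using fX by (intro Max_in) auto
  then obtain j where j: "j \<in> X" "Max (?v ` X) = ?v j" by auto
  have "\<bar>coeff (map_poly real_of_int q) k\<bar> \<le> (real d + 1) ^ (d + 1) * Max (?v ` X)"
  proof (rule coeff_bound_interpolation[OF _ _ X(2) assms(2)])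
    show "degree (map_poly real_of_int q) \<le> degree q" by (simp add: degree_map_poly)
    show "X \<subseteq> {0..d}" using X(1) by auto
    show "?v j \<le> Max (?v ` X)" if "j \<in> X" for j using that fX by (intro Max_ge) auto
  qed
  also have "\<dots> < naive_height q" using j X(1) by auto
  finally show False using k by (simp add: coeff_map_poly)
qed

lemma map_poly_of_int_mult:
  "map_poly real_of_int (q * r) = map_poly real_of_int q * map_poly real_of_int r"
  by (rule poly_eqI) (simp add: coeff_map_poly coeff_mult)

text \<open>
  Each factor is small at no more of the points \<open>0, \<dots>, d\<close> than its degree, so at one of these
  \<open>d + 1\<close> points neither factor is small.
\<close>

lemma naive_height_mult:
  fixes q r :: "int poly"
  assumes "q * r \<noteq> 0"
  defines "d \<equiv> degree (q * r)"
  shows "real_of_int (naive_height q) * real_of_int (naive_height r) \<le> (real d + 1) ^ (3 * d + 3) * real_of_int (naive_height (q * r))"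
proof -
  have n: "q \<noteq> 0" "r \<noteq> 0" and deg: "degree q + degree r = d"
    using assms by (auto simp: degree_mult_eq)
  let ?B = "(real d + 1) ^ (d + 1)"
  define v where "v = (\<lambda>p j. \<bar>poly (map_poly real_of_int p) (real j)\<bar>)"
  define S where "S = (\<lambda>p. {j \<in> {0..d}. ?B * v p j < naive_height p})"
  have "card (S q \<union> S r) \<le> card (S q) + card (S r)" by (rule card_Un_le)
  also have "\<dots> \<le> degree q + degree r"
    unfolding S_def v_def using n deg by (intro add_mono few_small_values) auto
  finally have "card (S q \<union> S r) < card {0..d}" using deg by simp
  moreover have "finite (S q \<union> S r)" by (simp add: S_def)
  ultimately have "\<not> {0..d} \<subseteq> S q \<union> S r" using card_mono by (metis not_less)
  then obtain j where "j \<in> {0..d}" "j \<notin> S q \<union> S r" by (meson subsetI)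
  then have j: "j \<le> d" "j \<notin> S q" "j \<notin> S r" by auto
  have h: "real_of_int (naive_height q) \<le> ?B * v q j" "real_of_int (naive_height r) \<le> ?B * v r j"
    using j by (auto simp: S_def)
  have "real_of_int (naive_height q) * real_of_int (naive_height r) \<le> (?B * v q j) * (?B * v r j)"
    using h naive_height_pos[OF n(1)] naive_height_pos[OF n(2)] by (intro mult_mono) (auto simp: v_def)
  also have "\<dots> = ?B ^ 2 * v (q * r) j"
    by (simp add: v_def map_poly_of_int_mult abs_mult power2_eq_square)
  \<comment> \<open>The third power of \<open>(d + 1) ^ (d + 1)\<close>: two stem from interpolating
    \<open>q\<close> and \<open>r\<close>, this one from evaluating \<open>d + 1\<close> terms at a
    point \<open>j \<le> d\<close>.\<close>
  also have "v (q * r) j \<le> (real d + 1) ^ (d + 1) * real_of_int (naive_height (q * r))"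
  proof -
    have "v (q * r) j = \<bar>\<Sum>k\<le>d. real_of_int (coeff (q * r) k) * real j ^ k\<bar>"
      by (simp add: v_def poly_map_of_int d_def)
    also have "\<dots> \<le> (\<Sum>k\<le>d. real_of_int (naive_height (q * r)) * (real d + 1) ^ d)"
    proof (rule order_trans[OF sum_abs sum_mono])
      fix k assume k: "k \<in> {..d}"
      have "real j ^ k \<le> (real d + 1) ^ k" using j(1) by (intro power_mono) auto
      also have "\<dots> \<le> (real d + 1) ^ d" using k by (intro power_increasing) auto
      finally have "real j ^ k \<le> (real d + 1) ^ d" .
      moreover have "real_of_int \<bar>coeff (q * r) k\<bar> \<le> real_of_int (naive_height (q * r))"
        by (simp only: of_int_le_iff coeff_le_naive_height)
      ultimately show "\<bar>real_of_int (coeff (q * r) k) * real j ^ k\<bar> \<le> real_of_int (naive_height (q * r)) * (real d + 1) ^ d"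
        unfolding abs_mult using naive_height_pos[OF assms(1)] by (intro mult_mono) auto
    qed
    finally show ?thesis by (simp add: algebra_simps)
  qed
  finally have "real_of_int (naive_height q) * real_of_int (naive_height r) \<le> ?B ^ 2 * ((real d + 1) ^ (d + 1) * real_of_int (naive_height (q * r)))"
    by (simp add: mult_left_mono)
  also have "\<dots> = (real d + 1) ^ (3 * d + 3) * real_of_int (naive_height (q * r))"
  proof -
    have e: "3 * d + 3 = (d + 1) * 2 + (d + 1)" by simp
    show ?thesis unfolding e power_add[of _ "(d + 1) * 2"] power_mult by (simp only: mult.assoc)
  qed
  finally show ?thesis .
qed

text \<open>Some coefficient equals plus or minus \<open>h\<close>, which leaves
  \<open>a + 1\<close> positions, two signs and \<open>a\<close> free coefficients. Prescribing the
  height exactly saves one power of \<open>h\<close> against bounding it.\<close>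

lemma card_height_eq:
  "card {q :: int poly. degree q \<le> a \<and> naive_height q = int h} \<le> 2 * (a + 1) * (2 * h + 1) ^ a"
proof -
  define B where "B = (\<lambda>k (s::int). {q :: int poly. degree q \<le> a \<and> naive_height q = int h \<and> coeff q k = s})"
  have cB: "card (B k s) \<le> (2 * h + 1) ^ a" if k: "k \<le> a" for k s
  proof -
    have "inj_on (\<lambda>q. restrict (coeff q) ({..a} - {k})) (B k s)"
    proof (rule inj_onI, rule poly_eqI)
      fix q r n assume q: "q \<in> B k s" and r: "r \<in> B k s"
        and eq: "restrict (coeff q) ({..a} - {k}) = restrict (coeff r) ({..a} - {k})"
      consider "n = k" | "n > a" | "n \<in> {..a} - {k}" by fastforce
      then show "coeff q n = coeff r n"
      proof cases
        case 3
        then show ?thesis using fun_cong[OF eq, of n] by simp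
      qed (use q r in \<open>auto simp: B_def coeff_eq_0\<close>)
    qed
    moreover have "(\<lambda>q. restrict (coeff q) ({..a} - {k})) ` B k s \<subseteq> ({..a} - {k}) \<rightarrow>\<^sub>E {- int h..int h}"
    proof
      fix f assume "f \<in> (\<lambda>q. restrict (coeff q) ({..a} - {k})) ` B k s"
      then obtain q where q: "naive_height q = int h" "f = restrict (coeff q) ({..a} - {k})" by (auto simp: B_def)
      have "coeff q n \<in> {- int h..int h}" for n using coeff_le_naive_height[of q n] q(1) by auto
      then show "f \<in> ({..a} - {k}) \<rightarrow>\<^sub>E {- int h..int h}" unfolding q(2) restrict_PiE_iff by blast
    qed
    ultimately have "card (B k s) \<le> card (({..a} - {k}) \<rightarrow>\<^sub>E {- int h..int h})"
      by (intro card_inj_on_le finite_PiE) auto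
    also have "\<dots> = (2 * h + 1) ^ a"
    proof -
      have "nat (int h - - int h + 1) = 2 * h + 1" by linarith
      then show ?thesis using k by (simp add: card_PiE)
    qed
    finally show ?thesis .
  qed
  have sub: "{q :: int poly. degree q \<le> a \<and> naive_height q = int h} \<subseteq> (\<Union>k\<le>a. B k (int h) \<union> B k (- int h))"
  proof
    fix q :: "int poly" assume q: "q \<in> {q. degree q \<le> a \<and> naive_height q = int h}"
    obtain k where "k \<le> degree q" "naive_height q = \<bar>coeff q k\<bar>" using naive_height_attained by blast
    then show "q \<in> (\<Union>k\<le>a. B k (int h) \<union> B k (- int h))"
      using q by (intro UN_I[of k]) (auto simp: B_def abs_if split: if_splits)
  qed
  have fin: "finite (\<Union>k\<le>a. B k (int h) \<union> B k (- int h))"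
    by (rule finite_subset[OF _ finite_int_box[of a "real h"]]) (auto simp: B_def int_box_iff)
  have "card {q :: int poly. degree q \<le> a \<and> naive_height q = int h} \<le> card (\<Union>k\<le>a. B k (int h) \<union> B k (- int h))"
    by (rule card_mono[OF fin sub])
  also have "\<dots> \<le> (\<Sum>k\<le>a. card (B k (int h) \<union> B k (- int h)))" by (rule card_UN_le) simp
  also have "\<dots> \<le> (\<Sum>k\<le>a. 2 * (2 * h + 1) ^ a)"
  proof (rule sum_mono)
    fix k assume "k \<in> {..a}"
    then have "card (B k (int h)) \<le> (2 * h + 1) ^ a" "card (B k (- int h)) \<le> (2 * h + 1) ^ a" using cB by auto
    then show "card (B k (int h) \<union> B k (- int h)) \<le> 2 * (2 * h + 1) ^ a"
      using card_Un_le[of "B k (int h)" "B k (- int h)"] by linarith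
  qed
  finally show ?thesis by simp
qed

definition height_pairs :: "nat \<Rightarrow> nat \<Rightarrow> real \<Rightarrow> (int poly \<times> int poly) set" where
  "height_pairs a b X = {(q, r). q \<noteq> 0 \<and> r \<noteq> 0 \<and> degree q \<le> a \<and> degree r \<le> b \<and>
     real_of_int (naive_height q) * real_of_int (naive_height r) \<le> X}"

text \<open>Summation over the height \<open>h\<close> of the first factor; the second then has
  height at most \<open>X / h\<close>. As \<open>X / h \<ge> 1\<close> and \<open>a \<ge> 1\<close>,
  the exponent \<open>b + 1\<close> may be raised to \<open>a + b\<close>, and
  \<open>h\<^sup>a (X / h)\<^sup>a\<^sup>+\<^sup>b\<close> leaves
  \<open>1 / h\<^sup>b\<close>.\<close>

lemma card_height_pairs:
  assumes ab: "1 \<le> a" and X: "1 \<le> X"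
  shows "finite (height_pairs a b X)"
    "card (height_pairs a b X) \<le> 2 * (real a + 1) * 3 ^ (a + b + 1) * X ^ (a + b) * (\<Sum>h=1..nat \<lfloor>X\<rfloor>. 1 / real h ^ b)"
proof -
  define Q where "Q = (\<lambda>h. {q :: int poly. degree q \<le> a \<and> naive_height q = int h})"
  define R where "R = (\<lambda>h. int_box b (X / real h))"
  have finQ: "finite (Q h)" for h
    by (rule finite_subset[OF _ finite_int_box[of a "real h"]]) (auto simp: Q_def int_box_iff)
  have sub: "height_pairs a b X \<subseteq> (\<Union>h\<in>{1..nat \<lfloor>X\<rfloor>}. Q h \<times> R h)"
  proof
    fix x assume "x \<in> height_pairs a b X"
    then obtain q r where x: "x = (q, r)" "q \<noteq> 0" "r \<noteq> 0" "degree q \<le> a" "degree r \<le> b"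
      "real_of_int (naive_height q) * real_of_int (naive_height r) \<le> X" by (auto simp: height_pairs_def)
    define h where "h = nat (naive_height q)"
    have pos: "1 \<le> naive_height q" "1 \<le> naive_height r" using x naive_height_pos by auto
    have hq: "naive_height q = int h" "1 \<le> h" using pos by (auto simp: h_def)
    have le: "real h * real_of_int (naive_height r) \<le> X" using x(6) hq(1) by simp
    have "real h * 1 \<le> real h * real_of_int (naive_height r)" using pos(2) by (intro mult_left_mono) auto
    then have "real h \<le> X" using le by linarith
    then have "h \<in> {1..nat \<lfloor>X\<rfloor>}" using hq(2) by (auto simp: le_nat_floor)
    moreover have "r \<in> R h" using le hq(2) x(5) by (auto simp: R_def int_box_iff field_simps)
    ultimately show "x \<in> (\<Union>h\<in>{1..nat \<lfloor>X\<rfloor>}. Q h \<times> R h)"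
      using x(1,4) hq(1) by (auto simp: Q_def)
  qed
  have fin: "finite (\<Union>h\<in>{1..nat \<lfloor>X\<rfloor>}. Q h \<times> R h)"
    using finQ finite_int_box by (auto simp: R_def)
  show "finite (height_pairs a b X)" using sub fin by (rule finite_subset)
  have "card (height_pairs a b X) \<le> card (\<Union>h\<in>{1..nat \<lfloor>X\<rfloor>}. Q h \<times> R h)"
    by (rule card_mono[OF fin sub])
  also have "\<dots> \<le> (\<Sum>h\<in>{1..nat \<lfloor>X\<rfloor>}. card (Q h \<times> R h))" by (rule card_UN_le) simp
  finally have "real (card (height_pairs a b X)) \<le> (\<Sum>h=1..nat \<lfloor>X\<rfloor>. real (card (Q h)) * real (card (R h)))"
    by (simp only: card_cartesian_product of_nat_mult[symmetric] of_nat_sum[symmetric] of_nat_le_iff)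
  also have "\<dots> \<le> (\<Sum>h=1..nat \<lfloor>X\<rfloor>. 2 * (real a + 1) * 3 ^ (a + b + 1) * X ^ (a + b) * (1 / real h ^ b))"
  proof (rule sum_mono)
    fix h assume "h \<in> {1..nat \<lfloor>X\<rfloor>}"
    then have h: "1 \<le> h" "real h \<le> X" using X by (auto simp: le_nat_iff le_floor_iff)
    have Xh: "1 \<le> X / real h" using h by simp
    have "real (card (Q h)) \<le> real (2 * (a + 1) * (2 * h + 1) ^ a)"
      unfolding Q_def of_nat_le_iff by (rule card_height_eq)
    also have "\<dots> = 2 * (real a + 1) * (2 * real h + 1) ^ a" by (simp add: algebra_simps)
    also have "\<dots> \<le> 2 * (real a + 1) * (3 * real h) ^ a"
      using h by (intro mult_left_mono power_mono) auto
    finally have 1: "real (card (Q h)) \<le> 2 * (real a + 1) * (3 * real h) ^ a" .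
    have "real (card (R h)) \<le> (3 * (X / real h)) ^ (b + 1)" unfolding R_def by (rule card_int_box[OF Xh])
    also have "\<dots> \<le> 3 ^ (b + 1) * (X / real h) ^ (a + b)"
      unfolding power_mult_distrib using Xh ab by (intro mult_left_mono power_increasing) auto
    finally have 2: "real (card (R h)) \<le> 3 ^ (b + 1) * (X / real h) ^ (a + b)" .
    have "real (card (Q h)) * real (card (R h)) \<le> (2 * (real a + 1) * (3 * real h) ^ a) * (3 ^ (b + 1) * (X / real h) ^ (a + b))"
      using 1 2 by (intro mult_mono) auto
    also have "\<dots> = 2 * (real a + 1) * 3 ^ (a + b + 1) * X ^ (a + b) * (1 / real h ^ b)"
      using h by (simp add: power_mult_distrib power_divide power_add field_simps)
    finally show "real (card (Q h)) * real (card (R h)) \<le> 2 * (real a + 1) * 3 ^ (a + b + 1) * X ^ (a + b) * (1 / real h ^ b)" .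
  qed
  finally show "card (height_pairs a b X) \<le> 2 * (real a + 1) * 3 ^ (a + b + 1) * X ^ (a + b) * (\<Sum>h=1..nat \<lfloor>X\<rfloor>. 1 / real h ^ b)"
    by (simp only: sum_distrib_left)
qed

lemma sum_inverse_le_ln:
  assumes "1 \<le> X"
  shows "(\<Sum>h=1..nat \<lfloor>X\<rfloor>. 1 / real h) \<le> 1 + ln X"
proof -
  have "(\<Sum>h=1..Suc n. 1 / real h) \<le> 1 + ln (real (Suc n))" for n
  proof (induction n)
    case (Suc n)
    have "ln (real (Suc n) / real (Suc (Suc n))) \<le> real (Suc n) / real (Suc (Suc n)) - 1"
      by (rule ln_le_minus_one) simp
    then have "1 / real (Suc (Suc n)) \<le> ln (real (Suc (Suc n))) - ln (real (Suc n))"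
      by (simp add: ln_div field_simps)
    then show ?case using Suc by simp
  qed simp
  from this[of "nat \<lfloor>X\<rfloor> - 1"] have "(\<Sum>h=1..nat \<lfloor>X\<rfloor>. 1 / real h) \<le> 1 + ln (real (nat \<lfloor>X\<rfloor>))"
    using assms by (simp add: Suc_diff_le le_nat_iff flip: Suc_diff_1)
  also have "\<dots> \<le> 1 + ln X" using assms by (simp add: of_nat_nat le_nat_iff)
  finally show ?thesis .
qed

lemma sum_inverse_power_le:
  assumes "2 \<le> b"
  shows "(\<Sum>h=1..N. 1 / real h ^ b) \<le> 2"
proof -
  have "(\<Sum>h=1..Suc n. 1 / real h ^ 2) \<le> 2 - 1 / real (Suc n)" for n
  proof (induction n)
    case (Suc n)
    have "1 / real (Suc (Suc n)) ^ 2 \<le> 1 / (real (Suc n) * real (Suc (Suc n)))"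
      unfolding power2_eq_square by (intro divide_left_mono mult_right_mono) auto
    also have "\<dots> = 1 / real (Suc n) - 1 / real (Suc (Suc n))" by (simp add: field_simps)
    finally show ?case using Suc by simp
  qed simp
  moreover have "(\<Sum>h=1..N. 1 / real h ^ b) \<le> (\<Sum>h=1..N. 1 / real h ^ 2)"
    using assms by (intro sum_mono divide_left_mono power_increasing) auto
  ultimately show ?thesis
  proof (cases N)
    case (Suc n)
    assume sq: "\<And>n. (\<Sum>h=1..Suc n. 1 / real h ^ 2) \<le> 2 - 1 / real (Suc n)"
      and le: "(\<Sum>h=1..N. 1 / real h ^ b) \<le> (\<Sum>h=1..N. 1 / real h ^ 2)"
    have "0 \<le> 1 / real (Suc n)" by simp
    then show ?thesis using sq[of n] le unfolding Suc by linarith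
  qed simp
qed

definition reducibles :: "nat \<Rightarrow> real \<Rightarrow> int poly set" where
  "reducibles d H = {p \<in> int_box d H. degree p = d \<and> (\<exists>q r. p = q * r \<and> 1 \<le> degree q \<and> 1 \<le> degree r)}"

text \<open>The factor lost in \<open>naive_height_mult\<close> for a product of degree
  \<open>d\<close>.\<close>

definition height_const :: "nat \<Rightarrow> real" where
  "height_const d = (real d + 1) ^ (3 * d + 3)"

text \<open>With the factor of smaller degree \<open>a \<le> d div 2\<close> put first, the exponent
  \<open>d - a\<close> in the sum over heights is at least 2 unless \<open>d = 2\<close>. Only then
  is the sum harmonic, whence the exponent \<open>l_exp d\<close> of the logarithm.\<close>

lemma card_reducibles:
  assumes d: "2 \<le> d" and H: "2 \<le> H"
  shows "card (reducibles d H) \<le> 40 * real d * (real d + 1) * 3 ^ (d + 1) * height_const d ^ d * H ^ d * ln H ^ l_exp d"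
proof -
  define X where "X = height_const d * H"
  have hc: "1 \<le> height_const d" unfolding height_const_def by (rule one_le_power) simp
  have X: "1 \<le> X" unfolding X_def using mult_mono[of 1 "height_const d" 1 H] hc H by simp
  have lnH: "2 / 3 \<le> ln H"
  proof -
    have "ln 2 \<le> ln H" using H by simp
    then show ?thesis using ln2_ge_two_thirds by linarith
  qed
  have sub: "reducibles d H \<subseteq> (\<Union>a\<in>{1..d div 2}. (\<lambda>(q, r). q * r) ` height_pairs a (d - a) X)"
  proof
    fix p assume p: "p \<in> reducibles d H"
    then obtain q r where qr: "p = q * r" "1 \<le> degree q" "1 \<le> degree r" and pd: "degree p = d" and ph: "real_of_int (naive_height p) \<le> H"
      by (auto simp: reducibles_def int_box_iff)
    have p0: "p \<noteq> 0" using pd d by auto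
    have "\<exists>q r. p = q * r \<and> 1 \<le> degree q \<and> degree q \<le> degree r"
    proof (cases "degree q \<le> degree r")
      case False
      then show ?thesis using qr by (intro exI[of _ r] exI[of _ q]) (auto simp: mult.commute)
    qed (use qr in blast)
    then obtain q r where qr: "p = q * r" "1 \<le> degree q" "degree q \<le> degree r" by blast
    have n: "q \<noteq> 0" "r \<noteq> 0" and deg: "degree q + degree r = d"
      using qr(1) p0 pd by (auto simp: degree_mult_eq)
    have "real_of_int (naive_height q) * real_of_int (naive_height r) \<le> height_const d * real_of_int (naive_height p)"
      using naive_height_mult[of q r] p0 pd unfolding qr(1) height_const_def by simp
    also have "\<dots> \<le> X" unfolding X_def using ph hc by (intro mult_left_mono) auto
    finally have "(q, r) \<in> height_pairs (degree q) (d - degree q) X"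
      using n deg by (auto simp: height_pairs_def)
    moreover have "degree q \<in> {1..d div 2}" using qr(2,3) deg by auto
    ultimately show "p \<in> (\<Union>a\<in>{1..d div 2}. (\<lambda>(q, r). q * r) ` height_pairs a (d - a) X)"
      using qr(1) by (intro UN_I[of "degree q"] image_eqI[of _ _ "(q, r)"]) auto
  qed
  have fin: "finite ((\<lambda>(q, r). q * r) ` height_pairs a (d - a) X)" if "a \<in> {1..d div 2}" for a
    using card_height_pairs(1)[OF _ X, of a "d - a"] that by auto
  define U where "U = 2 * (real d + 1) * 3 ^ (d + 1) * X ^ d * (20 * ln H ^ l_exp d)"
  have "card (reducibles d H) \<le> card (\<Union>a\<in>{1..d div 2}. (\<lambda>(q, r). q * r) ` height_pairs a (d - a) X)"
    using fin by (intro card_mono sub) auto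
  also have "\<dots> \<le> (\<Sum>a\<in>{1..d div 2}. card ((\<lambda>(q, r). q * r) ` height_pairs a (d - a) X))" by (rule card_UN_le) simp
  also have "\<dots> \<le> (\<Sum>a\<in>{1..d div 2}. card (height_pairs a (d - a) X))"
    by (intro sum_mono card_image_le card_height_pairs(1)[OF _ X]) auto
  finally have "real (card (reducibles d H)) \<le> (\<Sum>a=1..d div 2. real (card (height_pairs a (d - a) X)))"
    by (simp only: of_nat_sum[symmetric] of_nat_le_iff)
  also have "\<dots> \<le> (\<Sum>a=1..d div 2. U)"
  proof (rule sum_mono)
    fix a assume "a \<in> {1..d div 2}"
    then have a: "1 \<le> a" "2 * a \<le> d" by auto
    have S: "(\<Sum>h=1..nat \<lfloor>X\<rfloor>. 1 / real h ^ (d - a)) \<le> 20 * ln H ^ l_exp d"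
    proof (cases "d = 2")
      case True
      then have "d - a = 1" using a by auto
      \<comment> \<open>The number 20 comes from \<open>1 + 9 * ln 3 + ln H \<le> 20 * ln H\<close>,
        which uses \<open>ln 3 \<le> 43 / 36\<close> and \<open>ln H \<ge> 2 / 3\<close>.\<close>
      have "X = 3 ^ 9 * H" by (simp add: X_def height_const_def True)
      then have "ln X = ln (3 ^ 9) + ln H" using H by (simp only: ln_mult_pos zero_less_power zero_less_numeral)
      moreover have "ln ((3::real) ^ 9) = real 9 * ln 3" by (rule ln_realpow)
      ultimately have "ln X = 9 * ln 3 + ln H" by simp
      moreover have "ln (3::real) \<le> 43 / 36"
      proof -
        have "ln (3::real) = ln (3 / 2) + ln 2" by (simp add: ln_div)
        then show ?thesis using ln_le_minus_one[of "3 / 2 :: real"] ln2_le_25_over_36 by linarith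
      qed
      ultimately show ?thesis
        using sum_inverse_le_ln[OF X] lnH True \<open>d - a = 1\<close> by (simp add: l_exp_def)
    next
      case False
      then have "2 \<le> d - a" using a d by linarith
      from sum_inverse_power_le[OF this, of "nat \<lfloor>X\<rfloor>"] show ?thesis using False by (simp add: l_exp_def)
    qed
    have "real (card (height_pairs a (d - a) X)) \<le> 2 * (real a + 1) * 3 ^ (d + 1) * X ^ d * (\<Sum>h=1..nat \<lfloor>X\<rfloor>. 1 / real h ^ (d - a))"
    proof -
      have "a + (d - a) = d" using a by simp
      then show ?thesis using card_height_pairs(2)[OF a(1) X, of "d - a"] by (simp only:)
    qed
    also have "\<dots> \<le> U"
      unfolding U_def using a X by (intro mult_mono S) (auto intro!: sum_nonneg)
    finally show "real (card (height_pairs a (d - a) X)) \<le> U" .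
  qed
  also have "\<dots> = real (d div 2) * U" by simp
  also have "\<dots> \<le> real d * U"
    using X lnH by (intro mult_right_mono) (auto simp: U_def)
  also have "\<dots> = 40 * real d * (real d + 1) * 3 ^ (d + 1) * height_const d ^ d * H ^ d * ln H ^ l_exp d"
    by (simp add: U_def X_def power_mult_distrib algebra_simps)
  finally show ?thesis .
qed

section \<open>Algebraic numbers in intervals\<close>

text \<open>Factors must have positive degree, so an integer constant does not count as a factor, in
  contrast to irreducibility in the ring of integer polynomials; the content is controlled
  separately.\<close>

definition splits :: "int poly \<Rightarrow> bool" where
  "splits p \<longleftrightarrow> (\<exists>q r. p = q * r \<and> 1 \<le> degree q \<and> 1 \<le> degree r)"

abbreviation "is_root x p \<equiv> poly (map_poly real_of_int p) x = 0"

lemma map_poly_of_int_add: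
  "map_poly real_of_int (p + q) = map_poly real_of_int p + map_poly real_of_int q"
  by (rule poly_eqI) (simp add: coeff_map_poly)

lemma map_poly_of_int_diff:
  "map_poly real_of_int (p - q) = map_poly real_of_int p - map_poly real_of_int q"
  by (rule poly_eqI) (simp add: coeff_map_poly)

lemma map_poly_of_int_smult:
  "map_poly real_of_int (smult k p) = smult (real_of_int k) (map_poly real_of_int p)"
  by (rule poly_eqI) (simp add: coeff_map_poly)

lemma smult_cancel_int:
  fixes p q :: "int poly"
  assumes "smult k p = smult k q" "k \<noteq> 0"
  shows "p = q"
proof (rule poly_eqI)
  fix n
  have "coeff (smult k p) n = coeff (smult k q) n" by (simp only: assms(1))
  then show "coeff p n = coeff q n" using assms(2) by simp
qed

lemma primitive_minpolyD:
  assumes "primitive_minpoly x p"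
  shows "p \<noteq> 0" "is_root x p" "content p = 1" "0 < lead_coeff p"
    and "\<And>q. q \<noteq> 0 \<Longrightarrow> is_root x q \<Longrightarrow> degree p \<le> degree q"
proof -
  note a = assms[unfolded primitive_minpoly_def]
  show "p \<noteq> 0" "is_root x p" "content p = 1" "0 < lead_coeff p" using a by simp_all
  show "degree p \<le> degree q" if "q \<noteq> 0" "is_root x q" for q
    using conjunct1[OF conjunct2[OF conjunct2[OF a]], rule_format, of q] that by simp
qed

text \<open>Multiplied crosswise by the leading coefficients, the two polynomials have a difference
  that vanishes at \<open>x\<close> and is of smaller degree, hence zero. Content 1 and positivity
  then identify the leading coefficients.\<close>

lemma primitive_minpoly_unique:
  assumes p: "primitive_minpoly x p" and q: "primitive_minpoly x q"
  shows "p = q"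
proof -
  have deg: "degree p = degree q"
  proof (rule le_antisym)
    show "degree p \<le> degree q" by (rule primitive_minpolyD(5)[OF p primitive_minpolyD(1,2)[OF q]])
    show "degree q \<le> degree p" by (rule primitive_minpolyD(5)[OF q primitive_minpolyD(1,2)[OF p]])
  qed
  let ?r = "smult (lead_coeff q) p - smult (lead_coeff p) q"
  have root: "is_root x ?r"
    using primitive_minpolyD(2)[OF p] primitive_minpolyD(2)[OF q]
    by (simp add: map_poly_of_int_smult map_poly_of_int_diff)
  have le: "degree ?r \<le> degree p" using deg by (intro degree_diff_le) (auto intro: order_trans[OF degree_smult_le])
  have c0: "coeff ?r (degree p) = 0" using deg by simp
  have "?r = 0"
  proof (rule ccontr)
    assume "?r \<noteq> 0"
    then have "degree p \<le> degree ?r" using primitive_minpolyD(5)[OF p _ root] by simp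
    with le have "degree ?r = degree p" by simp
    then have "lead_coeff ?r = 0" using c0 by simp
    then show False using \<open>?r \<noteq> 0\<close> by (simp only: leading_coeff_0_iff)
  qed
  then have eq: "smult (lead_coeff q) p = smult (lead_coeff p) q" by simp
  then have "content (smult (lead_coeff q) p) = content (smult (lead_coeff p) q)" by simp
  then have lc: "lead_coeff q = lead_coeff p"
    using primitive_minpolyD(3,4)[OF p] primitive_minpolyD(3,4)[OF q] by simp
  have "smult (lead_coeff p) p = smult (lead_coeff p) q" using eq unfolding lc .
  moreover have "lead_coeff p \<noteq> 0" using primitive_minpolyD(1)[OF p] by simp
  ultimately show ?thesis by (rule smult_cancel_int)
qed

lemma primitive_minpoly_not_splits:
  assumes p: "primitive_minpoly x p"
  shows "\<not> splits p"
proof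
  assume "splits p"
  then obtain q r where qr: "p = q * r" "1 \<le> degree q" "1 \<le> degree r" unfolding splits_def by blast
  have n: "q \<noteq> 0" "r \<noteq> 0" using qr by auto
  then have deg: "degree p = degree q + degree r" using qr(1) by (simp add: degree_mult_eq)
  have "is_root x q \<or> is_root x r"
    using primitive_minpolyD(2)[OF p] unfolding qr(1) by (simp add: map_poly_of_int_mult)
  then have "degree p \<le> degree q \<or> degree p \<le> degree r"
    using primitive_minpolyD(5)[OF p n(1)] primitive_minpolyD(5)[OF p n(2)] by auto
  then show False using deg qr(2,3) by linarith
qed

text \<open>Pseudo-division of \<open>p\<close> by a primitive polynomial \<open>m\<close> of least
  degree with root \<open>x\<close> leaves no remainder, and Gauss's lemma makes \<open>m\<close>
  divide \<open>p\<close> over the integers. Since \<open>p\<close> does not split, the cofactor is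
  constant, so \<open>p\<close> has the least degree as well.\<close>

lemma primitive_minpolyI:
  assumes c: "content p = 1" and l: "0 < lead_coeff p" and x: "is_root x p" and ns: "\<not> splits p"
  shows "primitive_minpoly x p"
proof -
  have p0: "p \<noteq> 0" using c by auto
  define Q where "Q = (\<lambda>m :: int poly. m \<noteq> 0 \<and> is_root x m)"
  obtain m0 where m0: "Q m0" "\<And>m. Q m \<Longrightarrow> degree m0 \<le> degree m"
    using ex_has_least_nat[of Q p degree] p0 x unfolding Q_def by auto
  define m where "m = primitive_part m0"
  have m0m: "smult (content m0) m = m0" by (simp add: m_def)
  have cm0: "content m0 \<noteq> 0" using m0(1) by (simp add: Q_def)
  have mQ: "Q m"
  proof -
    have "map_poly real_of_int m0 = smult (real_of_int (content m0)) (map_poly real_of_int m)"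
      using map_poly_of_int_smult[of "content m0" m] m0m by simp
    then show ?thesis using m0(1) cm0 by (auto simp: Q_def m_def)
  qed
  have mdeg: "degree m = degree m0" by (simp add: m_def)
  have cm: "content m = 1" using m0(1) by (simp add: m_def Q_def content_primitive_part)
  obtain s r where sr: "pseudo_divmod p m = (s, r)" by (cases "pseudo_divmod p m")
  define k where "k = lead_coeff m ^ (Suc (degree p) - degree m)"
  have mn: "m \<noteq> 0" using mQ by (simp add: Q_def)
  have pd: "smult k p = m * s + r" "r = 0 \<or> degree r < degree m"
    using pseudo_divmod[OF mn sr] unfolding k_def by auto
  have k0: "k \<noteq> 0" using mn by (simp add: k_def)
  have "is_root x r"
  proof -
    have "smult (real_of_int k) (map_poly real_of_int p) = map_poly real_of_int m * map_poly real_of_int s + map_poly real_of_int r"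
      unfolding map_poly_of_int_smult[symmetric] map_poly_of_int_mult[symmetric] map_poly_of_int_add[symmetric] pd(1) ..
    from arg_cong[OF this, of "\<lambda>f. poly f x"] show ?thesis using x mQ by (simp add: Q_def)
  qed
  then have r0: "r = 0"
    using pd(2) m0(2)[of r] mdeg by (cases "r = 0") (auto simp: Q_def)
  have eq: "smult k p = m * s" using pd(1) r0 by simp
  then have "content (smult k p) = content (m * s)" by simp
  \<comment> \<open>Gauss's lemma: contents are multiplicative. Therefore the multiplier
    \<open>k\<close> of the pseudo-division can be cancelled from \<open>s\<close>.\<close>
  then have cs: "content s = \<bar>k\<bar>" using c cm by (simp add: content_mult)
  have "s = smult \<bar>k\<bar> (primitive_part s)" using content_times_primitive_part[of s] cs by simp
  then have "smult k p = m * smult \<bar>k\<bar> (primitive_part s)" using eq by simp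
  also have "\<dots> = smult k (m * smult (sgn k) (primitive_part s))"
    by (simp add: abs_sgn mult.commute)
  finally have ps: "p = m * smult (sgn k) (primitive_part s)" using k0 by (rule smult_cancel_int)
  have "1 \<le> degree m"
  proof (rule ccontr)
    assume "\<not> 1 \<le> degree m"
    then have "degree m = 0" by simp
    then obtain a where "m = [:a:]" by (rule degree_eq_zeroE)
    then show False using mQ by (auto simp: Q_def map_poly_pCons)
  qed
  then have "\<not> 1 \<le> degree (smult (sgn k) (primitive_part s))" using ns ps unfolding splits_def by blast
  moreover have "degree p = degree m + degree (smult (sgn k) (primitive_part s))"
  proof -
    have "smult (sgn k) (primitive_part s) \<noteq> 0"
    proof
      assume z: "smult (sgn k) (primitive_part s) = 0"
      show False using p0 unfolding ps z by simp
    qed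
    then show ?thesis using mn by (subst ps) (rule degree_mult_eq)
  qed
  ultimately have "degree p = degree m" by linarith
  then show ?thesis
    unfolding primitive_minpoly_def using c l x p0
  proof (intro conjI allI impI)
    fix q :: "int poly" assume "q \<noteq> 0 \<and> is_root x q"
    then show "degree p \<le> degree q" using m0(2)[of q] mdeg \<open>degree p = degree m\<close> by (simp add: Q_def)
  qed
qed

section \<open>Algebraic numbers as roots of their minimal polynomials\<close>

definition minpolys :: "nat \<Rightarrow> real \<Rightarrow> int poly set" where
  "minpolys d H = {p \<in> int_box d H. degree p = d \<and> content p = 1 \<and> 0 < lead_coeff p \<and> \<not> splits p}"

lemma finite_minpolys: "finite (minpolys d H)"
  by (rule finite_subset[OF _ finite_int_box[of d H]]) (auto simp: minpolys_def)

lemma alg_numbers_eq: "alg_numbers d H = (\<Union>p\<in>minpolys d H. {x. is_root x p})"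
proof
  show "alg_numbers d H \<subseteq> (\<Union>p\<in>minpolys d H. {x. is_root x p})"
  proof
    fix x assume "x \<in> alg_numbers d H"
    then obtain p where p: "primitive_minpoly x p" "degree p = d" "of_int (naive_height p) \<le> H"
      by (auto simp: alg_numbers_def)
    have "p \<in> minpolys d H"
      using p(2,3) primitive_minpoly_not_splits[OF p(1)] primitive_minpolyD[OF p(1)]
      by (simp add: minpolys_def int_box_iff)
    moreover have "is_root x p" by (rule primitive_minpolyD[OF p(1)])
    ultimately show "x \<in> (\<Union>p\<in>minpolys d H. {x. is_root x p})" by auto
  qed
  show "(\<Union>p\<in>minpolys d H. {x. is_root x p}) \<subseteq> alg_numbers d H"
  proof
    fix x assume "x \<in> (\<Union>p\<in>minpolys d H. {x. is_root x p})"
    then obtain p where p: "p \<in> minpolys d H" "is_root x p" by auto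
    have pm: "primitive_minpoly x p" using p by (intro primitive_minpolyI) (auto simp: minpolys_def)
    have "algebraic x"
    proof (rule algebraicI)
      show "coeff (map_poly real_of_int p) i \<in> \<int>" for i by (simp add: coeff_map_poly)
      show "map_poly real_of_int p \<noteq> 0" using primitive_minpolyD(1)[OF pm] by (simp add: map_poly_of_int_eq_0_iff)
      show "is_root x p" by (rule p(2))
    qed
    then show "x \<in> alg_numbers d H"
      using pm p(1) by (auto simp: alg_numbers_def minpolys_def int_box_iff)
  qed
qed

lemma finite_roots: "p \<noteq> 0 \<Longrightarrow> finite {x. is_root x p}"
  by (rule poly_roots_finite) (simp add: map_poly_of_int_eq_0_iff)

lemma minpolys_nonzero: "p \<in> minpolys d H \<Longrightarrow> p \<noteq> 0"
  by (auto simp: minpolys_def)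

lemma finite_alg_numbers: "finite (alg_numbers d H)"
  unfolding alg_numbers_eq by (intro finite_UN_I finite_minpolys finite_roots minpolys_nonzero)

lemma card_alg_numbers: "real (card (alg_numbers d H \<inter> I)) = (\<Sum>p\<in>minpolys d H. zroots I p)"
proof -
  have "alg_numbers d H \<inter> I = (\<Union>p\<in>minpolys d H. {x \<in> I. is_root x p})" by (auto simp: alg_numbers_eq)
  moreover have "card \<dots> = (\<Sum>p\<in>minpolys d H. card {x \<in> I. is_root x p})"
  proof (rule card_UN_disjoint[OF finite_minpolys])
    show "\<forall>p\<in>minpolys d H. finite {x \<in> I. is_root x p}"
    proof
      fix p assume "p \<in> minpolys d H"
      then have "finite {x. is_root x p}" by (intro finite_roots minpolys_nonzero)
      then show "finite {x \<in> I. is_root x p}" by (rule rev_finite_subset) auto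
    qed
    show "\<forall>p\<in>minpolys d H. \<forall>q\<in>minpolys d H. p \<noteq> q \<longrightarrow> {x \<in> I. is_root x p} \<inter> {x \<in> I. is_root x q} = {}"
    proof (intro ballI impI, rule ccontr)
      fix p q assume p: "p \<in> minpolys d H" and q: "q \<in> minpolys d H" and "p \<noteq> q"
        and "{x \<in> I. is_root x p} \<inter> {x \<in> I. is_root x q} \<noteq> {}"
      then obtain x where "is_root x p" "is_root x q" by auto
      then have "primitive_minpoly x p" "primitive_minpoly x q"
        using p q by (auto simp: minpolys_def intro: primitive_minpolyI)
      then show False using primitive_minpoly_unique \<open>p \<noteq> q\<close> by blast
    qed
  qed
  ultimately show ?thesis by (simp add: zroots_def)
qed

text \<open>A primitive polynomial of degree \<open>d\<close> that does not split is a minimal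
  polynomial or the negative of one, never both, and has the same roots as its negative: hence the
  factor 2.\<close>

lemma prim_count_eq:
  assumes d: "1 \<le> d"
  shows "prim_count d I H = 2 * real (card (alg_numbers d H \<inter> I)) +
    (\<Sum>p\<in>{p \<in> int_box d H. content p = 1 \<and> (degree p < d \<or> splits p)}. zroots I p)"
proof -
  let ?M = "minpolys d H" and ?E = "{p \<in> int_box d H. content p = 1 \<and> (degree p < d \<or> splits p)}"
  let ?G = "{p \<in> int_box d H. content p = 1 \<and> degree p = d \<and> \<not> splits p}"
  have fin: "finite ?G" "finite ?E" by (rule finite_subset[OF _ finite_int_box[of d H]]; blast)+
  have sm: "splits (- p)" if sp: "splits p" for p
  proof -
    obtain q r where "p = q * r" "1 \<le> degree q" "1 \<le> degree r" using sp unfolding splits_def by blast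
    then show ?thesis unfolding splits_def by (intro exI[of _ "- q"] exI[of _ r]) auto
  qed
  have sm': "splits (- p) = splits p" for p using sm[of p] sm[of "- p"] by auto
  have cm: "content (- p) = content p" for p :: "int poly" using content_smult[of "-1" p] by simp
  have G: "?G = ?M \<union> uminus ` ?M"
  proof
    show "?G \<subseteq> ?M \<union> uminus ` ?M"
    proof
      fix p assume p: "p \<in> ?G"
      have l: "lead_coeff p \<noteq> 0" using p by auto
      show "p \<in> ?M \<union> uminus ` ?M"
      proof (cases "0 < lead_coeff p")
        case False
        then have "- p \<in> ?M" using p l by (auto simp: minpolys_def int_box_def sm' cm)
        then have "- (- p) \<in> uminus ` ?M" by (rule imageI)
        then show ?thesis by simp
      qed (use p in \<open>auto simp: minpolys_def\<close>)
    qed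
    show "?M \<union> uminus ` ?M \<subseteq> ?G" by (auto simp: minpolys_def int_box_def sm' cm)
  qed
  have dis: "?M \<inter> uminus ` ?M = {}"
  proof (rule equals0I)
    fix p assume "p \<in> ?M \<inter> uminus ` ?M"
    then obtain q where p: "p \<in> ?M" and q: "q \<in> ?M" and pq: "p = - q" by blast
    have "0 < lead_coeff p" using p unfolding minpolys_def by blast
    moreover have "0 < lead_coeff q" using q unfolding minpolys_def by blast
    moreover have "lead_coeff p = - lead_coeff q" unfolding pq by simp
    ultimately show False by linarith
  qed
  have "(\<Sum>p\<in>uminus ` ?M. zroots I p) = (\<Sum>p\<in>?M. zroots I (- p))"
    by (subst sum.reindex) (auto simp: inj_on_def)
  also have "\<dots> = (\<Sum>p\<in>?M. zroots I p)"
    using zroots_smult[of "-1" I] by (intro sum.cong) auto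
  finally have "(\<Sum>p\<in>?G. zroots I p) = 2 * (\<Sum>p\<in>?M. zroots I p)"
    unfolding G using finite_minpolys dis by (subst sum.union_disjoint) auto
  moreover have "{p \<in> int_box d H. content p = 1} = ?G \<union> ?E" by (auto simp: int_box_def)
  moreover have "?G \<inter> ?E = {}" by auto
  ultimately show ?thesis
    unfolding prim_count_def card_alg_numbers using fin by (simp add: sum.union_disjoint)
qed

text \<open>Degree below \<open>d\<close> means one coefficient less, so these polynomials number at
  most \<open>(3 * H) ^ d\<close>; those of full degree are reducible. Each exception has at most
  \<open>d\<close> roots.\<close>

lemma exceptional_sum_bounds:
  fixes H :: real
  assumes d: "2 \<le> d" and H: "2 \<le> H"
  defines "E \<equiv> {p \<in> int_box d H. content p = 1 \<and> (degree p < d \<or> splits p)}"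
  shows "0 \<le> (\<Sum>p\<in>E. zroots I p)"
    "(\<Sum>p\<in>E. zroots I p) \<le> real d * ((3 * H) ^ d + real (card (reducibles d H)))"
proof -
  have n: "p \<noteq> 0" if "p \<in> E" for p using that by (auto simp: E_def)
  show "0 \<le> (\<Sum>p\<in>E. zroots I p)" using n by (intro sum_nonneg zroots_bounds) auto
  have fR: "finite (reducibles d H)"
    by (rule finite_subset[OF _ finite_int_box[of d H]]) (auto simp: reducibles_def)
  have "(\<Sum>p\<in>E. zroots I p) \<le> (\<Sum>p\<in>E. real d)"
  proof (rule sum_mono)
    fix p assume p: "p \<in> E"
    then have "degree p \<le> d" by (auto simp: E_def int_box_def)
    then show "zroots I p \<le> real d" using zroots_bounds(2)[OF n[OF p], of I] by linarith
  qed
  also have "\<dots> = real d * real (card E)" by simp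
  also have "\<dots> \<le> real d * ((3 * H) ^ d + real (card (reducibles d H)))"
  proof (intro mult_left_mono)
    have "E \<subseteq> int_box (d - 1) H \<union> reducibles d H"
      using d by (auto simp: E_def int_box_def reducibles_def splits_def)
    then have "card E \<le> card (int_box (d - 1) H \<union> reducibles d H)"
      using finite_int_box fR by (intro card_mono) auto
    also have "\<dots> \<le> card (int_box (d - 1) H) + card (reducibles d H)" by (rule card_Un_le)
    finally have "real (card E) \<le> real (card (int_box (d - 1) H)) + real (card (reducibles d H))" by linarith
    moreover have "real (card (int_box (d - 1) H)) \<le> (3 * H) ^ d"
      using card_int_box[of H "d - 1"] d H by simp
    ultimately show "real (card E) \<le> (3 * H) ^ d + real (card (reducibles d H))" by linarith
  qed simp
  finally show "(\<Sum>p\<in>E. zroots I p) \<le> real d * ((3 * H) ^ d + real (card (reducibles d H)))" .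
qed

text \<open>The three summands belong to the sieve, to the polynomials of lower degree and to the
  reducible ones. The estimate bounds twice the count: halving it turns 40 into 20, while the other
  two summands lose this 2 when they are multiplied by
  \<open>2 * ln H ^ l_exp d \<ge> 1\<close>.\<close>

definition koleda_const :: "nat \<Rightarrow> real" where
  "koleda_const d = 4 * lattice_const d + real d * 3 ^ d +
     20 * real d ^ 2 * (real d + 1) * 3 ^ (d + 1) * height_const d ^ d"

lemma ln_pow_l_exp_ge: "(2::real) \<le> H \<Longrightarrow> 1 / 2 \<le> ln H ^ l_exp d"
proof -
  assume H: "(2::real) \<le> H"
  have "ln 2 \<le> ln H" using H by simp
  then have "2 / 3 \<le> ln H" using ln2_ge_two_thirds by linarith
  then show ?thesis by (auto simp: l_exp_def)
qed

lemma alg_numbers_in_interval: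
  fixes H :: real
  assumes I: "is_interval I" and d: "2 \<le> d" and H: "2 \<le> H"
  shows "\<bar>real (card (alg_numbers d H \<inter> I)) / H ^ (d + 1) - root_mean d I / (2 * zeta (d + 1))\<bar>
    \<le> koleda_const d * (ln H ^ l_exp d / H)"
proof -
  define A where "A = real (card (alg_numbers d H \<inter> I))"
  define lam where "lam = ln H ^ l_exp d"
  define V where "V = root_mean d I / zeta (d + 1)"
  define R where "R = 40 * real d * (real d + 1) * 3 ^ (d + 1) * height_const d ^ d"
  have lam: "1 / 2 \<le> lam" unfolding lam_def by (rule ln_pow_l_exp_ge[OF H])
  define E where "E = (\<Sum>p\<in>{p \<in> int_box d H. content p = 1 \<and> (degree p < d \<or> splits p)}. zroots I p)"
  have Eb: "0 \<le> E" "E \<le> real d * ((3 * H) ^ d + R * H ^ d * lam)"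
  proof -
    show "0 \<le> E" unfolding E_def by (rule exceptional_sum_bounds[OF d H])
    have "E \<le> real d * ((3 * H) ^ d + real (card (reducibles d H)))"
      unfolding E_def by (rule exceptional_sum_bounds[OF d H])
    also have "\<dots> \<le> real d * ((3 * H) ^ d + R * H ^ d * lam)"
      using card_reducibles[OF d H] by (intro mult_left_mono add_left_mono) (auto simp: R_def lam_def)
    finally show "E \<le> real d * ((3 * H) ^ d + R * H ^ d * lam)" .
  qed
  have "prim_count d I H = 2 * A + E" unfolding A_def E_def using d by (intro prim_count_eq) simp
  moreover have "\<bar>prim_count d I H - V * H ^ (d + 1)\<bar> \<le> 4 * lattice_const d * H ^ d"
    unfolding V_def using H by (intro prim_count_asymp I d) simp
  ultimately have "\<bar>2 * A - V * H ^ (d + 1)\<bar> \<le> 4 * lattice_const d * H ^ d + real d * ((3 * H) ^ d + R * H ^ d * lam)"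
    using Eb by (simp add: abs_le_iff)
  also have "\<dots> = (4 * lattice_const d + real d * 3 ^ d) * H ^ d + real d * R * H ^ d * lam"
    by (simp add: power_mult_distrib algebra_simps)
  also have "\<dots> \<le> (4 * lattice_const d + real d * 3 ^ d) * H ^ d * (2 * lam) + real d * R * H ^ d * lam"
  proof -
    have "0 \<le> (4 * lattice_const d + real d * 3 ^ d) * H ^ d" using H by (auto simp: lattice_const_def)
    from mult_left_mono[OF _ this, of 1 "2 * lam"] show ?thesis using lam by simp
  qed
  also have "\<dots> = 2 * koleda_const d * H ^ d * lam"
    by (simp add: koleda_const_def R_def power2_eq_square algebra_simps)
  finally have main: "\<bar>2 * A - V * H ^ (d + 1)\<bar> \<le> 2 * koleda_const d * H ^ d * lam" .
  have "A / H ^ (d + 1) - root_mean d I / (2 * zeta (d + 1)) = (2 * A - V * H ^ (d + 1)) / (2 * H ^ (d + 1))"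
    using H by (simp add: V_def field_simps)
  then have "\<bar>A / H ^ (d + 1) - root_mean d I / (2 * zeta (d + 1))\<bar> = \<bar>2 * A - V * H ^ (d + 1)\<bar> / (2 * H ^ (d + 1))"
    using H by simp
  also have "\<dots> \<le> 2 * koleda_const d * H ^ d * lam / (2 * H ^ (d + 1))"
    using H by (intro divide_right_mono main) auto
  also have "\<dots> = koleda_const d * (lam / H)" using H by (simp add: field_simps)
  finally show ?thesis unfolding A_def lam_def .
qed

lemma card_alg_numbers_le:
  fixes H :: real
  assumes "1 \<le> H" "1 \<le> d"
  shows "real (card (alg_numbers d H)) / H ^ (d + 1) \<le> real d * 3 ^ (d + 1)"
proof -
  have "real (card (alg_numbers d H \<inter> UNIV)) = (\<Sum>p\<in>minpolys d H. zroots UNIV p)" by (rule card_alg_numbers)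
  also have "\<dots> \<le> (\<Sum>p\<in>minpolys d H. real d)"
  proof (rule sum_mono)
    fix p assume p: "p \<in> minpolys d H"
    then show "zroots UNIV p \<le> real d" using zroots_bounds(2)[OF minpolys_nonzero[OF p], of UNIV] by (simp add: minpolys_def)
  qed
  also have "\<dots> = real d * real (card (minpolys d H))" by simp
  also have "\<dots> \<le> real d * (3 * H) ^ (d + 1)"
  proof (rule mult_left_mono)
    have "card (minpolys d H) \<le> card (int_box d H)"
      by (rule card_mono[OF finite_int_box]) (auto simp: minpolys_def)
    then show "real (card (minpolys d H)) \<le> (3 * H) ^ (d + 1)"
      using card_int_box[OF assms(1), of d] by linarith
  qed simp
  finally have "real (card (alg_numbers d H)) \<le> real d * (3 * H) ^ (d + 1)" by simp
  then show ?thesis using assms by (simp add: divide_le_eq power_mult_distrib mult_ac)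
qed

section \<open>Constants\<close>

text \<open>The term with \<open>height_const\<close> is the largest: the factors of its bound have
  exponents 3, 2, 1, \<open>d + 1\<close> and \<open>(3 * d + 3) * d\<close>, with sum
  \<open>e\<close>. The last unit of the exponent absorbs the sum of three terms, as
  \<open>3 \<le> d + 1\<close>.\<close>

lemma koleda_const_le:
  assumes d: "2 \<le> d"
  shows "koleda_const d \<le> (real d + 1) ^ (3 * d ^ 2 + 4 * d + 8)"
proof -
  define q where "q = real d + 1"
  define e where "e = 3 * d ^ 2 + 4 * d + 7"
  have q: "3 \<le> q" using d by (simp add: q_def)
  have mono: "q ^ i \<le> q ^ j" if "i \<le> j" for i j using q that by (intro power_increasing) auto
  have d0: "real d \<le> q" by (simp add: q_def)
  have p3: "3 ^ i \<le> q ^ i" for i using q by (intro power_mono) auto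
  have "2 * real d + 3 \<le> 3 * q" using q by (simp add: q_def)
  then have "q * (2 * real d + 3) * 3 ^ d \<le> q * (3 * q) * q ^ d"
    using q p3 by (intro mult_mono) auto
  also have "q * (3 * q) * q ^ d \<le> q * (q * q) * q ^ d"
    using q by (intro mult_right_mono mult_left_mono) auto
  also have "\<dots> = q ^ (d + 3)" by (simp add: power_add power3_eq_cube)
  finally have "lattice_const d \<le> q ^ (d + 3) + q ^ (d + 3)"
    using one_le_power[of q "d + 3"] q unfolding lattice_const_def q_def by linarith
  moreover have "0 \<le> q ^ (d + 3)" using q by simp
  ultimately have "4 * lattice_const d \<le> 9 * q ^ (d + 3)" by linarith
  also have "\<dots> \<le> (q * q) * q ^ (d + 3)"
    using mult_mono[OF q q] q by (intro mult_right_mono) auto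
  also have "\<dots> = q ^ (d + 5)" by (simp add: power_add numeral_eq_Suc)
  also have "\<dots> \<le> q ^ e" by (rule mono) (simp add: e_def)
  finally have 1: "4 * lattice_const d \<le> q ^ e" .
  have "real d * 3 ^ d \<le> q * q ^ d" using d0 p3 q by (intro mult_mono) auto
  also have "\<dots> = q ^ (d + 1)" by simp
  also have "\<dots> \<le> q ^ e" by (rule mono) (simp add: e_def)
  finally have 2: "real d * 3 ^ d \<le> q ^ e" .
  have "(27::real) = 3 ^ 3" by simp
  also have "\<dots> \<le> q ^ 3" using q by (intro power_mono) auto
  finally have c: "20 \<le> q ^ 3" by simp
  have "20 * real d ^ 2 * (real d + 1) * 3 ^ (d + 1) * height_const d ^ d \<le> q ^ 3 * q ^ 2 * q * q ^ (d + 1) * (q ^ (3 * d + 3)) ^ d"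
    unfolding height_const_def using c d0 p3 q by (intro mult_mono power_mono) (auto simp: q_def)
  also have "\<dots> = q ^ e"
  proof -
    have "e = 3 + 2 + 1 + (d + 1) + (3 * d + 3) * d" by (simp add: e_def power2_eq_square algebra_simps)
    then show ?thesis by (simp only: power_add power_mult power_one_right)
  qed
  finally have 3: "20 * real d ^ 2 * (real d + 1) * 3 ^ (d + 1) * height_const d ^ d \<le> q ^ e" .
  have "koleda_const d \<le> 3 * q ^ e" using 1 2 3 unfolding koleda_const_def by linarith
  also have "\<dots> \<le> q * q ^ e" using q by (intro mult_right_mono) auto
  also have "\<dots> = (real d + 1) ^ (3 * d ^ 2 + 4 * d + 8)"
  proof -
    have "3 * d ^ 2 + 4 * d + 8 = Suc e" by (simp add: e_def)
    then show ?thesis by (simp only: power_Suc q_def)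
  qed
  finally show ?thesis .
qed

text \<open>Lets one constant serve as interval error and as mass: the first two bounds dominate the
  masses of the discrete and of the continuous factor.\<close>

lemma koleda_const_ge:
  assumes "2 \<le> d"
  shows "real d * 3 ^ (d + 1) \<le> koleda_const d" "(real d + 1) * 2 ^ d \<le> koleda_const d" "1 \<le> koleda_const d"
proof -
  have hc: "0 \<le> height_const d" by (simp add: height_const_def)
  have "0 \<le> 20 * real d ^ 2 * (real d + 1) * 3 ^ (d + 1) * height_const d ^ d"
    using hc by (intro mult_nonneg_nonneg) auto
  then have k: "4 * lattice_const d \<le> koleda_const d"
    unfolding koleda_const_def by simp
  have "(3 * real d) * 3 ^ d \<le> ((real d + 1) * (2 * real d + 3)) * 3 ^ d"
  proof (rule mult_right_mono)
    have "3 * real d \<le> 2 * real d * real d + 5 * real d + 3" by simp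
    then show "3 * real d \<le> (real d + 1) * (2 * real d + 3)" by (simp add: algebra_simps)
  qed simp
  also have "\<dots> \<le> lattice_const d" by (simp add: lattice_const_def)
  also have lc: "\<dots> \<le> 4 * lattice_const d" by (simp add: lattice_const_def)
  finally show "real d * 3 ^ (d + 1) \<le> koleda_const d" using k by simp
  have "(real d + 1) * 2 ^ d \<le> ((real d + 1) * (2 * real d + 3)) * 3 ^ d"
    by (intro mult_mono power_mono) (auto simp: algebra_simps)
  also have "\<dots> \<le> lattice_const d" by (simp add: lattice_const_def)
  finally show "(real d + 1) * 2 ^ d \<le> koleda_const d" using k lc by linarith
  have "1 \<le> lattice_const d" by (simp add: lattice_const_def)
  then show "1 \<le> koleda_const d" using k lc by linarith
qed

text \<open>With \<open>d i + 1 \<le> P ^ 2\<close>, the exponent of \<open>P\<close> needed is at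
  most \<open>16 * (d i + 1) ^ 2 \<le> 4 ^ (d i + 2)\<close>, and \<open>p_const\<close> offers the
  exponent \<open>4 ^ E\<close> with \<open>E \<ge> d i + 2\<close>.\<close>

lemma koleda_const_le_p_const:
  fixes d :: "'n :: finite \<Rightarrow> nat"
  assumes d: "\<And>i. 2 \<le> d i"
  shows "koleda_const (d i) \<le> real (p_const \<phi> d)"
    "4 * P_const \<phi> d \<le> p_const \<phi> d" "2 \<le> P_const \<phi> d" "max_degree \<phi> \<le> P_const \<phi> d"
proof -
  define P where "P = P_const \<phi> d"
  define E where "E = D_const d + CARD('n)"
  define c where "c = (4::nat) ^ ((4 ^ E - 1) div 3)"
  have pc: "p_const \<phi> d = c * P ^ (4 ^ E)" by (simp add: p_const_def P_def E_def c_def)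
  have "d i \<le> (MAX j. d j)" by simp
  also have "\<dots> \<le> P" by (simp add: P_def P_const_def)
  finally have Pd: "d i \<le> P" .
  then show P2: "2 \<le> P_const \<phi> d" using d[of i] by (simp add: P_def)
  show "max_degree \<phi> \<le> P_const \<phi> d" by (simp add: P_const_def)
  have "d i + 1 \<le> D_const d" unfolding D_const_def by (rule member_le_sum) auto
  moreover have "1 \<le> CARD('n)" using zero_less_card_finite[where 'a = 'n] by linarith
  ultimately have E: "d i + 2 \<le> E" unfolding E_def by linarith
  have c4: "4 \<le> c"
  proof -
    have "(4::nat) ^ 1 \<le> 4 ^ E" using E by (intro power_increasing) auto
    then have "1 \<le> (4 ^ E - 1 :: nat) div 3" by simp
    then have "(4::nat) ^ 1 \<le> c" unfolding c_def by (intro power_increasing) auto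
    then show ?thesis by simp
  qed
  have "P ^ 1 \<le> P ^ (4 ^ E)" using P2 by (intro power_increasing) (auto simp: P_def)
  then have "4 * P \<le> c * P ^ (4 ^ E)" using c4 by (intro mult_mono) auto
  then show "4 * P_const \<phi> d \<le> p_const \<phi> d" by (simp add: pc P_def)
  let ?d = "d i"
  have sq: "(?d + 1) ^ 2 \<le> 4 ^ ?d"
  proof -
    have "?d + 1 \<le> 2 ^ ?d" by (induction "?d") (auto simp: Suc_le_eq intro: less_exp)
    then have "(?d + 1) ^ 2 \<le> (2 ^ ?d) ^ 2" by (rule power_mono) simp
    then show ?thesis by (simp add: power_mult[symmetric] mult.commute[of _ 2] power_mult)
  qed
  have "2 * (3 * ?d ^ 2 + 4 * ?d + 8) \<le> 16 * (?d + 1) ^ 2" by (simp add: power2_eq_square algebra_simps)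
  also have "\<dots> \<le> 16 * 4 ^ ?d" using sq by simp
  also have "\<dots> = 4 ^ (?d + 2)" by simp
  also have "\<dots> \<le> 4 ^ E" using E by (intro power_increasing) auto
  finally have ex: "2 * (3 * ?d ^ 2 + 4 * ?d + 8) \<le> 4 ^ E" .
  have "?d + 1 \<le> P ^ 2"
  proof -
    have "?d + 1 \<le> 2 * P" using Pd P2 by (simp add: P_def)
    also have "\<dots> \<le> P * P" using P2 by (simp add: P_def)
    finally show ?thesis by (simp add: power2_eq_square)
  qed
  then have "(?d + 1) ^ (3 * ?d ^ 2 + 4 * ?d + 8) \<le> (P ^ 2) ^ (3 * ?d ^ 2 + 4 * ?d + 8)" by (rule power_mono) simp
  also have "\<dots> = P ^ (2 * (3 * ?d ^ 2 + 4 * ?d + 8))" by (simp only: power_mult)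
  also have "\<dots> \<le> P ^ (4 ^ E)" using P2 ex by (intro power_increasing) (auto simp: P_def)
  also have "\<dots> \<le> p_const \<phi> d" using c4 by (simp add: pc)
  finally have "real ((?d + 1) ^ (3 * ?d ^ 2 + 4 * ?d + 8)) \<le> real (p_const \<phi> d)" by (simp only: of_nat_le_iff)
  then show "koleda_const (d i) \<le> real (p_const \<phi> d)"
    using koleda_const_le[OF d, of i] by (simp add: add.commute)
qed

text \<open>The left-hand side is what the exchange of \<open>N\<close> coordinates costs. Each of
  its factors is at most a power of \<open>p\<close>, with total exponent
  \<open>2 * N + s + 1\<close>; since \<open>3 * S_const \<le> s_const\<close> and
  \<open>s + 3 * N \<le> S_const\<close>, a power inside \<open>M1\<close> exceeds it.\<close>

lemma crude_le_M1:
  fixes \<phi> :: "'v description" and d :: "'n :: finite \<Rightarrow> nat"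
  assumes d: "\<And>i. 2 \<le> d i"
  defines "N \<equiv> CARD('n) ^ 2" and "p \<equiv> real (p_const \<phi> d)"
  shows "real N * (2 * real (num_relations \<phi> * max_degree \<phi>) + 1) * p ^ N \<le> M1 \<phi> d"
proof -
  define n where "n = CARD('n)"
  define s where "s = num_relations \<phi>"
  define S where "S = S_const \<phi> d"
  define sc where "sc = s_const \<phi> d"
  note K = koleda_const_le_p_const[where d = d and \<phi> = \<phi>, OF d]
  have n1: "1 \<le> n" using zero_less_card_finite[where 'a = 'n] unfolding n_def by linarith
  have p: "8 \<le> p" using K(2,3) by (simp add: p_def)
  have "3 * n \<le> D_const d"
  proof -
    have "(\<Sum>i\<in>(UNIV :: 'n set). 3) \<le> D_const d"
      unfolding D_const_def using d by (intro sum_mono) auto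
    then show ?thesis by (simp add: n_def mult.commute)
  qed
  then have "s + n * (3 * n) \<le> S"
    unfolding S_def S_const_def s_def n_def[symmetric] by (intro add_mono mult_le_mono) auto
  then have S: "s + 3 * N \<le> S" by (simp add: N_def n_def power2_eq_square)
  have N1: "1 \<le> N" using n1 by (simp add: N_def n_def)
  have "S ^ 1 \<le> S ^ (2 ^ (D_const d + CARD('n)))" using S N1 by (intro power_increasing) auto
  moreover have "1 \<le> P_const \<phi> d ^ ((16 ^ (D_const d + CARD('n)) - 1) * nat \<lceil>ln (real (P_const \<phi> d)) / ln 2\<rceil>)"
    using K(3) by (intro one_le_power) auto
  ultimately have "3 * S * 1 \<le> sc"
    unfolding sc_def s_const_def S_def[symmetric] by (intro mult_le_mono) auto
  then have ex: "N + s + 1 + N \<le> n + sc" using S N1 n1 by linarith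
  have two: "real k + 1 \<le> p ^ k" for k
  proof -
    have "real k + 1 \<le> 2 ^ k" by (induction k) auto
    also have "\<dots> \<le> p ^ k" using p by (intro power_mono) auto
    finally show ?thesis .
  qed
  have "real (num_relations \<phi> * max_degree \<phi>) * 2 + 1 \<le> (real s + 1) * (2 * real (max_degree \<phi>) + 1)"
    by (simp add: s_def algebra_simps)
  also have "\<dots> \<le> p ^ s * p"
  proof (intro mult_mono two)
    have "2 * max_degree \<phi> + 1 \<le> 4 * P_const \<phi> d" using K(3,4) by linarith
    then have "2 * max_degree \<phi> + 1 \<le> p_const \<phi> d" using K(2) by linarith
    then show "2 * real (max_degree \<phi>) + 1 \<le> p" unfolding p_def by (simp flip: of_nat_le_iff[where 'a = real])
  qed (use p in auto)
  finally have a: "2 * real (num_relations \<phi> * max_degree \<phi>) + 1 \<le> p ^ s * p" by (simp only: mult.commute)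
  have "real N * (2 * real (num_relations \<phi> * max_degree \<phi>) + 1) * p ^ N \<le> p ^ N * (p ^ s * p) * p ^ N"
    using a two[of N] p by (intro mult_right_mono mult_mono) auto
  also have "\<dots> = p ^ (N + s + 1 + N)" by (simp add: power_add)
  also have "\<dots> \<le> p ^ (n + sc)" using ex p by (intro power_increasing) auto
  also have "\<dots> = p * p ^ (n + sc - 1)" using n1 by (simp flip: power_Suc)
  also have "\<dots> \<le> p * (2 * p - 1) ^ (n + sc - 1)" using p by (intro mult_left_mono power_mono) auto
  also have "\<dots> \<le> 2 ^ (n * (2 * D_const d + 1) + 1) * p * (2 * p - 1) ^ (n + sc - 1)"
  proof -
    have "1 * (p * (2 * p - 1) ^ (n + sc - 1)) \<le> 2 ^ (n * (2 * D_const d + 1) + 1) * (p * (2 * p - 1) ^ (n + sc - 1))"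
      using p by (intro mult_right_mono one_le_power) auto
    then show ?thesis by (simp only: mult.assoc mult_1)
  qed
  also have "\<dots> \<le> 2 ^ (n ^ 2) * (MAX i. E1 (d i)) + 2 ^ (n * (2 * D_const d + 1) + 1) * p * (2 * p - 1) ^ (n + sc - 1)"
  proof -
    have "0 \<le> E1 (d undefined)" by (simp add: E1_def)
    also have "\<dots> \<le> (MAX i. E1 (d i))" by simp
    finally show ?thesis by simp
  qed
  also have "\<dots> \<le> real (\<Prod>i\<in>UNIV. d i) ^ n * (2 ^ (n ^ 2) * (MAX i. E1 (d i)) + 2 ^ (n * (2 * D_const d + 1) + 1) * p * (2 * p - 1) ^ (n + sc - 1))"
    (is "?A \<le> ?B * ?A")
  proof -
    have "1 \<le> (\<Prod>i\<in>UNIV. d i)" using d by (intro prod_ge_1) (metis le_trans one_le_numeral)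
    then have "real 1 \<le> real (\<Prod>i\<in>UNIV. d i)" by (simp only: of_nat_le_iff)
    then have "1 \<le> ?B" by (intro one_le_power) (simp only: of_nat_1)
    moreover have "0 \<le> ?A"
    proof -
      have "0 \<le> E1 (d undefined)" by (simp add: E1_def)
      also have "\<dots> \<le> (MAX i. E1 (d i))" by simp
      finally show ?thesis using p by simp
    qed
    ultimately show ?thesis using mult_right_mono[of 1 ?B ?A] by simp
  qed
  also have "\<dots> = M1 \<phi> d" by (simp only: M1_def n_def sc_def p_def)
  finally show ?thesis .
qed

section \<open>Sections along coordinate lines\<close>

text \<open>Freezing all variables but \<open>v0\<close> turns each monomial into a constant times a
  power of \<open>c\<close>, whose exponent is at most the degree of the monomial.\<close>

lemma poly_along_line:
  fixes f :: "'v rpoly"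
  shows "\<exists>q :: real poly. degree q \<le> total_degree f \<and> (\<forall>c. poly q c = rpoly_eval f (w(v0 := c)))"
proof -
  define g where "g = (\<lambda>a :: 'v \<Rightarrow>\<^sub>0 nat. \<lambda>v. if v = v0 then monom 1 (Poly_Mapping.lookup a v) else [:w v ^ Poly_Mapping.lookup a v:] :: real poly)"
  define q where "q = (\<Sum>a\<in>Poly_Mapping.keys f. smult (Poly_Mapping.lookup f a) (\<Prod>v\<in>Poly_Mapping.keys a. g a v))"
  have "degree q \<le> total_degree f"
    unfolding q_def
  proof (rule degree_sum_le[OF finite_keys])
    fix a assume a: "a \<in> Poly_Mapping.keys f"
    have "degree (\<Prod>v\<in>Poly_Mapping.keys a. g a v) \<le> (\<Sum>v\<in>Poly_Mapping.keys a. degree (g a v))"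
      using degree_prod_sum_le[OF finite_keys, of "g a" a] by (simp add: comp_def)
    also have "\<dots> \<le> (\<Sum>v\<in>Poly_Mapping.keys a. Poly_Mapping.lookup a v)"
      by (rule sum_mono) (simp add: g_def degree_monom_le)
    also have "\<dots> \<le> total_degree f"
      unfolding total_degree_def using a by (intro Max_ge) auto
    finally show "degree (smult (Poly_Mapping.lookup f a) (\<Prod>v\<in>Poly_Mapping.keys a. g a v)) \<le> total_degree f"
      by (rule order_trans[OF degree_smult_le])
  qed
  moreover have "poly q c = rpoly_eval f (w(v0 := c))" for c
  proof -
    have "poly (g a v) c = (w(v0 := c)) v ^ Poly_Mapping.lookup a v" for a v by (simp add: g_def poly_monom)
    then show ?thesis by (simp add: q_def rpoly_eval_def poly_sum poly_prod)
  qed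
  ultimately show ?thesis by blast
qed

lemma finite_relations: "finite (relations \<phi>)"
  by (induction \<phi>) auto

lemma holds_cong:
  "(\<And>r. r \<in> relations \<phi> \<Longrightarrow> relation_holds r u \<longleftrightarrow> relation_holds r v) \<Longrightarrow> holds \<phi> u \<longleftrightarrow> holds \<phi> v"
  by (induction \<phi>) auto

lemma poly_sign_constant:
  fixes q :: "real poly"
  assumes "\<And>z. x \<le> z \<Longrightarrow> z \<le> y \<Longrightarrow> poly q z \<noteq> 0" "x < y"
  shows "0 < poly q x \<longleftrightarrow> 0 < poly q y"
proof (rule ccontr)
  assume *: "(0 < poly q x) \<noteq> (0 < poly q y)"
  have n: "poly q x \<noteq> 0" "poly q y \<noteq> 0" using assms by auto
  consider "poly q x < 0" "0 < poly q y" | "0 < poly q x" "poly q y < 0" using * n by linarith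
  then show False
  proof cases
    case 1
    then obtain z where "x < z" "z < y" "poly q z = 0" using poly_IVT_pos[OF assms(2)] by blast
    then show False using assms(1)[of z] by simp
  next
    case 2
    then obtain z where "x < z" "z < y" "poly q z = 0" using poly_IVT_neg[OF assms(2)] by blast
    then show False using assms(1)[of z] by simp
  qed
qed

text \<open>This takes the place of quantifier elimination: only sections along coordinate lines occur.\<close>

lemma holds_constant_on_cells:
  "\<exists>R. finite R \<and> card R \<le> num_relations \<phi> * max_degree \<phi> \<and>
     (\<forall>x y. cell_index R x = cell_index R y \<longrightarrow> holds \<phi> (w(v0 := x)) = holds \<phi> (w(v0 := y)))"
proof -
  have "\<exists>q :: real poly. degree q \<le> total_degree (relation_poly r) \<and> (\<forall>c. poly q c = rpoly_eval (relation_poly r) (w(v0 := c)))" for r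
    by (rule poly_along_line)
  then obtain Q :: "'a relation \<Rightarrow> real poly" where Q: "\<And>r. degree (Q r) \<le> total_degree (relation_poly r)"
    "\<And>r c. rpoly_eval (relation_poly r) (w(v0 := c)) = poly (Q r) c" by metis
  \<comment> \<open>A polynomial that vanishes identically on the line has constant sign 0 and needs
    no cutting points.\<close>
  define Z where "Z = (\<lambda>r. if Q r = 0 then {} else {c. poly (Q r) c = 0})"
  define R where "R = (\<Union>r\<in>relations \<phi>. Z r)"
  have fZ: "finite (Z r)" for r by (simp add: Z_def poly_roots_finite)
  have fR: "finite R" unfolding R_def using finite_relations fZ by blast
  have "card R \<le> (\<Sum>r\<in>relations \<phi>. card (Z r))" unfolding R_def by (rule card_UN_le[OF finite_relations])
  also have "\<dots> \<le> (\<Sum>r\<in>relations \<phi>. max_degree \<phi>)"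
  proof (rule sum_mono)
    fix r assume r: "r \<in> relations \<phi>"
    have "card (Z r) \<le> degree (Q r)" using card_poly_roots_bound[of "Q r"] by (auto simp: Z_def)
    also have "\<dots> \<le> total_degree (relation_poly r)" by (rule Q)
    also have "\<dots> \<le> max_degree \<phi>" unfolding max_degree_def using r finite_relations by (intro Max_ge) auto
    finally show "card (Z r) \<le> max_degree \<phi>" .
  qed
  finally have cR: "card R \<le> num_relations \<phi> * max_degree \<phi>" by (simp add: num_relations_def)
  have less: "holds \<phi> (w(v0 := x)) = holds \<phi> (w(v0 := y))" if xy: "cell_index R x = cell_index R y" "x < y" for x y
  proof (rule holds_cong)
    fix r assume r: "r \<in> relations \<phi>"
    have s: "(poly (Q r) x = 0) = (poly (Q r) y = 0) \<and> (0 < poly (Q r) x) = (0 < poly (Q r) y)"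
    proof (cases "Q r = 0")
      case False
      have n: "poly (Q r) z \<noteq> 0" if "x \<le> z" "z \<le> y" for z
      proof
        assume "poly (Q r) z = 0"
        then have "z \<in> R" using False r by (auto simp: R_def Z_def)
        then show False using cell_index_eqD[OF fR xy] that by fastforce
      qed
      have "poly (Q r) x \<noteq> 0" "poly (Q r) y \<noteq> 0" using n[of x] n[of y] xy(2) by simp_all
      then show ?thesis using poly_sign_constant[OF n xy(2)] by simp
    qed simp
    then have "(0 \<le> poly (Q r) x) = (0 \<le> poly (Q r) y)" by (simp only: order_le_less) metis
    then show "relation_holds r (w(v0 := x)) \<longleftrightarrow> relation_holds r (w(v0 := y))"
      using s Q(2)[of r x] Q(2)[of r y] by (cases r) simp_all
  qed
  have "holds \<phi> (w(v0 := x)) = holds \<phi> (w(v0 := y))" if "cell_index R x = cell_index R y" for x y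
  proof (rule linorder_cases[of x y])
    assume "x < y" with less[OF that] show ?thesis by simp
  next
    assume "y < x" with less[OF that[symmetric]] show ?thesis by simp
  qed simp
  then show ?thesis using fR cR by blast
qed

text \<open>Invariance under equal \<open>cell_index\<close> makes \<open>A\<close> a union of
  cells, of which there are at most \<open>2 * card R + 1\<close>; each is an interval and costs
  \<open>e\<close>.\<close>

lemma measure_diff_union_of_cells:
  assumes M: "mass_le M m" and N: "mass_le N m" and R: "finite R"
    and A: "\<And>x y. cell_index R x = cell_index R y \<Longrightarrow> x \<in> A \<longleftrightarrow> y \<in> A"
    and e: "\<And>I. is_interval I \<Longrightarrow> \<bar>measure M I - measure N I\<bar> \<le> e"
  shows "\<bar>measure M A - measure N A\<bar> \<le> (2 * real (card R) + 1) * e"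
proof -
  note DM = mass_leD[OF M] and DN = mass_leD[OF N]
  interpret M: finite_measure M by (rule DM)
  interpret N: finite_measure N by (rule DN)
  define J where "J = {k. k \<le> 2 * card R \<and> cell R k \<inter> A \<noteq> {}}"
  have fJ: "finite J" by (simp add: J_def)
  have AJ: "A = (\<Union>k\<in>J. cell R k)"
  proof
    show "A \<subseteq> (\<Union>k\<in>J. cell R k)"
    proof
      fix x assume "x \<in> A"
      then have "cell_index R x \<in> J" using cell_index_le[OF R, of x] by (auto simp: J_def cell_def)
      then show "x \<in> (\<Union>k\<in>J. cell R k)" by (rule UN_I) (simp add: cell_def)
    qed
    show "(\<Union>k\<in>J. cell R k) \<subseteq> A"
    proof
      fix x assume "x \<in> (\<Union>k\<in>J. cell R k)"
      then obtain k where k: "k \<in> J" "cell_index R x = k" by (auto simp: cell_def)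
      from k(1) obtain y where "cell_index R y = k" "y \<in> A" by (auto simp: J_def cell_def)
      then show "x \<in> A" using A[of x y] k(2) by simp
    qed
  qed
  have cb: "cell R k \<in> sets borel" for k by (rule is_interval_borel[OF is_interval_cell[OF R]])
  have dis: "disjoint_family_on (cell R) J" by (auto simp: disjoint_family_on_def cell_def)
  have "measure M A = (\<Sum>k\<in>J. measure M (cell R k))"
    unfolding AJ using cb DM(1) by (intro M.finite_measure_finite_Union fJ dis) auto
  moreover have "measure N A = (\<Sum>k\<in>J. measure N (cell R k))"
    unfolding AJ using cb DN(1) by (intro N.finite_measure_finite_Union fJ dis) auto
  ultimately have "\<bar>measure M A - measure N A\<bar> = \<bar>\<Sum>k\<in>J. measure M (cell R k) - measure N (cell R k)\<bar>"
    by (simp add: sum_subtractf)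
  also have "\<dots> \<le> (\<Sum>k\<in>J. e)"
    by (rule order_trans[OF sum_abs sum_mono]) (rule e[OF is_interval_cell[OF R]])
  also have "\<dots> = real (card J) * e" by simp
  also have "\<dots> \<le> (2 * real (card R) + 1) * e"
  proof (rule mult_right_mono)
    have "card J \<le> card {..2 * card R}" by (rule card_mono) (auto simp: J_def)
    then show "real (card J) \<le> 2 * real (card R) + 1" by simp
    show "0 \<le> e" using e[of "{}"] by (simp add: is_interval_empty)
  qed
  finally show ?thesis .
qed

text \<open>The limit density per normalised algebraic number: \<open>zeta (d + 1)\<close> is
  contributed by \<open>sieve\<close> and 2 by \<open>prim_count_eq\<close>.\<close>

definition root_density :: "nat \<Rightarrow> real \<Rightarrow> real" where
  "root_density d x = rho d x / (2 * zeta (d + 1))"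

lemma root_density_measurable: "root_density d \<in> borel_measurable borel"
proof -
  have "(\<lambda>x. rho d x / (2 * zeta (d + 1))) \<in> borel_measurable borel"
    using rho_measurable by (intro borel_measurable_divide) auto
  then show ?thesis by (simp add: root_density_def[abs_def])
qed

lemma root_density_interval:
  assumes d: "2 \<le> d" and I: "is_interval I"
  shows "emeasure (density lborel (\<lambda>x. ennreal (root_density d x))) I = ennreal (root_mean d I / (2 * zeta (d + 1)))"
proof -
  have z: "1 \<le> zeta (d + 1)" using d by (intro zeta_sums) auto
  have Ib: "I \<in> sets borel" by (rule is_interval_borel[OF I])
  have "emeasure (density lborel (\<lambda>x. ennreal (root_density d x))) I = (\<integral>\<^sup>+x. ennreal (root_density d x) * indicator I x \<partial>lborel)"
    using Ib root_density_measurable by (intro emeasure_density) auto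
  also have "\<dots> = (\<integral>\<^sup>+x. ennreal (1 / (2 * zeta (d + 1))) * ennreal (indicator I x * rho d x) \<partial>lborel)"
    using z rho_nonneg[of d] by (intro nn_integral_cong) (auto simp: root_density_def indicator_def simp flip: ennreal_mult')
  also have "\<dots> = ennreal (1 / (2 * zeta (d + 1))) * (\<integral>\<^sup>+x. ennreal (indicator I x * rho d x) \<partial>lborel)"
    using Ib rho_measurable by (intro nn_integral_cmult) auto
  also have "\<dots> = ennreal (1 / (2 * zeta (d + 1))) * ennreal (root_mean d I)" by (simp only: ennreal_root_mean[OF I])
  also have "\<dots> = ennreal (root_mean d I / (2 * zeta (d + 1)))"
    using z root_mean_bounds(1)[OF I] by (subst ennreal_mult[symmetric]) auto
  finally show ?thesis .
qed

lemma mass_le_root_density: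
  assumes d: "2 \<le> d" and c: "koleda_const d \<le> c"
  shows "mass_le (density lborel (\<lambda>x. ennreal (root_density d x))) c"
proof -
  let ?N = "density lborel (\<lambda>x. ennreal (root_density d x))"
  have z: "1 \<le> zeta (d + 1)" using d by (intro zeta_sums) auto
  have U: "is_interval (UNIV :: real set)" by (simp add: is_interval_1)
  have e: "emeasure ?N UNIV = ennreal (root_mean d UNIV / (2 * zeta (d + 1)))" by (rule root_density_interval[OF d U])
  have sp: "space ?N = UNIV" by simp
  have "root_mean d UNIV / (2 * zeta (d + 1)) \<le> (real d + 1) * 2 ^ (d + 1) / 2"
    using root_mean_bounds[OF U, of d] z by (intro frac_le) (auto simp: algebra_simps)
  also have "\<dots> \<le> c" using koleda_const_ge(2)[OF d] c by simp
  finally have "root_mean d UNIV / (2 * zeta (d + 1)) \<le> c" .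
  moreover have "0 \<le> root_mean d UNIV / (2 * zeta (d + 1))" using root_mean_bounds(1)[OF U] z by simp
  ultimately show ?thesis
    unfolding mass_le_def measure_def e by (auto intro!: finite_measureI simp: sp e)
qed

lemma mass_le_alg_numbers:
  assumes d: "2 \<le> d" and H: "2 \<le> H" and c: "koleda_const d \<le> c"
  shows "mass_le (point_masses (alg_numbers d H) (1 / H ^ (d + 1))) c"
proof (rule mass_le_point_masses[OF finite_alg_numbers])
  have "real (card (alg_numbers d H)) / H ^ (d + 1) \<le> real d * 3 ^ (d + 1)"
    using d H by (intro card_alg_numbers_le) auto
  then show "1 / H ^ (d + 1) * real (card (alg_numbers d H)) \<le> c"
    using koleda_const_ge(1)[OF d] c by simp
qed (use H in auto)

lemma interval_masses:
  assumes d: "2 \<le> d" and H: "2 \<le> H" and I: "is_interval I"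
  shows "\<bar>measure (point_masses (alg_numbers d H) (1 / H ^ (d + 1))) I
      - measure (density lborel (\<lambda>x. ennreal (root_density d x))) I\<bar> \<le> koleda_const d * (ln H ^ l_exp d / H)"
proof -
  have z: "1 \<le> zeta (d + 1)" using d by (intro zeta_sums) auto
  have "measure (point_masses (alg_numbers d H) (1 / H ^ (d + 1))) I = real (card (alg_numbers d H \<inter> I)) / H ^ (d + 1)"
    unfolding measure_def using H is_interval_borel[OF I]
    by (subst emeasure_point_masses[OF finite_alg_numbers]) (auto simp: Int_commute)
  moreover have "measure (density lborel (\<lambda>x. ennreal (root_density d x))) I = root_mean d I / (2 * zeta (d + 1))"
    unfolding measure_def root_density_interval[OF d I] using root_mean_bounds(1)[OF I] z by simp
  ultimately show ?thesis using alg_numbers_in_interval[OF I d H] by (simp only:)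
qed

section \<open>Matrices of algebraic numbers\<close>

text \<open>Lebesgue measure on matrices is the image of a product measure indexed by
  \<open>Basis\<close>, so matrix units, instead of pairs of indices, index the coordinates.\<close>

definition entry :: "'n :: finite \<Rightarrow> 'n \<Rightarrow> real ^ 'n ^ 'n" where
  "entry k i = axis k (axis i 1)"

lemma inner_entry: "x \<bullet> entry k i = x $ k $ i"
  by (simp add: entry_def inner_axis)

lemma entry_eq_iff: "entry k i = entry k' i' \<longleftrightarrow> k = k' \<and> i = i'"
  by (auto simp: entry_def axis_eq_axis)

lemma Basis_matrix: "(Basis :: (real ^ 'n :: finite ^ 'n) set) = (\<lambda>(k, i). entry k i) ` UNIV"
  by (auto simp: Basis_vec_def entry_def image_iff)

lemma inj_entry: "inj (\<lambda>(k, i). entry k i)"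
  by (auto simp: inj_on_def entry_eq_iff)

text \<open>The degree and the height of an entry depend on its column alone; this reads the column
  off the matrix unit. Outside \<open>Basis\<close> the value is arbitrary.\<close>

definition entry_column :: "real ^ 'n :: finite ^ 'n \<Rightarrow> 'n" where
  "entry_column b = (SOME i. \<exists>k. b = entry k i)"

lemma entry_column [simp]: "entry_column (entry k i) = i"
proof -
  have "\<exists>k'. entry k i = entry k' (entry_column (entry k i))"
    unfolding entry_column_def by (rule someI[of _ i]) auto
  then show ?thesis by (auto simp: entry_eq_iff)
qed

lemma prod_Basis_matrix:
  fixes f :: "real ^ 'n :: finite ^ 'n \<Rightarrow> real"
  shows "(\<Prod>b\<in>Basis. f b) = (\<Prod>k\<in>UNIV. \<Prod>i\<in>UNIV. f (entry k i))"
  unfolding Basis_matrix prod.reindex[OF inj_entry]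
  by (simp add: prod.cartesian_product comp_def case_prod_unfold)

definition from_coords :: "(real ^ 'n ^ 'n \<Rightarrow> real) \<Rightarrow> real ^ 'n :: finite ^ 'n" where
  "from_coords y = (\<Sum>b\<in>Basis. y b *\<^sub>R b)"

lemma from_coords_nth: "from_coords y $ k $ i = y (entry k i)"
proof -
  have "entry k i \<in> Basis" by (auto simp: Basis_matrix)
  then show ?thesis unfolding inner_entry[symmetric] from_coords_def by simp
qed

lemma from_coords_measurable:
  "from_coords \<in> Pi\<^sub>M Basis (\<lambda>_. borel) \<rightarrow>\<^sub>M (borel :: (real ^ 'n :: finite ^ 'n) measure)"
  unfolding from_coords_def[abs_def]
  by (intro borel_measurable_sum borel_measurable_scaleR borel_measurable_const measurable_component_singleton)

lemma holds_measurable: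
  assumes "\<And>v. (\<lambda>x. g x v) \<in> borel_measurable M"
  shows "{x \<in> space M. holds \<phi> (g x)} \<in> sets M"
proof (induction \<phi>)
  case (Rel r)
  have "(\<lambda>x. rpoly_eval f (g x)) \<in> borel_measurable M" for f
    unfolding rpoly_eval_def using assms
    by (intro borel_measurable_sum borel_measurable_times borel_measurable_prod borel_measurable_power) auto
  note [measurable] = this
  show ?case by (cases r) simp_all
next
  case (Neg \<phi>)
  then show ?case using sets.sets_Collect_neg[of M "\<lambda>x. holds \<phi> (g x)"] by simp
next
  case (Conj \<phi> \<psi>)
  then show ?case using sets.sets_Collect_conj by simp
next
  case (Disj \<phi> \<psi>)
  then show ?case using sets.sets_Collect_disj by simp
qed

lemma joint_point_inj: "joint_point t x = joint_point t' x' \<longleftrightarrow> t = t' \<and> x = x'"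
proof
  assume eq: "joint_point t x = joint_point t' x'"
  have "t $ j = t' $ j" for j using arg_cong[OF eq, of "\<lambda>z. z $ Inl j"] by (simp add: joint_point_def)
  moreover have "x $ k $ i = x' $ k $ i" for k i
    using arg_cong[OF eq, of "\<lambda>z. z $ Inr (k, i)"] by (simp add: joint_point_def)
  ultimately show "t = t' \<and> x = x'" by (simp add: vec_eq_iff)
qed simp

lemma fibre_eq:
  assumes "describes \<phi> (family_graph \<Omega> Z)" "t \<in> \<Omega>"
  shows "Z t = {x. holds \<phi> (\<lambda>v. joint_point t x $ v)}"
proof -
  have "x \<in> Z t \<longleftrightarrow> joint_point t x \<in> family_graph \<Omega> Z" for x
    using assms(2) by (auto simp: family_graph_def joint_point_inj)
  then show ?thesis using assms(1) by (auto simp: describes_def)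
qed

lemma joint_point_measurable: "(\<lambda>x. joint_point t x $ v) \<in> borel_measurable borel"
proof (cases v)
  case (Inr p)
  then show ?thesis
    by (cases p) (auto simp: joint_point_def intro!: borel_measurable_continuous_onI continuous_intros)
qed (simp add: joint_point_def)

theorem theorem4p1:
  fixes d :: "'n :: finite \<Rightarrow> nat"
    and \<Omega> :: "(real ^ 'm :: finite) set"
    and Z :: "real ^ 'm \<Rightarrow> (real ^ 'n ^ 'n) set"
    and \<phi> :: "('m + 'n \<times> 'n) description"
    and t :: "real ^ 'm"
    and H :: "'n \<Rightarrow> real"
  assumes "\<And>i. d i \<ge> 2"
    and "semialgebraic_family \<Omega> Z"
    and "describes \<phi> (family_graph \<Omega> Z)"
    and "\<And>u. u \<in> \<Omega> \<Longrightarrow> bounded (Z u)"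
    and "t \<in> \<Omega>"
    and "\<And>i. H i \<ge> 2"
  shows "\<bar>real (card (alg_matrices d H \<inter> Z t)) / (\<Prod>i\<in>UNIV. H i ^ (CARD('n) * (d i + 1)))
          - (LINT x:Z t | lborel. (\<Prod>k\<in>UNIV. rho_vec d (x $ k) / (2 ^ CARD('n) * zeta_vec d)))\<bar>
         \<le> M1 \<phi> d * (MAX i. ln (H i) ^ l_exp (d i) / H i)"
proof -
  note d = assms(1) and H = assms(6)
  let ?B = "Basis :: (real ^ 'n ^ 'n) set"
  let ?c = "entry_column :: real ^ 'n ^ 'n \<Rightarrow> 'n"
  define C where "C = real (p_const \<phi> d)"
  define \<delta> where "\<delta> = (MAX i. ln (H i) ^ l_exp (d i) / H i)"
  define N where "N = CARD('n) ^ 2"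
  define A where "A = (\<lambda>i. alg_numbers (d i) (H i))"
  define w where "w = (\<lambda>i. 1 / H i ^ (d i + 1))"
  define M where "M = (\<lambda>b. point_masses (A (?c b)) (w (?c b)))"
  define K where "K = (\<lambda>b. density lborel (\<lambda>x. ennreal (root_density (d (?c b)) x)))"
  define L where "L = num_relations \<phi> * max_degree \<phi>"
  define f where "f = (\<lambda>y. indicator (Z t) (from_coords y) :: real)"
  \<comment> \<open>From here on the single number \<open>C\<close> bounds the masses of all factors
    and all interval errors.\<close>
  have kC: "koleda_const (d i) \<le> C" for i unfolding C_def by (rule koleda_const_le_p_const[OF d])
  have C0: "0 \<le> C" by (simp add: C_def)
  have Mm: "mass_le (M b) C" for b
    unfolding M_def A_def w_def by (rule mass_le_alg_numbers[OF d H kC])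
  have Km: "mass_le (K b) C" for b
    unfolding K_def by (rule mass_le_root_density[OF d kC])
  have Zeq: "Z t = {x. holds \<phi> (\<lambda>v. joint_point t x $ v)}" by (rule fibre_eq[OF assms(3,5)])
  have Zb: "Z t \<in> sets borel"
    using holds_measurable[of "\<lambda>x v. joint_point t x $ v" borel \<phi>, OF joint_point_measurable] by (simp add: Zeq)
  have fm: "f \<in> borel_measurable (Pi\<^sub>M ?B (\<lambda>_. borel))"
    unfolding f_def by (rule measurable_compose[OF from_coords_measurable]) (use Zb in simp)
  have fB: "\<bar>f y\<bar> \<le> 1" for y by (simp add: f_def indicator_def)
  have \<delta>: "ln (H i) ^ l_exp (d i) / H i \<le> \<delta>" for i unfolding \<delta>_def by simp
  have \<delta>0: "0 \<le> \<delta>"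
  proof -
    have "0 \<le> ln (H undefined) ^ l_exp (d undefined) / H undefined"
      using H[of undefined] by (intro divide_nonneg_nonneg zero_le_power) auto
    then show ?thesis using \<delta>[of undefined] by linarith
  qed
  have line: "\<bar>(\<integral>x. f (y(b := x)) \<partial>M b) - (\<integral>x. f (y(b := x)) \<partial>K b)\<bar> \<le> (2 * real L + 1) * (C * \<delta>)"
    if b: "b \<in> ?B" and y: "y \<in> space (Pi\<^sub>M (?B - {b}) (\<lambda>_. borel :: real measure))" for b y
  proof -
    obtain k0 i0 where bk: "b = entry k0 i0" using b by (auto simp: Basis_matrix)
    define S where "S = {x. from_coords (y(b := x)) \<in> Z t}"
    have fS: "f (y(b := x)) = indicator S x" for x by (simp add: f_def S_def indicator_def)
    have "(\<lambda>x. f (y(b := x))) \<in> borel_measurable borel" by (rule measurable_fun_upd_line[OF fm b y])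
    then have Sb: "S \<in> sets borel" unfolding fS by (simp add: borel_measurable_indicator_iff)
    have coords: "(\<lambda>v. joint_point t (from_coords (y(b := x))) $ v)
        = (\<lambda>v. joint_point t (from_coords y) $ v)(Inr (k0, i0) := x)" for x
    proof
      fix v
      show "joint_point t (from_coords (y(b := x))) $ v = ((\<lambda>v. joint_point t (from_coords y) $ v)(Inr (k0, i0) := x)) v"
        by (cases v) (auto simp: joint_point_def from_coords_nth bk entry_eq_iff split: prod.split)
    qed
    obtain R where R: "finite R" "card R \<le> L"
      "\<And>u v. cell_index R u = cell_index R v \<Longrightarrow>
         holds \<phi> ((\<lambda>v. joint_point t (from_coords y) $ v)(Inr (k0, i0) := u))
         = holds \<phi> ((\<lambda>v. joint_point t (from_coords y) $ v)(Inr (k0, i0) := v))"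
      using holds_constant_on_cells[of \<phi> "\<lambda>v. joint_point t (from_coords y) $ v" "Inr (k0, i0)"]
      unfolding L_def by auto
    have SR: "u \<in> S \<longleftrightarrow> v \<in> S" if "cell_index R u = cell_index R v" for u v
      using R(3)[OF that] by (simp add: S_def Zeq coords)
    have int: "\<bar>measure (M b) I - measure (K b) I\<bar> \<le> C * \<delta>" if I: "is_interval I" for I
    proof -
      have "\<bar>measure (M b) I - measure (K b) I\<bar> \<le> koleda_const (d (?c b)) * (ln (H (?c b)) ^ l_exp (d (?c b)) / H (?c b))"
        unfolding M_def K_def A_def w_def by (rule interval_masses[OF d H I])
      also have "\<dots> \<le> C * \<delta>"
        using \<delta>0 koleda_const_ge(3)[OF d, of "?c b"] H[of "?c b"]
        by (intro mult_mono kC \<delta> C0 divide_nonneg_nonneg zero_le_power) auto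
      finally show ?thesis .
    qed
    note DM = mass_leD[OF Mm[of b]] and DK = mass_leD[OF Km[of b]]
    interpret M: finite_measure "M b" by (rule DM)
    interpret K: finite_measure "K b" by (rule DK)
    have "(\<integral>x. f (y(b := x)) \<partial>M b) = measure (M b) S" unfolding fS using DM(2) by simp
    moreover have "(\<integral>x. f (y(b := x)) \<partial>K b) = measure (K b) S" unfolding fS using DK(2) by simp
    ultimately have "\<bar>(\<integral>x. f (y(b := x)) \<partial>M b) - (\<integral>x. f (y(b := x)) \<partial>K b)\<bar> \<le> (2 * real (card R) + 1) * (C * \<delta>)"
      using measure_diff_union_of_cells[OF Mm[of b] Km[of b] R(1) SR int] by simp
    also have "\<dots> \<le> (2 * real L + 1) * (C * \<delta>)"
      using R(2) C0 \<delta>0 by (intro mult_right_mono) auto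
    finally show ?thesis .
  qed
  have cB: "card ?B = N"
    unfolding Basis_matrix using card_image[OF inj_entry] by (simp add: N_def power2_eq_square)
  have "\<bar>(\<integral>y. f y \<partial>Pi\<^sub>M ?B M) - (\<integral>y. f y \<partial>Pi\<^sub>M ?B K)\<bar>
      \<le> (\<Sum>b\<in>?B. (2 * real L + 1) * (C * \<delta>) * (\<Prod>b'\<in>?B - {b}. C))"
    by (rule PiM_integral_change_all[OF Mm Km finite_Basis fm fB line])
  also have "\<dots> = (\<Sum>b\<in>?B. (2 * real L + 1) * \<delta> * C ^ N)"
  proof (rule sum.cong[OF refl])
    fix b assume b: "b \<in> ?B"
    \<comment> \<open>The error of the exchanged factor carries the one \<open>C\<close> that its
      absence from the mass product takes away, so every coordinate costs
      \<open>C ^ N\<close>.\<close>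
    have "C * (\<Prod>b'\<in>?B - {b}. C) = (\<Prod>b'\<in>?B. C)" by (rule prod.remove[OF finite_Basis b, symmetric])
    then have CN: "C * (\<Prod>b'\<in>?B - {b}. C) = C ^ N" unfolding prod_constant cB .
    show "(2 * real L + 1) * (C * \<delta>) * (\<Prod>b'\<in>?B - {b}. C) = (2 * real L + 1) * \<delta> * C ^ N"
      unfolding CN[symmetric] by (simp only: mult_ac)
  qed
  also have "\<dots> = (real N * (2 * real L + 1) * C ^ N) * \<delta>" by (simp only: sum_constant cB mult_ac)
  also have "\<dots> \<le> M1 \<phi> d * \<delta>"
    unfolding N_def L_def C_def by (rule mult_right_mono[OF crude_le_M1[OF d] \<delta>0])
  finally have main: "\<bar>(\<integral>y. f y \<partial>Pi\<^sub>M ?B M) - (\<integral>y. f y \<partial>Pi\<^sub>M ?B K)\<bar> \<le> M1 \<phi> d * \<delta>" .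
  have count: "(\<integral>y. f y \<partial>Pi\<^sub>M ?B M) = real (card (alg_matrices d H \<inter> Z t)) / (\<Prod>i\<in>UNIV. H i ^ (CARD('n) * (d i + 1)))"
  proof -
    have fA: "finite (A i)" for i unfolding A_def by (rule finite_alg_numbers)
    have w0: "0 \<le> w i" for i using H[of i] by (simp add: w_def)
    let ?P = "Pi\<^sub>E ?B (\<lambda>b. A (?c b))"
    have fP: "finite ?P" using fA by (intro finite_PiE) auto
    have "(\<integral>y. f y \<partial>Pi\<^sub>M ?B M) = (\<Prod>b\<in>?B. w (?c b)) * (\<Sum>y\<in>?P. f y)"
      unfolding M_def by (rule integral_PiM_point_masses[OF finite_Basis fA w0 fm fB])
    also have "(\<Prod>b\<in>?B. w (?c b)) = 1 / (\<Prod>i\<in>UNIV. H i ^ (CARD('n) * (d i + 1)))"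
    proof -
      \<comment> \<open>Every column meets all rows, so each weight occurs \<open>CARD('n)\<close>
        times; this is the factor \<open>n\<close> in the exponent of \<open>H i\<close>.\<close>
      have "(\<Prod>b\<in>?B. w (?c b)) = (\<Prod>i\<in>UNIV. w i) ^ CARD('n)"
        by (subst prod_Basis_matrix) simp
      also have "\<dots> = (\<Prod>i\<in>UNIV. w i ^ CARD('n))" by (rule prod_power_distrib)
      also have "\<dots> = (\<Prod>i\<in>UNIV. 1 / H i ^ (CARD('n) * (d i + 1)))"
        by (intro prod.cong refl) (simp only: w_def power_one_over power_mult[symmetric] mult.commute)
      finally show ?thesis by (simp add: prod_dividef)
    qed
    also have "(\<Sum>y\<in>?P. f y) = real (card {y \<in> ?P. from_coords y \<in> Z t})"
      unfolding f_def indicator_def using fP by (simp add: sum.If_cases Int_def of_bool_def)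
    also have "card {y \<in> ?P. from_coords y \<in> Z t} = card (alg_matrices d H \<inter> Z t)"
    proof (rule bij_betw_same_card[of from_coords], rule bij_betwI[where g = "\<lambda>x. restrict (\<lambda>b. x \<bullet> b) ?B"])
      have in_B: "entry k i \<in> ?B" for k i by (auto simp: Basis_matrix)
      show "from_coords \<in> {y \<in> ?P. from_coords y \<in> Z t} \<rightarrow> alg_matrices d H \<inter> Z t"
      proof
        fix y assume y: "y \<in> {y \<in> ?P. from_coords y \<in> Z t}"
        have "y (entry k i) \<in> A i" for k i
          using PiE_mem[of y ?B "\<lambda>b. A (?c b)" "entry k i"] y in_B by simp
        then show "from_coords y \<in> alg_matrices d H \<inter> Z t"
          using y by (simp add: alg_matrices_def alg_vectors_def from_coords_nth A_def)
      qed
      have inv: "from_coords (restrict (\<lambda>b. x \<bullet> b) ?B) = x" for x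
        by (simp add: vec_eq_iff from_coords_nth in_B inner_entry)
      show "(\<lambda>x. restrict (\<lambda>b. x \<bullet> b) ?B) \<in> alg_matrices d H \<inter> Z t \<rightarrow> {y \<in> ?P. from_coords y \<in> Z t}"
      proof
        fix x assume x: "x \<in> alg_matrices d H \<inter> Z t"
        have "x \<bullet> b \<in> A (?c b)" if b: "b \<in> ?B" for b
        proof -
          obtain k i where "b = entry k i" using b by (auto simp: Basis_matrix)
          then show ?thesis using x by (simp add: inner_entry alg_matrices_def alg_vectors_def A_def)
        qed
        then have "restrict (\<lambda>b. x \<bullet> b) ?B \<in> ?P" unfolding restrict_PiE_iff by blast
        then show "restrict (\<lambda>b. x \<bullet> b) ?B \<in> {y \<in> ?P. from_coords y \<in> Z t}" using x inv by simp
      qed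
      show "from_coords (restrict (\<lambda>b. x \<bullet> b) ?B) = x" if "x \<in> alg_matrices d H \<inter> Z t" for x by (rule inv)
      show "restrict (\<lambda>b. from_coords y \<bullet> b) ?B = y" if y: "y \<in> {y \<in> ?P. from_coords y \<in> Z t}" for y
      proof
        fix b
        show "restrict (\<lambda>b. from_coords y \<bullet> b) ?B b = y b"
        proof (cases "b \<in> ?B")
          case True
          then show ?thesis by (simp add: from_coords_def)
        next
          case False
          then have "y b = undefined" using y PiE_arb[of y ?B "\<lambda>b. A (?c b)" b] by simp
          then show ?thesis using False by simp
        qed
      qed
    qed
    finally show ?thesis by simp
  qed
  have volume: "(\<integral>y. f y \<partial>Pi\<^sub>M ?B K) = (LINT x:Z t | lborel. (\<Prod>k\<in>UNIV. rho_vec d (x $ k) / (2 ^ CARD('n) * zeta_vec d)))"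
  proof -
    let ?g = "\<lambda>x :: real ^ 'n ^ 'n. \<Prod>k\<in>UNIV. rho_vec d (x $ k) / (2 ^ CARD('n) * zeta_vec d)"
    have z: "1 \<le> zeta (d i + 1)" for i using d[of i] by (intro zeta_sums) auto
    have rd0: "0 \<le> root_density e x" if "2 \<le> e" for e x
    proof -
      have "1 \<le> zeta (e + 1)" using that by (intro zeta_sums) auto
      then show ?thesis using rho_nonneg[of e x] by (simp add: root_density_def)
    qed
    have gx: "?g x = (\<Prod>k\<in>UNIV. \<Prod>i\<in>UNIV. root_density (d i) (x $ k $ i))" for x
    proof (intro prod.cong refl)
      fix k
      have "(2::real) ^ CARD('n) * zeta_vec d = (\<Prod>i\<in>UNIV. 2 * zeta (d i + 1))"
        by (simp add: zeta_vec_def prod.distrib)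
      then show "rho_vec d (x $ k) / (2 ^ CARD('n) * zeta_vec d) = (\<Prod>i\<in>UNIV. root_density (d i) (x $ k $ i))"
        by (simp add: rho_vec_def root_density_def prod_dividef)
    qed
    have gm: "?g \<in> borel_measurable borel"
      unfolding gx
    proof (intro borel_measurable_prod)
      fix k i :: 'n
      have "(\<lambda>x :: real ^ 'n ^ 'n. x $ k $ i) \<in> borel_measurable borel"
        by (intro borel_measurable_continuous_onI continuous_intros)
      then show "(\<lambda>x :: real ^ 'n ^ 'n. root_density (d i) (x $ k $ i)) \<in> borel_measurable borel"
        by (rule measurable_compose[OF _ root_density_measurable])
    qed
    have gc: "?g (from_coords y) = (\<Prod>b\<in>?B. root_density (d (?c b)) (y b))" for y
      unfolding gx prod_Basis_matrix by (simp add: from_coords_nth)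
    have "(LINT x:Z t | lborel. ?g x) = (\<integral>x. indicator (Z t) x *\<^sub>R ?g x \<partial>distr (Pi\<^sub>M ?B (\<lambda>_. lborel)) borel from_coords)"
      unfolding set_lebesgue_integral_def lborel_eq[where 'a = "real ^ 'n ^ 'n"] from_coords_def[abs_def] ..
    also have "\<dots> = (\<integral>y. indicator (Z t) (from_coords y) *\<^sub>R ?g (from_coords y) \<partial>Pi\<^sub>M ?B (\<lambda>_. lborel))"
    proof (rule integral_distr)
      have "sets (Pi\<^sub>M ?B (\<lambda>_. lborel :: real measure)) = sets (Pi\<^sub>M ?B (\<lambda>_. borel))" by (intro sets_PiM_cong) auto
      then show "from_coords \<in> Pi\<^sub>M ?B (\<lambda>_. lborel) \<rightarrow>\<^sub>M borel"
        using from_coords_measurable measurable_cong_sets by blast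
      show "(\<lambda>x. indicator (Z t) x *\<^sub>R ?g x) \<in> borel_measurable borel"
        using Zb gm by (intro borel_measurable_scaleR borel_measurable_indicator)
    qed
    also have "\<dots> = (\<integral>y. (\<Prod>b\<in>?B. root_density (d (?c b)) (y b)) *\<^sub>R f y \<partial>Pi\<^sub>M ?B (\<lambda>_. lborel))"
      unfolding gc f_def by (simp only: real_scaleR_def mult.commute)
    also have "\<dots> = (\<integral>y. f y \<partial>density (Pi\<^sub>M ?B (\<lambda>_. lborel)) (\<lambda>y. ennreal (\<Prod>b\<in>?B. root_density (d (?c b)) (y b))))"
    proof (rule integral_density[symmetric])
      have se: "sets (Pi\<^sub>M ?B (\<lambda>_. lborel :: real measure)) = sets (Pi\<^sub>M ?B (\<lambda>_. borel))" by (intro sets_PiM_cong) auto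
      show "f \<in> borel_measurable (Pi\<^sub>M ?B (\<lambda>_. lborel))" using fm measurable_cong_sets[OF se refl] by blast
      show "(\<lambda>y. \<Prod>b\<in>?B. root_density (d (?c b)) (y b)) \<in> borel_measurable (Pi\<^sub>M ?B (\<lambda>_. lborel))"
      proof (rule borel_measurable_prod)
        fix b assume b: "b \<in> ?B"
        show "(\<lambda>y. root_density (d (?c b)) (y b)) \<in> borel_measurable (Pi\<^sub>M ?B (\<lambda>_. lborel))"
          by (rule measurable_compose[OF measurable_component_singleton[OF b]]) (simp add: root_density_measurable)
      qed
      show "AE y in Pi\<^sub>M ?B (\<lambda>_. lborel). 0 \<le> (\<Prod>b\<in>?B. root_density (d (?c b)) (y b))"
        using rd0[OF d] by (intro AE_I2 prod_nonneg) auto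
    qed
    also have "density (Pi\<^sub>M ?B (\<lambda>_. lborel)) (\<lambda>y. ennreal (\<Prod>b\<in>?B. root_density (d (?c b)) (y b))) = Pi\<^sub>M ?B K"
    proof -
      have "Pi\<^sub>M ?B K = density (Pi\<^sub>M ?B (\<lambda>_. lborel)) (\<lambda>y. \<Prod>b\<in>?B. ennreal (root_density (d (?c b)) (y b)))"
        unfolding K_def
        by (rule PiM_density_lborel[OF finite_Basis]) (use root_density_measurable mass_leD(3)[OF Km, unfolded K_def] in auto)
      then show ?thesis using rd0[OF d] by (simp add: prod_ennreal)
    qed
    finally show ?thesis by simp
  qed
  show ?thesis using main unfolding count volume \<delta>_def .
qed

end
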